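(* Let $T_\alpha\subset M_{t_0}\cong\mathbb S^3_{a_0}$, $0<\alpha<\pi/2$, be a Clifford torus in a time slice of the FLRW Lorentzian manifold $(\mathbb R\times\mathbb S^3,\,-dt^2+a(t)^2g_{\mathbb S^3})$. If $H^2-P^2\neq0$, then, for every constant $\beta\in\mathbb R$, the torus $T_\alpha$ is area-constrained Willmore in the direction $V_\beta=\vec H+\beta\vec H^\star$. The corresponding directional Lagrange multiplier is $\lambda_\beta=\frac{W+\beta W^\star}{H^2-P^2}$, or equivalently, $$ \lambda_\beta(H^2-P^2)=-\frac12(H^2-P^2)^2-\bigl(H^2+P^2-2\beta HP\bigr)\|\mathring B\|_h^2-2H(H-\beta P)\mu-2P(P-\beta H)\operatorname{Ein}(\nu,\nu). $$ If $H^2-P^2=0$, then $T_\alpha$ is area-constrained Willmore in every constant normal direction transverse to $\vec H$.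
   Context: Setting. $a:\mathbb R\to(0,\infty)$ is smooth, $t_0\in\mathbb R$ fixed, $a_0=a(t_0)$, $\mathcal H_0=\dot a(t_0)/a(t_0)$, $M_{t_0}=\{t=t_0\}$ is identified with the round sphere $\mathbb S^3_{a_0}\subset\mathbb C^2$ of radius $a_0$; its second fundamental form is $K=\mathcal H_0g^{M_{t_0}}$ (with $K(X,Y)=\langle\nabla_Xn,Y\rangle$, $n=\partial_t$). The Clifford torus is $T_\alpha=\{(z_1,z_2)\in\mathbb S^3_{a_0}:|z_1|=a_0\cos\alpha,\ |z_2|=a_0\sin\alpha\}$, with induced metric $h$ and unit normal $\nu$ in $M_{t_0}$ such that its principal curvatures are $\kappa_1=\frac{\tan\alpha}{a_0}$, $\kappa_2=-\frac{\cot\alpha}{a_0}$. Hence $H=\kappa_1+\kappa_2$, $\mathring B$ is the trace-free second fundamental form in $M_{t_0}$ with $\|\mathring B\|_h^2=\frac12(\kappa_1-\kappa_2)^2$, and $P=\operatorname{tr}_hK=2\mathcal H_0$. $\operatorname{Ein}=\operatorname{Ric}-\frac12\operatorname{Sc}\,\mathbf g$ is the Einstein tensor of the FLRW metric and $\mu=\operatorname{Ein}(n,n)$. The spacetime mean curvature vector is $\vec H=H\nu-Pn$ (trace of $\chi(X,Y)=-(\nabla_XY)^\perp$), $\vec H^\star=Hn-P\nu$, and $|\vec H|^2=\langle\vec H,\vec H\rangle=H^2-P^2$. For a normal field $V$, $\delta_V$ denotes the derivative at time $0$ along a smooth variation of the surface with initial velocity $V$. $W$ and $W^\star$ are the functions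 on the surface defined by $\delta_{\phi\vec H}\int|\vec H|^2d\mu=\int\phi W\,d\mu$ and $\delta_{\phi\vec H^\star}\int|\vec H|^2d\mu=\int\phi W^\star\,d\mu$ for all smooth $\phi$. For a nowhere-vanishing normal field $V$, a closed spacelike surface $\Sigma$ is area-constrained Willmore in the direction $V$ if it is critical for $\int_\Sigma|\vec H|^2\,d\mu$ under all area-preserving normal variations of the form $\phi V$, $\phi\in C^\infty(\Sigma)$; equivalently, there is a constant $\lambda$ (the Lagrange multiplier) with $\delta_{\phi V}\int_\Sigma|\vec H|^2\,d\mu=\lambda\,\delta_{\phi V}|\Sigma|$ for all $\phi$. A constant normal direction is $V=a\ell+bk$ with constants $a,b\in\mathbb R$ (not both zero), $\ell=n+\nu$, $k=n-\nu$; it is transverse to $\vec H$ (when $\vec H$ is null) if it does not lie in the null line generated by $\vec H$, i.e. $\langle V,\vec H\rangle\ne0$. *)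

theory Defs
  imports "HOL-Analysis.Analysis"
begin

section \<open>Smooth maps\<close>

text \<open>Only used for open \<open>S\<close>.\<close>

fun Ck_on :: "nat \<Rightarrow> 'a::euclidean_space set \<Rightarrow> ('a \<Rightarrow> 'b::euclidean_space) \<Rightarrow> bool" where
  "Ck_on 0 S f \<longleftrightarrow> continuous_on S f"
| "Ck_on (Suc k) S f \<longleftrightarrow>
     (\<forall>x\<in>S. f differentiable (at x)) \<and> (\<forall>v. Ck_on k S (\<lambda>x. frechet_derivative f (at x) v))"

definition smooth_on :: "'a::euclidean_space set \<Rightarrow> ('a \<Rightarrow> 'b::euclidean_space) \<Rightarrow> bool" where
  "smooth_on S f \<longleftrightarrow> (\<forall>k. Ck_on k S f)"

section \<open>The FLRW spacetime\<close>

text \<open>The manifold \<open>\<real> \<times> S\<^sup>3\<close> is the submanifold \<open>spacetime\<close> of \<open>\<real> \<times> \<complex>\<^sup>2\<close>, with \<open>S\<^sup>3\<close> the unit sphere.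
  The slice \<open>t = t0\<close>, whose induced metric is \<open>(a t0)\<^sup>2\<close> times that of the unit sphere, is
  identified with the round sphere of radius \<open>a t0\<close> by \<open>(t0, z) \<mapsto> a t0 *\<^sub>R z\<close>.\<close>

type_synonym event = "real \<times> complex \<times> complex"

definition spacetime :: "event set" where
  "spacetime = {p. norm (snd p) = 1}"

text \<open>For \<open>p\<close> off \<open>spacetime\<close> (but \<open>snd p \<noteq> 0\<close>) this is the tangent space of the concentric cylinder
  through \<open>p\<close>; so a vector field on \<open>spacetime\<close> may be represented by a field on a neighbourhood.\<close>

definition tangent_space :: "event \<Rightarrow> event set" where
  "tangent_space p = {X. snd p \<bullet> snd X = 0}"

definition tangent_part :: "event \<Rightarrow> event \<Rightarrow> event" where
  "tangent_part p X = (fst X, snd X - ((snd p \<bullet> snd X) / (snd p \<bullet> snd p)) *\<^sub>R snd p)"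

text \<open>The FLRW metric \<open>- dt\<^sup>2 + a(t)\<^sup>2 g\<close>, where \<open>g\<close> is the restriction of the Euclidean metric of \<open>\<complex>\<^sup>2\<close>.\<close>

definition flrw :: "(real \<Rightarrow> real) \<Rightarrow> event \<Rightarrow> event \<Rightarrow> event \<Rightarrow> real" where
  "flrw a p X Y = - (fst X * fst Y) + (a (fst p))\<^sup>2 * (snd X \<bullet> snd Y)"

text \<open>The tangent vector that represents the linear form \<open>L\<close> with respect to the metric.\<close>

definition sharp :: "(real \<Rightarrow> real) \<Rightarrow> event \<Rightarrow> (event \<Rightarrow> real) \<Rightarrow> event" where
  "sharp a p L = (THE Z. Z \<in> tangent_space p \<and> (\<forall>U\<in>tangent_space p. flrw a p Z U = L U))"

definition d_flrw :: "(real \<Rightarrow> real) \<Rightarrow> event \<Rightarrow> event \<Rightarrow> event \<Rightarrow> event \<Rightarrow> real" where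
  "d_flrw a p W X Y = frechet_derivative (\<lambda>q. flrw a q X Y) (at p) W"

text \<open>The value of the Levi-Civita derivative of a tangent vector field with value \<open>Y\<close> at \<open>p\<close>, in the
  direction of \<open>X\<close>, where \<open>DY\<close> is the ordinary derivative of the field in that direction. This is
  the Koszul formula: for tangent vector fields \<open>X\<close>, \<open>Y\<close>, \<open>U\<close> expand each term of
  \<open>X\<langle>Y,U\<rangle> + Y\<langle>X,U\<rangle> - U\<langle>X,Y\<rangle> + \<langle>[X,Y],U\<rangle> - \<langle>[X,U],Y\<rangle> - \<langle>[Y,U],X\<rangle>\<close> by the product rule; all derivatives
  of vector fields except \<open>2 \<langle>D\<^sub>X Y, U\<rangle>\<close> cancel.\<close>

definition levi_civita :: "(real \<Rightarrow> real) \<Rightarrow> event \<Rightarrow> event \<Rightarrow> event \<Rightarrow> event \<Rightarrow> event" where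
  "levi_civita a p X Y DY = sharp a p
     (\<lambda>U. flrw a p DY U + (d_flrw a p X Y U + d_flrw a p Y X U - d_flrw a p U X Y) / 2)"

definition nabla :: "(real \<Rightarrow> real) \<Rightarrow> (event \<Rightarrow> event) \<Rightarrow> (event \<Rightarrow> event) \<Rightarrow> event \<Rightarrow> event" where
  "nabla a X Y = (\<lambda>q. levi_civita a q (X q) (Y q) (frechet_derivative Y (at q) (X q)))"

definition lie_bracket :: "(event \<Rightarrow> event) \<Rightarrow> (event \<Rightarrow> event) \<Rightarrow> event \<Rightarrow> event" where
  "lie_bracket X Y = (\<lambda>q. frechet_derivative Y (at q) (X q) - frechet_derivative X (at q) (Y q))"

definition riemann ::
  "(real \<Rightarrow> real) \<Rightarrow> (event \<Rightarrow> event) \<Rightarrow> (event \<Rightarrow> event) \<Rightarrow> (event \<Rightarrow> event) \<Rightarrow> event \<Rightarrow> event" where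
  "riemann a X Y Z = (\<lambda>q. nabla a X (nabla a Y Z) q - nabla a Y (nabla a X Z) q
                          - nabla a (lie_bracket X Y) Z q)"

text \<open>Tangent vectors \<open>Y\<close>, \<open>Z\<close> at \<open>p\<close> are extended to the tangent vector fields
  \<open>q \<mapsto> tangent_part q Y\<close>, \<open>q \<mapsto> tangent_part q Z\<close>. As \<open>X \<mapsto> R(X,Y)Z\<close> is tangent-valued, its trace on the
  tangent space is that of its composition with \<open>tangent_part p\<close> on the ambient space.\<close>

definition Ric :: "(real \<Rightarrow> real) \<Rightarrow> event \<Rightarrow> event \<Rightarrow> event \<Rightarrow> real" where
  "Ric a p Y Z = (\<Sum>b\<in>Basis. riemann a (\<lambda>q. tangent_part q b) (\<lambda>q. tangent_part q Y)
                                       (\<lambda>q. tangent_part q Z) p \<bullet> b)"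

definition Sc :: "(real \<Rightarrow> real) \<Rightarrow> event \<Rightarrow> real" where
  "Sc a p = (\<Sum>b\<in>Basis. sharp a p (Ric a p (tangent_part p b)) \<bullet> b)"

definition Ein :: "(real \<Rightarrow> real) \<Rightarrow> event \<Rightarrow> event \<Rightarrow> event \<Rightarrow> real" where
  "Ein a p X Y = Ric a p X Y - Sc a p / 2 * flrw a p X Y"

section \<open>Spacelike tori\<close>

text \<open>A torus in spacetime is parametrized by a map on \<open>\<real>\<^sup>2\<close> which has period \<open>2 * pi\<close> in both variables,
  and functions and vector fields on it are maps on \<open>\<real>\<^sup>2\<close> with the same periods.\<close>

definition biperiodic :: "(real \<times> real \<Rightarrow> 'b) \<Rightarrow> bool" where
  "biperiodic f \<longleftrightarrow> (\<forall>u v. f (u + 2 * pi, v) = f (u, v) \<and> f (u, v + 2 * pi) = f (u, v))"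

definition smooth_torus_map :: "(real \<times> real \<Rightarrow> 'b::euclidean_space) \<Rightarrow> bool" where
  "smooth_torus_map f \<longleftrightarrow> smooth_on UNIV f \<and> biperiodic f"

definition spacelike_torus :: "(real \<Rightarrow> real) \<Rightarrow> (real \<times> real \<Rightarrow> event) \<Rightarrow> bool" where
  "spacelike_torus a f \<longleftrightarrow> smooth_torus_map f \<and> range f \<subseteq> spacetime \<and>
     (\<forall>u v. v \<noteq> 0 \<longrightarrow>
        flrw a (f u) (frechet_derivative f (at u) v) (frechet_derivative f (at u) v) > 0)"

abbreviation e1 :: "real \<times> real" where "e1 \<equiv> (1, 0)"
abbreviation e2 :: "real \<times> real" where "e2 \<equiv> (0, 1)"

abbreviation partial :: "real \<times> real \<Rightarrow> (real \<times> real \<Rightarrow> event) \<Rightarrow> real \<times> real \<Rightarrow> event" where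
  "partial i f u \<equiv> frechet_derivative f (at u) i"

definition induced_metric ::
  "(real \<Rightarrow> real) \<Rightarrow> (real \<times> real \<Rightarrow> event) \<Rightarrow> real \<times> real \<Rightarrow> real \<times> real \<Rightarrow> real \<times> real \<Rightarrow> real" where
  "induced_metric a f u i j = flrw a (f u) (partial i f u) (partial j f u)"

definition gram :: "(real \<Rightarrow> real) \<Rightarrow> (real \<times> real \<Rightarrow> event) \<Rightarrow> real \<times> real \<Rightarrow> real" where
  "gram a f u = induced_metric a f u e1 e1 * induced_metric a f u e2 e2
                - (induced_metric a f u e1 e2)\<^sup>2"

text \<open>The trace \<open>h\<^sup>i\<^sup>j T\<^sub>i\<^sub>j\<close> with respect to the induced metric \<open>h\<close>, with \<open>h\<^sup>i\<^sup>j\<close> the inverse matrix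
  of \<open>h\<^sub>i\<^sub>j\<close>.\<close>

definition tr_h :: "(real \<Rightarrow> real) \<Rightarrow> (real \<times> real \<Rightarrow> event) \<Rightarrow> real \<times> real \<Rightarrow>
    (real \<times> real \<Rightarrow> real \<times> real \<Rightarrow> 'b::real_vector) \<Rightarrow> 'b" where
  "tr_h a f u T = (1 / gram a f u) *\<^sub>R
     (induced_metric a f u e2 e2 *\<^sub>R T e1 e1 - induced_metric a f u e1 e2 *\<^sub>R T e1 e2
      - induced_metric a f u e2 e1 *\<^sub>R T e2 e1 + induced_metric a f u e1 e1 *\<^sub>R T e2 e2)"

text \<open>The covariant derivative of a vector field along \<open>f\<close> with respect to the parameter direction \<open>i\<close>.\<close>

definition nabla_along ::
  "(real \<Rightarrow> real) \<Rightarrow> (real \<times> real \<Rightarrow> event) \<Rightarrow> real \<times> real \<Rightarrow> (real \<times> real \<Rightarrow> event) \<Rightarrow> real \<times> real \<Rightarrow> event"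
  where
  "nabla_along a f i V u = levi_civita a (f u) (partial i f u) (V u) (partial i V u)"

definition normal_part ::
  "(real \<Rightarrow> real) \<Rightarrow> (real \<times> real \<Rightarrow> event) \<Rightarrow> real \<times> real \<Rightarrow> event \<Rightarrow> event" where
  "normal_part a f u X = X - tr_h a f u (\<lambda>i j. flrw a (f u) X (partial i f u) *\<^sub>R partial j f u)"

definition chi :: "(real \<Rightarrow> real) \<Rightarrow> (real \<times> real \<Rightarrow> event) \<Rightarrow> real \<times> real \<Rightarrow>
    real \<times> real \<Rightarrow> real \<times> real \<Rightarrow> event" where
  "chi a f u i j = - normal_part a f u (nabla_along a f i (partial j f) u)"

definition mean_curvature_vector :: "(real \<Rightarrow> real) \<Rightarrow> (real \<times> real \<Rightarrow> event) \<Rightarrow> real \<times> real \<Rightarrow> event" where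
  "mean_curvature_vector a f u = tr_h a f u (chi a f u)"

text \<open>The second fundamental form \<open>\<langle>\<nabla>\<^sub>X N, Y\<rangle>\<close> for a unit normal field \<open>N\<close>. If \<open>N\<close> and the
  surface are tangent to a slice \<open>t = t0\<close>, then the spacetime connection may be used in place of
  that of the slice, since the two differ by a multiple of \<open>\<partial>\<^sub>t\<close>.\<close>

definition second_form :: "(real \<Rightarrow> real) \<Rightarrow> (real \<times> real \<Rightarrow> event) \<Rightarrow> (real \<times> real \<Rightarrow> event) \<Rightarrow>
    real \<times> real \<Rightarrow> real \<times> real \<Rightarrow> real \<times> real \<Rightarrow> real" where
  "second_form a f N u i j = flrw a (f u) (nabla_along a f i N u) (partial j f u)"

definition tracefree_form :: "(real \<Rightarrow> real) \<Rightarrow> (real \<times> real \<Rightarrow> event) \<Rightarrow> (real \<times> real \<Rightarrow> event) \<Rightarrow>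
    real \<times> real \<Rightarrow> real \<times> real \<Rightarrow> real \<times> real \<Rightarrow> real" where
  "tracefree_form a f N u i j =
     second_form a f N u i j - tr_h a f u (second_form a f N u) / 2 * induced_metric a f u i j"

definition norm_h_sq :: "(real \<Rightarrow> real) \<Rightarrow> (real \<times> real \<Rightarrow> event) \<Rightarrow> real \<times> real \<Rightarrow>
    (real \<times> real \<Rightarrow> real \<times> real \<Rightarrow> real) \<Rightarrow> real" where
  "norm_h_sq a f u T = tr_h a f u (\<lambda>i k. tr_h a f u (\<lambda>j l. T i j * T k l))"

section \<open>The Willmore functional and its first variation\<close>

definition surface_integral ::
  "(real \<Rightarrow> real) \<Rightarrow> (real \<times> real \<Rightarrow> event) \<Rightarrow> (real \<times> real \<Rightarrow> real) \<Rightarrow> real" where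
  "surface_integral a f \<psi> =
     integral (cbox (0, 0) (2 * pi, 2 * pi)) (\<lambda>u. \<psi> u * sqrt (gram a f u))"

definition area :: "(real \<Rightarrow> real) \<Rightarrow> (real \<times> real \<Rightarrow> event) \<Rightarrow> real" where
  "area a f = surface_integral a f (\<lambda>_. 1)"

definition willmore :: "(real \<Rightarrow> real) \<Rightarrow> (real \<times> real \<Rightarrow> event) \<Rightarrow> real" where
  "willmore a f = surface_integral a f
     (\<lambda>u. flrw a (f u) (mean_curvature_vector a f u) (mean_curvature_vector a f u))"

definition variation :: "(real \<Rightarrow> real) \<Rightarrow> (real \<times> real \<Rightarrow> event) \<Rightarrow> (real \<times> real \<Rightarrow> event) \<Rightarrow>
    real \<Rightarrow> (real \<Rightarrow> real \<times> real \<Rightarrow> event) \<Rightarrow> bool" where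
  "variation a f V \<epsilon> F \<longleftrightarrow> \<epsilon> > 0 \<and>
     smooth_on ({-\<epsilon><..<\<epsilon>} \<times> UNIV) (\<lambda>(s, u). F s u) \<and>
     (\<forall>s\<in>{-\<epsilon><..<\<epsilon>}. spacelike_torus a (F s)) \<and>
     F 0 = f \<and>
     (\<forall>u. ((\<lambda>s. F s u) has_vector_derivative V u) (at 0))"

text \<open>\<open>W\<close> is the function with \<open>\<delta>\<^sub>\<phi>\<^sub>V \<integral>|H|\<^sup>2 d\<mu> = \<integral> \<phi> W d\<mu>\<close> for all smooth \<open>\<phi>\<close>.\<close>

definition willmore_gradient :: "(real \<Rightarrow> real) \<Rightarrow> (real \<times> real \<Rightarrow> event) \<Rightarrow> (real \<times> real \<Rightarrow> event) \<Rightarrow>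
    (real \<times> real \<Rightarrow> real) \<Rightarrow> bool" where
  "willmore_gradient a f V W \<longleftrightarrow> smooth_torus_map W \<and>
     (\<forall>\<phi> \<epsilon> F. smooth_torus_map \<phi> \<longrightarrow> variation a f (\<lambda>u. \<phi> u *\<^sub>R V u) \<epsilon> F \<longrightarrow>
        ((\<lambda>s. willmore a (F s)) has_real_derivative surface_integral a f (\<lambda>u. \<phi> u * W u)) (at 0))"

definition normal_field :: "(real \<Rightarrow> real) \<Rightarrow> (real \<times> real \<Rightarrow> event) \<Rightarrow> (real \<times> real \<Rightarrow> event) \<Rightarrow> bool" where
  "normal_field a f V \<longleftrightarrow> smooth_torus_map V \<and>
     (\<forall>u. V u \<in> tangent_space (f u) \<and> (\<forall>v. flrw a (f u) (V u) (frechet_derivative f (at u) v) = 0))"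

definition area_constrained_willmore ::
  "(real \<Rightarrow> real) \<Rightarrow> (real \<times> real \<Rightarrow> event) \<Rightarrow> (real \<times> real \<Rightarrow> event) \<Rightarrow> bool" where
  "area_constrained_willmore a f V \<longleftrightarrow>
     spacelike_torus a f \<and> normal_field a f V \<and> (\<forall>u. V u \<noteq> 0) \<and>
     (\<forall>\<phi> \<epsilon> F. smooth_torus_map \<phi> \<longrightarrow> variation a f (\<lambda>u. \<phi> u *\<^sub>R V u) \<epsilon> F \<longrightarrow>
        (\<forall>s\<in>{-\<epsilon><..<\<epsilon>}. area a (F s) = area a f) \<longrightarrow>
        ((\<lambda>s. willmore a (F s)) has_real_derivative 0) (at 0))"

definition lagrange_multiplier ::
  "(real \<Rightarrow> real) \<Rightarrow> (real \<times> real \<Rightarrow> event) \<Rightarrow> (real \<times> real \<Rightarrow> event) \<Rightarrow> real \<Rightarrow> bool" where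
  "lagrange_multiplier a f V lam \<longleftrightarrow>
     (\<forall>\<phi> \<epsilon> F. smooth_torus_map \<phi> \<longrightarrow> variation a f (\<lambda>u. \<phi> u *\<^sub>R V u) \<epsilon> F \<longrightarrow>
        (\<exists>A. ((\<lambda>s. area a (F s)) has_real_derivative A) (at 0) \<and>
             ((\<lambda>s. willmore a (F s)) has_real_derivative lam * A) (at 0)))"

section \<open>Clifford tori\<close>

definition clifford_torus :: "(real \<Rightarrow> real) \<Rightarrow> real \<Rightarrow> real \<Rightarrow> event set" where
  "clifford_torus a t0 \<alpha> = {(t, z1, z2) \<in> spacetime. t = t0 \<and>
     cmod (a t0 *\<^sub>R z1) = a t0 * cos \<alpha> \<and> cmod (a t0 *\<^sub>R z2) = a t0 * sin \<alpha>}"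

definition clifford :: "real \<Rightarrow> real \<Rightarrow> real \<times> real \<Rightarrow> event" where
  "clifford t0 \<alpha> = (\<lambda>(u, v). (t0, cos \<alpha> *\<^sub>R cis u, sin \<alpha> *\<^sub>R cis v))"

lemma range_clifford:
  assumes "a t0 > 0" "0 < \<alpha>" "\<alpha> < pi / 2"
  shows "range (clifford t0 \<alpha>) = clifford_torus a t0 \<alpha>"
proof -
  have c: "cos \<alpha> > 0" using assms by (intro cos_gt_zero_pi) auto
  have s: "sin \<alpha> > 0" using assms by (intro sin_gt_zero) auto
  have "p \<in> range (clifford t0 \<alpha>)" if "p \<in> clifford_torus a t0 \<alpha>" for p
  proof -
    obtain t z1 z2 where "p = (t, z1, z2)" by (cases p)
    with that assms(1) have p: "p = (t0, z1, z2)" "cmod z1 = cos \<alpha>" "cmod z2 = sin \<alpha>"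
      by (auto simp: clifford_torus_def)
    have "p = clifford t0 \<alpha> (Arg z1, Arg z2)"
      using p rcis_cmod_Arg[of z1] rcis_cmod_Arg[of z2]
      by (simp add: clifford_def rcis_def scaleR_conv_of_real)
    then show ?thesis by blast
  qed
  moreover have "clifford t0 \<alpha> u \<in> clifford_torus a t0 \<alpha>" for u
    using assms c s
    by (auto simp: clifford_def clifford_torus_def spacetime_def norm_prod_def norm_mult split: prod.splits)
  ultimately show ?thesis by blast
qed

text \<open>Injectivity up to the periods.\<close>

lemma clifford_eq_iff:
  assumes "0 < \<alpha>" "\<alpha> < pi / 2"
  shows "clifford t0 \<alpha> (u, v) = clifford t0 \<alpha> (u', v') \<longleftrightarrow> cis u = cis u' \<and> cis v = cis v'"
proof -
  have "cos \<alpha> > 0" using assms by (intro cos_gt_zero_pi) auto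
  moreover have "sin \<alpha> > 0" using assms by (intro sin_gt_zero) auto
  ultimately show ?thesis by (auto simp: clifford_def)
qed

text \<open>\<open>n = \<partial>\<^sub>t\<close>, and the unit normal \<open>\<nu>\<close> within the slice for which the principal curvatures are
  \<open>tan \<alpha> / a t0\<close> along the first and \<open>- cot \<alpha> / a t0\<close> along the second circle; see
  \<open>clifford_principal_curvatures\<close> below.\<close>

definition time_normal :: "real \<times> real \<Rightarrow> event" where
  "time_normal = (\<lambda>u. (1, 0, 0))"

definition clifford_normal :: "(real \<Rightarrow> real) \<Rightarrow> real \<Rightarrow> real \<Rightarrow> real \<times> real \<Rightarrow> event" where
  "clifford_normal a t0 \<alpha> =
     (\<lambda>(u, v). (0, (sin \<alpha> / a t0) *\<^sub>R cis u, (- cos \<alpha> / a t0) *\<^sub>R cis v))"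

lemma sharp_eqI:
  assumes a: "a (fst p) > 0" and Z: "Z \<in> tangent_space p"
    and L: "\<And>U. U \<in> tangent_space p \<Longrightarrow> flrw a p Z U = L U"
  shows "sharp a p L = Z"
  unfolding sharp_def
proof (rule the_equality)
  show "Z \<in> tangent_space p \<and> (\<forall>U\<in>tangent_space p. flrw a p Z U = L U)"
    using Z L by blast
next
  fix Y assume Y: "Y \<in> tangent_space p \<and> (\<forall>U\<in>tangent_space p. flrw a p Y U = L U)"
  have eq: "flrw a p Y U = flrw a p Z U" if "U \<in> tangent_space p" for U
    using that Y L by simp
  have "(1, 0) \<in> tangent_space p" by (simp add: tangent_space_def)
  from eq[OF this] have 1: "fst Y = fst Z" by (simp add: flrw_def)
  have "(0, snd Y - snd Z) \<in> tangent_space p"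
    using Y Z by (simp add: tangent_space_def inner_diff_right)
  from eq[OF this] have "(a (fst p))\<^sup>2 * ((snd Y - snd Z) \<bullet> (snd Y - snd Z)) = 0"
    by (simp add: flrw_def inner_diff_left right_diff_distrib)
  then have "snd Y = snd Z" using a by simp
  with 1 show "Y = Z" by (simp add: prod_eq_iff)
qed

lemma d_flrw_eq:
  assumes a: "(a has_real_derivative a') (at (fst p))"
  shows "d_flrw a p W X Y = 2 * a (fst p) * a' * fst W * (snd X \<bullet> snd Y)"
proof -
  have "((\<lambda>q. a (fst q)) has_derivative (\<lambda>h. fst h * a')) (at p)"
    using has_derivative_compose[OF has_derivative_fst[OF has_derivative_ident], of a "(*) a'" p UNIV] a
    by (simp add: has_field_derivative_def mult.commute)
  then have "((\<lambda>q. flrw a q X Y) has_derivative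
      (\<lambda>h. 2 * a (fst p) * a' * fst h * (snd X \<bullet> snd Y))) (at p)"
    unfolding flrw_def by (auto intro!: derivative_eq_intros simp: fun_eq_iff)
  from frechet_derivative_at[OF this, symmetric] show ?thesis by (simp add: d_flrw_def)
qed

lemma levi_civita_eq:
  assumes a: "(a has_real_derivative a') (at (fst p))" "a (fst p) > 0"
    and p: "snd p \<noteq> 0" and XY: "X \<in> tangent_space p" "Y \<in> tangent_space p"
  shows "levi_civita a p X Y DY =
    tangent_part p DY + (a (fst p) * a' * (snd X \<bullet> snd Y),
       (a' / a (fst p)) *\<^sub>R (fst X *\<^sub>R snd Y + fst Y *\<^sub>R snd X))"
  unfolding levi_civita_def
proof (rule sharp_eqI)
  show "a (fst p) > 0" by (fact a(2))
next
  show "tangent_part p DY + (a (fst p) * a' * (snd X \<bullet> snd Y),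
      (a' / a (fst p)) *\<^sub>R (fst X *\<^sub>R snd Y + fst Y *\<^sub>R snd X)) \<in> tangent_space p"
    using XY p by (simp add: tangent_space_def tangent_part_def inner_diff_right inner_add_right)
next
  fix U assume U: "U \<in> tangent_space p"
  show "flrw a p (tangent_part p DY + (a (fst p) * a' * (snd X \<bullet> snd Y),
      (a' / a (fst p)) *\<^sub>R (fst X *\<^sub>R snd Y + fst Y *\<^sub>R snd X))) U =
    flrw a p DY U + (d_flrw a p X Y U + d_flrw a p Y X U - d_flrw a p U X Y) / 2"
    using U a(2) unfolding d_flrw_eq[OF a(1)]
    by (simp add: flrw_def tangent_space_def tangent_part_def inner_diff_left inner_add_left
        power2_eq_square field_simps)
qed

lemma frechet_derivative_product_of_circles:
  "frechet_derivative (\<lambda>w. (t :: real, c *\<^sub>R cis (fst w), d *\<^sub>R cis (snd w))) (at u) =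
     (\<lambda>h. (0, (c * fst h) *\<^sub>R (\<i> * cis (fst u)), (d * snd h) *\<^sub>R (\<i> * cis (snd u))))"
proof -
  have "((\<lambda>w. (t, c *\<^sub>R cis (fst w), d *\<^sub>R cis (snd w))) has_derivative
     (\<lambda>h. (0, (c * fst h) *\<^sub>R (\<i> * cis (fst u)), (d * snd h) *\<^sub>R (\<i> * cis (snd u))))) (at u)"
    by (auto intro!: derivative_eq_intros simp: fun_eq_iff)
  then show ?thesis by (simp only: frechet_derivative_at[symmetric])
qed

lemma frechet_derivative_clifford:
  "frechet_derivative (clifford t0 \<alpha>) (at u) =
     (\<lambda>h. (0, (cos \<alpha> * fst h) *\<^sub>R (\<i> * cis (fst u)), (sin \<alpha> * snd h) *\<^sub>R (\<i> * cis (snd u))))"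
  unfolding clifford_def case_prod_beta by (rule frechet_derivative_product_of_circles)

lemma frechet_derivative_clifford_normal:
  "frechet_derivative (clifford_normal a t0 \<alpha>) (at u) =
     (\<lambda>h. (0, (sin \<alpha> / a t0 * fst h) *\<^sub>R (\<i> * cis (fst u)),
             (- cos \<alpha> / a t0 * snd h) *\<^sub>R (\<i> * cis (snd u))))"
  unfolding clifford_normal_def case_prod_beta by (rule frechet_derivative_product_of_circles)

lemma clifford_normal_unit:
  assumes "a t0 > 0"
  shows "clifford_normal a t0 \<alpha> u \<in> tangent_space (clifford t0 \<alpha> u)"
    and "flrw a (clifford t0 \<alpha> u) (clifford_normal a t0 \<alpha> u) (clifford_normal a t0 \<alpha> u) = 1"
    and "flrw a (clifford t0 \<alpha> u) (clifford_normal a t0 \<alpha> u) (partial v (clifford t0 \<alpha>) u) = 0"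
proof -
  obtain x y where u: "u = (x, y)" by force
  have cis: "cis w \<bullet> cis w = 1" "cis w \<bullet> (\<i> * cis w) = 0" for w
    by (simp_all add: inner_complex_def flip: power2_eq_square)
  show "clifford_normal a t0 \<alpha> u \<in> tangent_space (clifford t0 \<alpha> u)"
    by (simp add: u clifford_normal_def clifford_def tangent_space_def cis)
  show "flrw a (clifford t0 \<alpha> u) (clifford_normal a t0 \<alpha> u) (clifford_normal a t0 \<alpha> u) = 1"
    using assms sin_cos_squared_add[of \<alpha>]
    by (simp add: u clifford_normal_def clifford_def flrw_def cis power2_eq_square
        flip: add_divide_distrib)
  show "flrw a (clifford t0 \<alpha> u) (clifford_normal a t0 \<alpha> u) (partial v (clifford t0 \<alpha>) u) = 0"
    unfolding frechet_derivative_clifford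
    by (simp add: u clifford_normal_def clifford_def flrw_def cis)
qed

lemma clifford_principal_curvatures:
  assumes a: "(a has_real_derivative a') (at t0)" "a t0 > 0" and \<alpha>: "0 < \<alpha>" "\<alpha> < pi / 2"
  shows "nabla_along a (clifford t0 \<alpha>) e1 (clifford_normal a t0 \<alpha>) u
           = (tan \<alpha> / a t0) *\<^sub>R partial e1 (clifford t0 \<alpha>) u"
    and "nabla_along a (clifford t0 \<alpha>) e2 (clifford_normal a t0 \<alpha>) u
           = (- cot \<alpha> / a t0) *\<^sub>R partial e2 (clifford t0 \<alpha>) u"
proof -
  have c: "cos \<alpha> > 0" using \<alpha> by (intro cos_gt_zero_pi) auto
  have s: "sin \<alpha> > 0" using \<alpha> by (intro sin_gt_zero) auto
  obtain x y where u: "u = (x, y)" by force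
  have F: "fst (clifford t0 \<alpha> u) = t0" and S: "snd (clifford t0 \<alpha> u) \<noteq> 0"
    using c by (auto simp: clifford_def u prod_eq_iff)
  have T: "partial v (clifford t0 \<alpha>) u \<in> tangent_space (clifford t0 \<alpha> u)" for v
    unfolding frechet_derivative_clifford
    by (simp add: u clifford_def tangent_space_def inner_complex_def)
  note LC = levi_civita_eq[of a a' "clifford t0 \<alpha> u", unfolded F, OF a S T clifford_normal_unit(1)[of a t0, OF a(2)]]
  show "nabla_along a (clifford t0 \<alpha>) e1 (clifford_normal a t0 \<alpha>) u
           = (tan \<alpha> / a t0) *\<^sub>R partial e1 (clifford t0 \<alpha>) u"
    unfolding nabla_along_def LC
    unfolding frechet_derivative_clifford frechet_derivative_clifford_normal
    using c by (simp add: u clifford_def clifford_normal_def tangent_part_def inner_complex_def tan_def zero_prod_def)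
  show "nabla_along a (clifford t0 \<alpha>) e2 (clifford_normal a t0 \<alpha>) u
           = (- cot \<alpha> / a t0) *\<^sub>R partial e2 (clifford t0 \<alpha>) u"
    unfolding nabla_along_def LC
    unfolding frechet_derivative_clifford frechet_derivative_clifford_normal
    using s by (simp add: u clifford_def clifford_normal_def tangent_part_def inner_complex_def cot_def zero_prod_def)
qed

end

theory Submission
  imports Defs
begin

text \<open>The Willmore integrand and the area density are smooth functions of the two-jet of the
  parametrization, invariant under the rotations \<open>turn u\<close> of spacetime, and the Clifford torus is an
  orbit of these rotations. Hence the linearization of either density along \<open>\<phi> (p n + q \<nu>)\<close> is a
  differential operator in \<open>\<phi>\<close> with constant coefficients. As \<open>\<phi>\<close> is biperiodic, the first variation
  is the zeroth order coefficient times \<open>\<integral> \<phi>\<close>, and this coefficient is found by differentiating along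
  the explicit family of Clifford tori with varying \<open>t\<close> and \<open>\<alpha>\<close>, for which
  \<open>|H|\<^sup>2 d\<mu> = ((sin\<^sup>2 \<alpha> - cos\<^sup>2 \<alpha>)\<^sup>2 / (cos \<alpha> sin \<alpha>) - 4 a'(t)\<^sup>2 cos \<alpha> sin \<alpha>) du dv\<close>.\<close>

section \<open>Calculus of smooth maps\<close>

text \<open>Both halves of the theorem are one statement about constant combinations
  \<open>V = p n + q \<nu>\<close>. The first variations of area and of the Willmore functional
  along \<open>\<phi> V\<close> are \<open>(P p + H q) \<integral>\<phi>\<close> and
  \<open>w \<integral>\<phi>\<close>, up to the constant area density, with \<open>w\<close>
  depending on \<open>p\<close> and \<open>q\<close> only. If \<open>P p + H q \<noteq> 0\<close>,
  preserving area forces \<open>\<integral>\<phi> = 0\<close>, and the multiplier is the quotient of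
  the two constants. As \<open>P p + H q\<close> is the product of \<open>V\<close> with the mean
  curvature vector, this condition is transversality in the null case, while for
  \<open>V_\<beta>\<close> it reads \<open>H^2 - P^2 \<noteq> 0\<close>. The Einstein tensor enters
  only at the end, when \<open>w\<close> is rewritten. The obstacle is that the claims concern every
  variation \<open>F\<close>, of which only the velocity at \<open>s = 0\<close> is prescribed, and
  that the integrand contains two derivatives of \<open>F\<close> along the torus. Differentiability
  in \<open>s\<close> has to be proved by exchanging derivatives and by differentiating under the
  integral. For this the integrands must be smooth functions of the ambient coordinates of the jet;
  hence the calculus of \<open>smooth_on\<close>, including the symmetry of second
  derivatives.\<close>

lemma Ck_on_cong:
  assumes "open S" "\<And>x. x \<in> S \<Longrightarrow> f x = g x" "Ck_on k S f"
  shows "Ck_on k S g"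
  using assms(2,3)
proof (induction k arbitrary: f g)
  case 0
  then show ?case using continuous_on_cong by (metis Ck_on.simps(1))
next
  case (Suc k)
  have D: "(g has_derivative frechet_derivative f (at x)) (at x)" if "x \<in> S" for x
    using has_derivative_transform_within_open[of f _ x UNIV S g] assms(1) that Suc.prems
    by (simp add: frechet_derivative_works)
  have "Ck_on k S (\<lambda>x. frechet_derivative g (at x) v)" for v
    using Suc.IH[of "\<lambda>x. frechet_derivative f (at x) v" "\<lambda>x. frechet_derivative g (at x) v"]
      Suc.prems D frechet_derivative_at by fastforce
  then show ?case using D by (auto simp: differentiable_def)
qed

lemma Ck_on_Suc_imp: "Ck_on (Suc k) S f \<Longrightarrow> Ck_on k S f"
proof (induction k arbitrary: f)
  case 0
  then show ?case
    by (auto intro!: continuous_at_imp_continuous_on differentiable_imp_continuous_within)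
next
  case (Suc k)
  have "Ck_on k S (\<lambda>x. frechet_derivative f (at x) v)" for v
    using Suc.prems by (intro Suc.IH) (simp only: Ck_on.simps(2)[of "Suc k" S f])
  then show ?case using Suc.prems by simp
qed

text \<open>Lets regularity be read off any explicit formula \<open>f'\<close> for the derivative:
  by uniqueness it agrees with \<open>frechet_derivative\<close> on the open set, and
  \<open>Ck_on_cong\<close> transfers the class.\<close>

lemma Ck_on_SucI:
  assumes "open S" and D: "\<And>x. x \<in> S \<Longrightarrow> (f has_derivative f' x) (at x)"
    and "\<And>v. Ck_on k S (\<lambda>x. f' x v)"
  shows "Ck_on (Suc k) S f"
proof -
  have "Ck_on k S (\<lambda>x. frechet_derivative f (at x) v)" for v
    by (rule Ck_on_cong[OF assms(1) _ assms(3)[of v]]) (simp add: frechet_derivative_at[OF D, symmetric])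
  then show ?thesis using D by (auto simp: differentiable_def)
qed

lemma Ck_on_SucD:
  assumes "Ck_on (Suc k) S f"
  shows "x \<in> S \<Longrightarrow> (f has_derivative frechet_derivative f (at x)) (at x)"
    and "Ck_on k S (\<lambda>x. frechet_derivative f (at x) v)"
  using assms by (auto simp: frechet_derivative_works)

lemma Ck_on_const: "Ck_on k S (\<lambda>x. c)"
  by (induction k arbitrary: c) auto

lemma Ck_on_bounded_linear:
  assumes "bounded_linear f"
  shows "Ck_on k S f"
proof (cases k)
  case 0
  then show ?thesis using assms by (simp add: linear_continuous_on)
next
  case (Suc m)
  have "frechet_derivative f (at x) = f" for x
    using frechet_derivative_at[OF bounded_linear.has_derivative[OF assms has_derivative_ident]] by simp
  then show ?thesis using Suc bounded_linear_imp_differentiable[OF assms] by (simp add: Ck_on_const)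
qed

lemma Ck_on_add:
  assumes "open S"
  shows "Ck_on k S f \<Longrightarrow> Ck_on k S g \<Longrightarrow> Ck_on k S (\<lambda>x. f x + g x)"
proof (induction k arbitrary: f g)
  case 0
  then show ?case by (simp add: continuous_on_add)
next
  case (Suc k)
  show ?case
    by (rule Ck_on_SucI[OF assms has_derivative_add[OF Ck_on_SucD(1) Ck_on_SucD(1)]])
      (use Suc in \<open>auto intro!: Suc.IH simp del: Ck_on.simps dest: Ck_on_SucD(2)\<close>)
qed

lemma Ck_on_sum:
  assumes "open S" "\<And>i. i \<in> I \<Longrightarrow> Ck_on k S (f i)"
  shows "Ck_on k S (\<lambda>x. \<Sum>i\<in>I. f i x)"
  using assms(2)
  by (induction I rule: infinite_finite_induct) (auto intro: Ck_on_const Ck_on_add[OF assms(1)])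

text \<open>The Leibniz rule gives two terms of the same form; the undifferentiated factor in each
  is one class better than the induction hypothesis asks, hence \<open>Ck_on_Suc_imp\<close>. All
  products below are instances.\<close>

lemma Ck_on_bilinear:
  assumes "bounded_bilinear b" "open S"
  shows "Ck_on k S f \<Longrightarrow> Ck_on k S g \<Longrightarrow> Ck_on k S (\<lambda>x. b (f x) (g x))"
proof (induction k arbitrary: f g)
  case 0
  then show ?case by (simp add: bounded_bilinear.continuous_on[OF assms(1)])
next
  case (Suc k)
  show ?case
    by (rule Ck_on_SucI[OF assms(2) bounded_bilinear.FDERIV[OF assms(1) Ck_on_SucD(1) Ck_on_SucD(1)]])
      (use Suc in \<open>auto intro!: Ck_on_add[OF assms(2)] Suc.IH
         simp del: Ck_on.simps dest: Ck_on_SucD(2) Ck_on_Suc_imp\<close>)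
qed

lemma Ck_on_compose:
  assumes "open S" "open T"
  shows "Ck_on k T g \<Longrightarrow> Ck_on k S f \<Longrightarrow> f ` S \<subseteq> T \<Longrightarrow> Ck_on k S (\<lambda>x. g (f x))"
proof (induction k arbitrary: f g)
  case 0
  then show ?case using continuous_on_compose2 by auto
next
  case (Suc k)
  \<comment> \<open>\<open>Ck_on\<close> controls the derivative of \<open>g\<close> in a fixed
    direction, whereas the chain rule evaluates it in the moving direction
    \<open>frechet_derivative f (at x) v\<close>. Expanding that vector in \<open>Basis\<close>
    leaves fixed directions, to which the induction hypothesis applies.\<close>
  define D where "D x v = (\<Sum>i\<in>Basis.
      (frechet_derivative f (at x) v \<bullet> i) *\<^sub>R frechet_derivative g (at (f x)) i)" for x v
  show ?case
  proof (rule Ck_on_SucI[OF assms(1), of _ D])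
    fix x assume x: "x \<in> S"
    then have f: "(f has_derivative frechet_derivative f (at x)) (at x)"
      and g: "(g has_derivative frechet_derivative g (at (f x))) (at (f x))"
      using Suc.prems Ck_on_SucD(1) by blast+
    let ?L = "frechet_derivative g (at (f x))"
    have "?L w = (\<Sum>i\<in>Basis. (w \<bullet> i) *\<^sub>R ?L i)" for w
    proof -
      have "?L w = ?L (\<Sum>i\<in>Basis. (w \<bullet> i) *\<^sub>R i)" by (simp only: euclidean_representation)
      also have "\<dots> = (\<Sum>i\<in>Basis. (w \<bullet> i) *\<^sub>R ?L i)"
        by (simp only: linear_sum[OF has_derivative_linear[OF g]] linear_cmul[OF has_derivative_linear[OF g]])
      finally show ?thesis .
    qed
    then have "D x = (\<lambda>v. ?L (frechet_derivative f (at x) v))"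
      unfolding D_def fun_eq_iff by metis
    then show "((\<lambda>x. g (f x)) has_derivative D x) (at x)"
      using has_derivative_compose[OF f g] by metis
  next
    fix v
    have "Ck_on k S (\<lambda>x. frechet_derivative g (at (f x)) i)" for i
      by (rule Suc.IH[of "\<lambda>y. frechet_derivative g (at y) i", OF Ck_on_SucD(2)[OF Suc.prems(1)]
            Ck_on_Suc_imp[OF Suc.prems(2)] Suc.prems(3)])
    moreover have "Ck_on k S (\<lambda>x. frechet_derivative f (at x) v \<bullet> i)" for i
      by (rule Ck_on_bilinear[OF bounded_bilinear_inner assms(1) Ck_on_SucD(2)[OF Suc.prems(2)] Ck_on_const])
    ultimately show "Ck_on k S (\<lambda>x. D x v)"
      unfolding D_def by (intro Ck_on_sum assms Ck_on_bilinear[OF bounded_bilinear_scaleR])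
  qed
qed

section \<open>Closure rules for smooth maps\<close>

named_theorems smooth_intros

lemma smooth_on_const [smooth_intros]: "smooth_on S (\<lambda>x. c)"
  by (simp add: smooth_on_def Ck_on_const)

lemma smooth_on_bounded_linear: "bounded_linear f \<Longrightarrow> smooth_on S f"
  by (simp add: smooth_on_def Ck_on_bounded_linear)

lemma smooth_on_ident [smooth_intros]: "smooth_on S (\<lambda>x. x)"
  by (intro smooth_on_bounded_linear bounded_linear_ident)

lemma smooth_on_bilinear:
  "bounded_bilinear b \<Longrightarrow> open S \<Longrightarrow> smooth_on S f \<Longrightarrow> smooth_on S g \<Longrightarrow> smooth_on S (\<lambda>x. b (f x) (g x))"
  by (simp add: smooth_on_def Ck_on_bilinear)

lemma smooth_on_compose:
  "smooth_on T g \<Longrightarrow> smooth_on S f \<Longrightarrow> open S \<Longrightarrow> open T \<Longrightarrow> f ` S \<subseteq> T \<Longrightarrow> smooth_on S (\<lambda>x. g (f x))"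
  by (simp add: smooth_on_def Ck_on_compose)

lemma smooth_on_cong:
  "open S \<Longrightarrow> (\<And>x. x \<in> S \<Longrightarrow> f x = g x) \<Longrightarrow> smooth_on S f \<Longrightarrow> smooth_on S g"
  unfolding smooth_on_def by (metis Ck_on_cong)

lemma smooth_on_linear_compose:
  assumes "bounded_linear l" "open S" "smooth_on S f"
  shows "smooth_on S (\<lambda>x. l (f x))"
  by (rule smooth_on_compose[OF smooth_on_bounded_linear[OF assms(1)] assms(3,2) open_UNIV]) simp

lemma smooth_on_add [smooth_intros]:
  "open S \<Longrightarrow> smooth_on S f \<Longrightarrow> smooth_on S g \<Longrightarrow> smooth_on S (\<lambda>x. f x + g x)"
  by (simp add: smooth_on_def Ck_on_add)

lemmas smooth_on_scaleR [smooth_intros] = smooth_on_bilinear[OF bounded_bilinear_scaleR]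
lemmas smooth_on_inner [smooth_intros] = smooth_on_bilinear[OF bounded_bilinear_inner]
lemma smooth_on_mult [smooth_intros]:
  fixes f :: "'a::euclidean_space \<Rightarrow> real"
  shows "open S \<Longrightarrow> smooth_on S f \<Longrightarrow> smooth_on S g \<Longrightarrow> smooth_on S (\<lambda>x. f x * g x)"
  by (rule smooth_on_bilinear[OF bounded_bilinear_mult])

lemmas smooth_on_fst [smooth_intros] = smooth_on_linear_compose[OF bounded_linear_fst]
lemmas smooth_on_snd [smooth_intros] = smooth_on_linear_compose[OF bounded_linear_snd]

lemma smooth_on_minus [smooth_intros]: "open S \<Longrightarrow> smooth_on S f \<Longrightarrow> smooth_on S (\<lambda>x. - f x)"
  by (rule smooth_on_linear_compose[OF bounded_linear_minus[OF bounded_linear_ident]])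

lemma smooth_on_diff [smooth_intros]:
  "open S \<Longrightarrow> smooth_on S f \<Longrightarrow> smooth_on S g \<Longrightarrow> smooth_on S (\<lambda>x. f x - g x)"
  by (simp only: diff_conv_add_uminus smooth_on_add smooth_on_minus)

lemma smooth_on_Pair [smooth_intros]:
  assumes "open S" "smooth_on S f" "smooth_on S g"
  shows "smooth_on S (\<lambda>x. (f x, g x))"
proof -
  have "bounded_linear (\<lambda>x. (x, 0))" "bounded_linear (\<lambda>x. (0, x))"
    by (intro bounded_linear_Pair bounded_linear_ident bounded_linear_zero)+
  from smooth_on_add[OF assms(1) smooth_on_linear_compose[OF this(1) assms(1,2)]
      smooth_on_linear_compose[OF this(2) assms(1,3)]]
  show ?thesis by simp
qed

lemma smooth_on_power [smooth_intros]:
  fixes f :: "'a::euclidean_space \<Rightarrow> real"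
  shows "open S \<Longrightarrow> smooth_on S f \<Longrightarrow> smooth_on S (\<lambda>x. f x ^ n)"
  by (induction n) (auto intro: smooth_intros)

text \<open>Bootstrapping: an equation that expresses \<open>h'\<close> through \<open>h\<close> makes \<open>h\<close> smooth.\<close>

lemma smooth_on_real_ode:
  fixes h :: "real \<Rightarrow> real"
  assumes "open S" and D: "\<And>x. x \<in> S \<Longrightarrow> (h has_real_derivative h' x) (at x)"
    and step: "\<And>k. Ck_on k S h \<Longrightarrow> Ck_on k S h'"
  shows "smooth_on S h"
  unfolding smooth_on_def
proof
  fix k show "Ck_on k S h"
  proof (induction k)
    case 0
    then show ?case using D by (auto intro!: continuous_at_imp_continuous_on DERIV_isCont)
  next
    case (Suc k)
    show ?case
    proof (rule Ck_on_SucI[OF assms(1)])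
      show "(h has_derivative (*) (h' x)) (at x)" if "x \<in> S" for x
        using D[OF that] by (simp add: has_field_derivative_def)
      show "Ck_on k S (\<lambda>x. h' x * v)" for v
        by (rule Ck_on_bilinear[OF bounded_bilinear_mult assms(1) step[OF Suc] Ck_on_const])
    qed
  qed
qed

lemma smooth_on_inverse [smooth_intros]:
  fixes f :: "'a::euclidean_space \<Rightarrow> real"
  assumes "open S" "smooth_on S f" "\<And>x. x \<in> S \<Longrightarrow> f x \<noteq> 0"
  shows "smooth_on S (\<lambda>x. inverse (f x))"
proof -
  have o: "open (- {0::real})" by auto
  have "smooth_on (- {0}) (inverse :: real \<Rightarrow> real)"
  proof (rule smooth_on_real_ode[OF o])
    \<comment> \<open>The derivative is written as a product of \<open>inverse\<close> with itself,
      so that \<open>Ck_on_bilinear\<close> passes the class of \<open>inverse\<close> on to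
      it.\<close>
    show "(inverse has_real_derivative - 1 * (inverse x * inverse x)) (at x)" if "x \<in> - {0}" for x :: real
      using that by (auto intro!: derivative_eq_intros)
    show "Ck_on k (- {0}) (\<lambda>x::real. - 1 * (inverse x * inverse x))" if "Ck_on k (- {0::real}) inverse" for k
      by (rule Ck_on_bilinear[OF bounded_bilinear_mult o Ck_on_const
            Ck_on_bilinear[OF bounded_bilinear_mult o that that]])
  qed
  moreover have "f ` S \<subseteq> - {0}" using assms(3) by fastforce
  ultimately show ?thesis by (rule smooth_on_compose[OF _ assms(2,1) o])
qed

lemma smooth_on_divide [smooth_intros]:
  fixes f g :: "'a::euclidean_space \<Rightarrow> real"
  shows "open S \<Longrightarrow> smooth_on S f \<Longrightarrow> smooth_on S g \<Longrightarrow> (\<And>x. x \<in> S \<Longrightarrow> g x \<noteq> 0) \<Longrightarrow>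
    smooth_on S (\<lambda>x. f x / g x)"
  by (simp add: divide_inverse smooth_intros)

lemma smooth_on_sqrt [smooth_intros]:
  fixes f :: "'a::euclidean_space \<Rightarrow> real"
  assumes "open S" "smooth_on S f" "\<And>x. x \<in> S \<Longrightarrow> f x > 0"
  shows "smooth_on S (\<lambda>x. sqrt (f x))"
proof -
  have o: "open {0::real<..}" by auto
  have "smooth_on {0<..} sqrt"
  proof (rule smooth_on_real_ode[OF o])
    show "(sqrt has_real_derivative inverse (sqrt x) * (1 / 2)) (at x)" if "x \<in> {0<..}" for x :: real
      using that by (auto intro!: derivative_eq_intros)
    fix k assume k: "Ck_on k {0<..} sqrt"
    have inv: "Ck_on k (- {0}) (inverse :: real \<Rightarrow> real)"
      using smooth_on_inverse[of "- {0::real}" "\<lambda>x. x"] smooth_on_ident by (auto simp: smooth_on_def)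
    have "Ck_on k {0<..} (\<lambda>x. inverse (sqrt x))"
      by (rule Ck_on_compose[OF o _ inv k]) auto
    then show "Ck_on k {0<..} (\<lambda>x. inverse (sqrt x) * (1 / 2))"
      by (rule Ck_on_bilinear[OF bounded_bilinear_mult o _ Ck_on_const])
  qed
  moreover have "f ` S \<subseteq> {0<..}" using assms(3) by auto
  ultimately show ?thesis by (rule smooth_on_compose[OF _ assms(2,1) o])
qed

lemma smooth_on_sin_cos:
  "smooth_on UNIV (sin :: real \<Rightarrow> real)" "smooth_on UNIV (cos :: real \<Rightarrow> real)"
proof -
  \<comment> \<open>A joint induction, because each derivative is the other function up to
    sign.\<close>
  have "Ck_on k UNIV (sin :: real \<Rightarrow> real) \<and> Ck_on k UNIV (cos :: real \<Rightarrow> real)" for k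
  proof (induction k)
    case 0
    then show ?case by (auto intro: continuous_intros)
  next
    case (Suc k)
    have "(sin has_derivative (\<lambda>v. cos x * v)) (at x)" "(cos has_derivative (\<lambda>v. - 1 * (sin x * v))) (at x)"
      for x :: real
      by (auto intro!: derivative_eq_intros)
    moreover have "Ck_on k UNIV (\<lambda>x. cos x * v)" "Ck_on k UNIV (\<lambda>x. sin x * v)" for v :: real
      using Suc by (auto intro: Ck_on_bilinear[OF bounded_bilinear_mult open_UNIV _ Ck_on_const])
    moreover have "Ck_on k UNIV (\<lambda>x. - 1 * (sin x * v))" for v :: real
      by (rule Ck_on_bilinear[OF bounded_bilinear_mult open_UNIV Ck_on_const]) fact
    ultimately show ?case
      using Ck_on_SucI[OF open_UNIV, of sin "\<lambda>x v. cos x * v" k]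
        Ck_on_SucI[OF open_UNIV, of cos "\<lambda>x v. - 1 * (sin x * v)" k] by blast
  qed
  then show "smooth_on UNIV (sin :: real \<Rightarrow> real)" "smooth_on UNIV (cos :: real \<Rightarrow> real)"
    by (auto simp: smooth_on_def)
qed

lemma smooth_on_sin [smooth_intros]:
  fixes f :: "'a::euclidean_space \<Rightarrow> real"
  shows "open S \<Longrightarrow> smooth_on S f \<Longrightarrow> smooth_on S (\<lambda>x. sin (f x))"
  by (rule smooth_on_compose[OF smooth_on_sin_cos(1)]) auto

lemma smooth_on_cos [smooth_intros]:
  fixes f :: "'a::euclidean_space \<Rightarrow> real"
  shows "open S \<Longrightarrow> smooth_on S f \<Longrightarrow> smooth_on S (\<lambda>x. cos (f x))"
  by (rule smooth_on_compose[OF smooth_on_sin_cos(2)]) auto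

lemma smooth_on_cis [smooth_intros]:
  assumes "open S" "smooth_on S f"
  shows "smooth_on S (\<lambda>x. cis (f x))"
proof -
  have "cis t = cos t *\<^sub>R 1 + sin t *\<^sub>R \<i>" for t by (simp add: complex_eq_iff)
  then show ?thesis using assms by (simp only: smooth_intros)
qed

lemma smooth_on_frechet_derivative:
  "smooth_on S f \<Longrightarrow> smooth_on S (\<lambda>x. frechet_derivative f (at x) v)"
  unfolding smooth_on_def using Ck_on_SucD(2) by blast

lemma smooth_on_has_derivative:
  "smooth_on S f \<Longrightarrow> x \<in> S \<Longrightarrow> (f has_derivative frechet_derivative f (at x)) (at x)"
  unfolding smooth_on_def using Ck_on_SucD(1) by blast

lemma smooth_on_imp_continuous_on: "smooth_on S f \<Longrightarrow> continuous_on S f"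
  unfolding smooth_on_def using Ck_on.simps(1) by blast

lemma smooth_on_real_deriv:
  assumes "smooth_on S (f :: real \<Rightarrow> real)" "open S"
  shows "x \<in> S \<Longrightarrow> (f has_real_derivative deriv f x) (at x)" "smooth_on S (deriv f)"
proof -
  have D: "(f has_real_derivative frechet_derivative f (at x) 1) (at x)" if "x \<in> S" for x
  proof -
    note * = smooth_on_has_derivative[OF assms(1) that]
    have "frechet_derivative f (at x) = (*) (frechet_derivative f (at x) 1)"
    proof
      fix v :: real
      show "frechet_derivative f (at x) v = frechet_derivative f (at x) 1 * v"
        using linear_cmul[OF has_derivative_linear[OF *], of v 1] by simp
    qed
    then show ?thesis using * by (simp add: has_field_derivative_def)
  qed
  then show "x \<in> S \<Longrightarrow> (f has_real_derivative deriv f x) (at x)"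
    using DERIV_imp_deriv by fastforce
  show "smooth_on S (deriv f)"
    by (rule smooth_on_cong[OF assms(2) _ smooth_on_frechet_derivative[OF assms(1), of 1]])
      (use DERIV_imp_deriv[OF D] in auto)
qed

lemma smooth_on_has_vector_derivative:
  assumes "smooth_on S f" "p + t *\<^sub>R v \<in> S"
  shows "((\<lambda>s. f (p + s *\<^sub>R v)) has_vector_derivative frechet_derivative f (at (p + t *\<^sub>R v)) v) (at t)"
proof -
  have "((\<lambda>s. p + s *\<^sub>R v) has_derivative (\<lambda>h. h *\<^sub>R v)) (at t)"
    by (auto intro!: derivative_eq_intros)
  from has_derivative_compose[OF this smooth_on_has_derivative[OF assms]]
  show ?thesis
    using linear_cmul[OF has_derivative_linear[OF smooth_on_has_derivative[OF assms]]]
    by (simp add: has_vector_derivative_def)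
qed

section \<open>Symmetry of second derivatives\<close>

lemma second_difference_mvt:
  fixes f :: "'a::euclidean_space \<Rightarrow> real"
  assumes f: "smooth_on S f" and h: "0 < h"
    and S: "\<And>s t. 0 \<le> s \<Longrightarrow> s \<le> h \<Longrightarrow> 0 \<le> t \<Longrightarrow> t \<le> h \<Longrightarrow> x + s *\<^sub>R v + t *\<^sub>R w \<in> S"
  shows "\<exists>s t. 0 < s \<and> s < h \<and> 0 < t \<and> t < h \<and>
    f (x + h *\<^sub>R v + h *\<^sub>R w) - f (x + h *\<^sub>R v) - f (x + h *\<^sub>R w) + f x =
    h\<^sup>2 * frechet_derivative (\<lambda>y. frechet_derivative f (at y) v) (at (x + s *\<^sub>R v + t *\<^sub>R w)) w"
proof -
  let ?D = "\<lambda>y. frechet_derivative f (at y) v"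
  have u: "((\<lambda>s. f (x + t *\<^sub>R w + s *\<^sub>R v)) has_real_derivative ?D (x + t *\<^sub>R w + s *\<^sub>R v)) (at s)"
    if "0 \<le> s" "s \<le> h" "0 \<le> t" "t \<le> h" for s t
    using smooth_on_has_vector_derivative[OF f, of "x + t *\<^sub>R w" s v] S[OF that]
    by (simp add: has_real_derivative_iff_has_vector_derivative algebra_simps)
  \<comment> \<open>The mean value theorem along \<open>v\<close>, applied to the increment
    \<open>f (y + h w) - f y\<close>; a second application along \<open>w\<close> then treats the
    resulting difference of \<open>?D\<close>.\<close>
  have "\<exists>s. 0 < s \<and> s < h \<and>
      (f (x + h *\<^sub>R w + h *\<^sub>R v) - f (x + 0 *\<^sub>R w + h *\<^sub>R v)) -
      (f (x + h *\<^sub>R w + 0 *\<^sub>R v) - f (x + 0 *\<^sub>R w + 0 *\<^sub>R v)) =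
      (h - 0) * (?D (x + h *\<^sub>R w + s *\<^sub>R v) - ?D (x + 0 *\<^sub>R w + s *\<^sub>R v))"
    by (rule MVT2[OF h], rule DERIV_diff; rule u) (use h in auto)
  then obtain s where s: "0 < s" "s < h" and 1:
    "f (x + h *\<^sub>R v + h *\<^sub>R w) - f (x + h *\<^sub>R v) - f (x + h *\<^sub>R w) + f x =
      h * (?D (x + h *\<^sub>R w + s *\<^sub>R v) - ?D (x + s *\<^sub>R v))"
    by (auto simp: algebra_simps)
  have "\<exists>t. 0 < t \<and> t < h \<and> ?D (x + s *\<^sub>R v + h *\<^sub>R w) - ?D (x + s *\<^sub>R v + 0 *\<^sub>R w) =
      (h - 0) * frechet_derivative ?D (at (x + s *\<^sub>R v + t *\<^sub>R w)) w"
  proof (rule MVT2[OF h])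
    fix t assume "0 \<le> t" "t \<le> h"
    then show "((\<lambda>t. ?D (x + s *\<^sub>R v + t *\<^sub>R w)) has_real_derivative
        frechet_derivative ?D (at (x + s *\<^sub>R v + t *\<^sub>R w)) w) (at t)"
      using smooth_on_has_vector_derivative[OF smooth_on_frechet_derivative[OF f]] S s
      by (simp add: has_real_derivative_iff_has_vector_derivative)
  qed
  then obtain t where t: "0 < t" "t < h" and 2: "?D (x + s *\<^sub>R v + h *\<^sub>R w) - ?D (x + s *\<^sub>R v) =
      h * frechet_derivative ?D (at (x + s *\<^sub>R v + t *\<^sub>R w)) w"
    by auto
  have "x + h *\<^sub>R w + s *\<^sub>R v = x + s *\<^sub>R v + h *\<^sub>R w" by simp
  with 1 2 have "f (x + h *\<^sub>R v + h *\<^sub>R w) - f (x + h *\<^sub>R v) - f (x + h *\<^sub>R w) + f x =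
    h\<^sup>2 * frechet_derivative ?D (at (x + s *\<^sub>R v + t *\<^sub>R w)) w"
    by (simp only: power2_eq_square mult.assoc)
  with s t show ?thesis by blast
qed

text \<open>The second difference quotient is symmetric in \<open>v\<close> and \<open>w\<close>,
  and by the mean value theorem and continuity of the second derivatives it approximates either
  mixed derivative.\<close>

lemma frechet_derivative_commute_real:
  fixes f :: "'a::euclidean_space \<Rightarrow> real"
  assumes f: "smooth_on S f" and S: "open S" "x \<in> S"
  shows "frechet_derivative (\<lambda>y. frechet_derivative f (at y) v) (at x) w =
    frechet_derivative (\<lambda>y. frechet_derivative f (at y) w) (at x) v"
proof -
  let ?D = "\<lambda>v w y. frechet_derivative (\<lambda>y. frechet_derivative f (at y) v) (at y) w"
  have approx: "\<exists>d>0. \<forall>h. 0 < h \<longrightarrow> h < d \<longrightarrow>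
      \<bar>(f (x + h *\<^sub>R v + h *\<^sub>R w) - f (x + h *\<^sub>R v) - f (x + h *\<^sub>R w) + f x) / h\<^sup>2 - ?D v w x\<bar> < e"
    if "e > 0" for v w and e :: real
  proof -
    have "continuous_on S (?D v w)"
      by (intro smooth_on_imp_continuous_on smooth_on_frechet_derivative f)
    then have "\<forall>\<^sub>F y in at x. dist (?D v w y) (?D v w x) < e"
      using that S continuous_on_eq_continuous_at by (metis isCont_def tendstoD)
    moreover have "\<forall>\<^sub>F y in at x. y \<in> S" using S by (rule eventually_at_in_open')
    ultimately have "\<forall>\<^sub>F y in nhds x. dist (?D v w y) (?D v w x) < e \<and> y \<in> S"
      using that S by (auto simp: eventually_nhds_conv_at eventually_conj_iff)
    then obtain d where d: "d > 0" "\<And>y. dist y x < d \<Longrightarrow> dist (?D v w y) (?D v w x) < e \<and> y \<in> S"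
      by (auto simp: eventually_nhds_metric)
    \<comment> \<open>A step below \<open>d'\<close> keeps the whole parallelogram inside the
      \<open>d\<close>-ball; the summand 1 covers \<open>v = w = 0\<close>.\<close>
    define d' where "d' = d / (norm v + norm w + 1)"
    have N: "norm v + norm w + 1 > 0" by (simp add: add_nonneg_pos)
    have near: "dist (x + s *\<^sub>R v + t *\<^sub>R w) x < d"
      if "0 \<le> s" "s \<le> h" "0 \<le> t" "t \<le> h" "h < d'" for s t h
    proof -
      have "dist (x + s *\<^sub>R v + t *\<^sub>R w) x \<le> s * norm v + t * norm w"
        using norm_triangle_ineq[of "s *\<^sub>R v" "t *\<^sub>R w"] that by (simp add: dist_norm add.assoc)
      also have "\<dots> \<le> h * (norm v + norm w + 1)"
        using that mult_right_mono[of s h "norm v"] mult_right_mono[of t h "norm w"]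
        by (simp add: algebra_simps)
      also have "\<dots> < d" using that(5) N by (simp add: d'_def pos_less_divide_eq)
      finally show ?thesis .
    qed
    have "\<bar>(f (x + h *\<^sub>R v + h *\<^sub>R w) - f (x + h *\<^sub>R v) - f (x + h *\<^sub>R w) + f x) / h\<^sup>2 - ?D v w x\<bar> < e"
      if h: "0 < h" "h < d'" for h
    proof -
      obtain s t where st: "0 < s" "s < h" "0 < t" "t < h"
        "f (x + h *\<^sub>R v + h *\<^sub>R w) - f (x + h *\<^sub>R v) - f (x + h *\<^sub>R w) + f x =
          h\<^sup>2 * ?D v w (x + s *\<^sub>R v + t *\<^sub>R w)"
        using second_difference_mvt[OF f h(1), of x v w] d(2) near h by blast
      then show ?thesis
        using d(2)[OF near[of s h t]] h by (simp add: dist_real_def)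
    qed
    moreover have "d' > 0" using d(1) N by (simp add: d'_def)
    ultimately show ?thesis by blast
  qed
  show ?thesis
  proof (rule ccontr)
    assume ne: "?D v w x \<noteq> ?D w v x"
    \<comment> \<open>Half the supposed gap: a single quotient \<open>q\<close> strictly within
      \<open>e\<close> of both values would make the gap smaller than \<open>2 e\<close>.\<close>
    define e where "e = \<bar>?D v w x - ?D w v x\<bar> / 2"
    have "e > 0" using ne by (simp add: e_def)
    obtain d1 where d1: "d1 > 0" "\<And>h. 0 < h \<Longrightarrow> h < d1 \<Longrightarrow>
      \<bar>(f (x + h *\<^sub>R v + h *\<^sub>R w) - f (x + h *\<^sub>R v) - f (x + h *\<^sub>R w) + f x) / h\<^sup>2 - ?D v w x\<bar> < e"
      using approx[OF \<open>e > 0\<close>] by blast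
    obtain d2 where d2: "d2 > 0" "\<And>h. 0 < h \<Longrightarrow> h < d2 \<Longrightarrow>
      \<bar>(f (x + h *\<^sub>R w + h *\<^sub>R v) - f (x + h *\<^sub>R w) - f (x + h *\<^sub>R v) + f x) / h\<^sup>2 - ?D w v x\<bar> < e"
      using approx[OF \<open>e > 0\<close>] by blast
    define h where "h = min d1 d2 / 2"
    have h: "0 < h" "h < d1" "h < d2" using d1(1) d2(1) by (auto simp: h_def)
    define q where "q = (f (x + h *\<^sub>R v + h *\<^sub>R w) - f (x + h *\<^sub>R v) - f (x + h *\<^sub>R w) + f x) / h\<^sup>2"
    have "q = (f (x + h *\<^sub>R w + h *\<^sub>R v) - f (x + h *\<^sub>R w) - f (x + h *\<^sub>R v) + f x) / h\<^sup>2"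
      by (simp add: q_def algebra_simps)
    then have "\<bar>q - ?D w v x\<bar> < e" using d2(2)[OF h(1,3)] by (simp only:)
    moreover have "\<bar>q - ?D v w x\<bar> < e" using d1(2)[OF h(1,2)] by (simp only: q_def)
    moreover have "\<bar>A - B\<bar> \<le> \<bar>q - B\<bar> + \<bar>q - A\<bar>" for A B :: real by linarith
    ultimately show False unfolding e_def by (smt (verit) field_sum_of_halves)
  qed
qed

lemma frechet_derivative_inner_left:
  assumes "f differentiable (at x)"
  shows "frechet_derivative (\<lambda>y. f y \<bullet> i) (at x) v = frechet_derivative f (at x) v \<bullet> i"
proof -
  have "((\<lambda>y. f y \<bullet> i) has_derivative (\<lambda>v. frechet_derivative f (at x) v \<bullet> i)) (at x)"
    using assms by (intro has_derivative_inner_left) (simp add: frechet_derivative_works)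
  from frechet_derivative_at[OF this] show ?thesis by metis
qed

lemma frechet_derivative_cong:
  assumes "open S" "x \<in> S" "\<And>y. y \<in> S \<Longrightarrow> f y = g y"
  shows "frechet_derivative f (at x) = frechet_derivative g (at x)"
proof -
  have "(f has_derivative D) (at x) \<longleftrightarrow> (g has_derivative D) (at x)" for D
    using has_derivative_transform_within_open[OF _ assms(1,2), of f D UNIV g]
      has_derivative_transform_within_open[OF _ assms(1,2), of g D UNIV f] assms(3) by auto
  then show ?thesis by (simp add: frechet_derivative_def)
qed

lemma smooth_on_differentiable: "smooth_on S f \<Longrightarrow> x \<in> S \<Longrightarrow> f differentiable (at x)"
  using smooth_on_has_derivative differentiable_def by blast

theorem frechet_derivative_commute:
  assumes f: "smooth_on S f" and S: "open S" "x \<in> S"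
  shows "frechet_derivative (\<lambda>y. frechet_derivative f (at y) v) (at x) w =
    frechet_derivative (\<lambda>y. frechet_derivative f (at y) w) (at x) v"
proof (rule euclidean_eqI)
  fix i :: 'b
  have *: "frechet_derivative (\<lambda>y. frechet_derivative f (at y) v) (at x) w \<bullet> i =
    frechet_derivative (\<lambda>y. frechet_derivative (\<lambda>z. f z \<bullet> i) (at y) v) (at x) w" for v w
  proof -
    have "frechet_derivative (\<lambda>y. frechet_derivative f (at y) v) (at x) w \<bullet> i =
      frechet_derivative (\<lambda>y. frechet_derivative f (at y) v \<bullet> i) (at x) w"
      using smooth_on_differentiable[OF smooth_on_frechet_derivative[OF f] S(2)]
      by (simp add: frechet_derivative_inner_left)
    also have "\<dots> = frechet_derivative (\<lambda>y. frechet_derivative (\<lambda>z. f z \<bullet> i) (at y) v) (at x) w"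
      by (rule fun_cong[OF frechet_derivative_cong[OF S]])
        (simp add: frechet_derivative_inner_left smooth_on_differentiable[OF f])
    finally show ?thesis .
  qed
  show "frechet_derivative (\<lambda>y. frechet_derivative f (at y) v) (at x) w \<bullet> i =
    frechet_derivative (\<lambda>y. frechet_derivative f (at y) w) (at x) v \<bullet> i"
    unfolding *
    by (rule frechet_derivative_commute_real[OF smooth_on_inner[OF S(1) f smooth_on_const] S])
qed

section \<open>Integrals over the torus\<close>

lemma integral_partial_derivative_periodic:
  fixes \<psi> :: "real \<times> real \<Rightarrow> real"
  assumes "smooth_torus_map \<psi>"
  shows "integral (cbox (0, 0) (2 * pi, 2 * pi)) (\<lambda>u. frechet_derivative \<psi> (at u) e1) = 0"
    and "integral (cbox (0, 0) (2 * pi, 2 * pi)) (\<lambda>u. frechet_derivative \<psi> (at u) e2) = 0"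
proof -
  have \<psi>: "smooth_on UNIV \<psi>" and per: "\<psi> (u + 2 * pi, v) = \<psi> (u, v)" "\<psi> (u, v + 2 * pi) = \<psi> (u, v)" for u v
    using assms by (auto simp: smooth_torus_map_def biperiodic_def)
  have cont: "continuous_on S (\<lambda>u. frechet_derivative \<psi> (at u) e)" for e S
    using smooth_on_imp_continuous_on[OF smooth_on_frechet_derivative[OF \<psi>]] continuous_on_subset by blast
  \<comment> \<open>The fundamental theorem of calculus over a full period leaves two equal boundary
    values.\<close>
  have 1: "integral (cbox 0 (2 * pi)) (\<lambda>x. frechet_derivative \<psi> (at (x, y)) e1) = 0" for y
  proof -
    have "((\<lambda>x. frechet_derivative \<psi> (at (x, y)) e1) has_integral \<psi> (2 * pi, y) - \<psi> (0, y)) {0..2 * pi}"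
    proof (rule fundamental_theorem_of_calculus)
      fix x
      show "((\<lambda>x. \<psi> (x, y)) has_vector_derivative frechet_derivative \<psi> (at (x, y)) e1) (at x within {0..2 * pi})"
        using smooth_on_has_vector_derivative[OF \<psi>, of "(0, y)" x e1]
        by (auto intro: has_vector_derivative_at_within)
    qed simp
    then show ?thesis using per(1)[of 0 y] by (simp add: integral_unique)
  qed
  have 2: "integral (cbox 0 (2 * pi)) (\<lambda>y. frechet_derivative \<psi> (at (x, y)) e2) = 0" for x
  proof -
    have "((\<lambda>y. frechet_derivative \<psi> (at (x, y)) e2) has_integral \<psi> (x, 2 * pi) - \<psi> (x, 0)) {0..2 * pi}"
    proof (rule fundamental_theorem_of_calculus)
      fix y
      show "((\<lambda>y. \<psi> (x, y)) has_vector_derivative frechet_derivative \<psi> (at (x, y)) e2) (at y within {0..2 * pi})"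
        using smooth_on_has_vector_derivative[OF \<psi>, of "(x, 0)" y e2]
        by (auto intro: has_vector_derivative_at_within)
    qed simp
    then show ?thesis using per(2)[of x 0] by (simp add: integral_unique)
  qed
  show "integral (cbox (0, 0) (2 * pi, 2 * pi)) (\<lambda>u. frechet_derivative \<psi> (at u) e2) = 0"
    by (simp add: integral_prod_continuous[OF cont] 2[simplified])
  have "integral (cbox (0, 0) (2 * pi, 2 * pi)) (\<lambda>u. frechet_derivative \<psi> (at u) e1) =
     integral (cbox 0 (2 * pi)) (\<lambda>x. integral (cbox 0 (2 * pi)) (\<lambda>y. frechet_derivative \<psi> (at (x, y)) e1))"
    by (rule integral_prod_continuous[OF cont])
  \<comment> \<open>The iterated integral has the second variable inside, so for \<open>e1\<close>
    the order must be swapped before \<open>1\<close> applies.\<close>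
  also have "\<dots> = integral (cbox 0 (2 * pi)) (\<lambda>y. integral (cbox 0 (2 * pi)) (\<lambda>x. frechet_derivative \<psi> (at (x, y)) e1))"
    by (rule integral_swap_continuous) (use cont[of _ e1] in \<open>simp add: case_prod_beta\<close>)
  finally show "integral (cbox (0, 0) (2 * pi, 2 * pi)) (\<lambda>u. frechet_derivative \<psi> (at u) e1) = 0"
    by (simp add: 1[simplified])
qed

text \<open>Makes the vanishing of integrals of derivatives available a second time, for the second
  derivatives of \<open>\<phi>\<close>.\<close>

lemma smooth_torus_map_frechet_derivative:
  assumes "smooth_torus_map f"
  shows "smooth_torus_map (\<lambda>u. frechet_derivative f (at u) v)"
proof -
  have shift: "frechet_derivative f (at (u + w)) = frechet_derivative f (at u)" if "\<And>u. f (u + w) = f u" for u w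
  proof -
    have "((\<lambda>u. u + w) has_derivative (\<lambda>h. h)) (at u)" by (auto intro!: derivative_eq_intros)
    moreover have "(f has_derivative frechet_derivative f (at (u + w))) (at (u + w))"
      using assms by (auto simp: smooth_torus_map_def intro: smooth_on_has_derivative)
    ultimately have "((\<lambda>u. f (u + w)) has_derivative frechet_derivative f (at (u + w))) (at u)"
      by (rule has_derivative_compose)
    then show ?thesis using frechet_derivative_at that by fastforce
  qed
  have "frechet_derivative f (at (x + 2 * pi, y)) = frechet_derivative f (at (x, y))"
    "frechet_derivative f (at (x, y + 2 * pi)) = frechet_derivative f (at (x, y))" for x y
    using shift[of "(2 * pi, 0)" "(x, y)"] shift[of "(0, 2 * pi)" "(x, y)"] assms
    by (auto simp: smooth_torus_map_def biperiodic_def)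
  then show ?thesis
    using assms by (auto simp: smooth_torus_map_def biperiodic_def intro: smooth_on_frechet_derivative)
qed

lemma leibniz_rule_smooth:
  fixes G :: "real \<times> 'a::euclidean_space \<Rightarrow> real"
  assumes G: "smooth_on ({-\<epsilon><..<\<epsilon>} \<times> UNIV) G" and "\<epsilon> > 0"
  shows "((\<lambda>s. integral (cbox p q) (\<lambda>u. G (s, u))) has_real_derivative
    integral (cbox p q) (\<lambda>u. frechet_derivative G (at (0, u)) (1, 0))) (at 0)"
proof -
  let ?U = "{-\<epsilon><..<\<epsilon>}"
  have "((\<lambda>s. integral (cbox p q) (\<lambda>u. G (s, u))) has_real_derivative
      integral (cbox p q) (\<lambda>u. frechet_derivative G (at (0, u)) (1, 0))) (at 0 within ?U)"
  proof (rule leibniz_rule_field_derivative)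
    fix s u assume "s \<in> ?U"
    then show "((\<lambda>s. G (s, u)) has_real_derivative frechet_derivative G (at (s, u)) (1, 0)) (at s within ?U)"
      using smooth_on_has_vector_derivative[OF G, of "(0, u)" s "(1, 0)"]
      by (auto intro: has_vector_derivative_at_within simp: has_real_derivative_iff_has_vector_derivative)
  next
    fix s assume s: "s \<in> ?U"
    have "continuous_on (cbox p q) (\<lambda>u. G (s, u))"
      using s by (auto intro!: continuous_on_compose2[OF smooth_on_imp_continuous_on[OF G]] continuous_intros)
    then show "(\<lambda>u. G (s, u)) integrable_on cbox p q" by (rule integrable_continuous)
  next
    show "continuous_on (?U \<times> cbox p q) (\<lambda>(s, u). frechet_derivative G (at (s, u)) (1, 0))"
      unfolding case_prod_beta prod.collapse
      by (rule continuous_on_subset[OF smooth_on_imp_continuous_on[OF smooth_on_frechet_derivative[OF G]]]) auto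
  qed (use \<open>\<epsilon> > 0\<close> in auto)
  then show ?thesis using \<open>\<epsilon> > 0\<close> by (simp add: at_within_open[of 0 ?U])
qed

section \<open>Curvature of the FLRW metric\<close>

context
  fixes a :: "real \<Rightarrow> real"
  assumes a_smooth: "smooth_on UNIV a" and a_pos: "\<And>t. a t > 0"
begin

lemma a_deriv: "(a has_real_derivative deriv a t) (at t)"
  using smooth_on_real_deriv(1)[OF a_smooth] by simp

lemma a_deriv2: "(deriv a has_real_derivative deriv (deriv a) t) (at t)"
  using smooth_on_real_deriv(1)[OF smooth_on_real_deriv(2)[OF a_smooth]] by simp

lemmas levi_civita_flrw = levi_civita_eq[OF a_deriv a_pos]

lemma tangent_part_in_tangent_space: "snd q \<noteq> 0 \<Longrightarrow> tangent_part q X \<in> tangent_space q"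
  by (simp add: tangent_part_def tangent_space_def inner_diff_right)

lemma tangent_part_id: "X \<in> tangent_space q \<Longrightarrow> tangent_part q X = X"
  by (simp add: tangent_part_def tangent_space_def)

text \<open>Derivatives are taken in the ambient space, hence also off the unit sphere; the factors
  \<open>snd q \<bullet> snd q\<close> cannot be set to 1 before differentiating.\<close>

lemma has_derivative_tangent_part:
  assumes "snd q \<noteq> 0"
  shows "((\<lambda>q. tangent_part q X) has_derivative
    (\<lambda>w. (0, - (((snd w \<bullet> snd X) / (snd q \<bullet> snd q) -
         2 * (snd q \<bullet> snd X) * (snd q \<bullet> snd w) / (snd q \<bullet> snd q)\<^sup>2) *\<^sub>R snd q +
       ((snd q \<bullet> snd X) / (snd q \<bullet> snd q)) *\<^sub>R snd w)))) (at q)"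
proof -
  let ?\<rho> = "snd q \<bullet> snd q"
  have \<rho>: "?\<rho> \<noteq> 0" using assms by simp
  have "((\<lambda>q. (snd q \<bullet> snd X) / (snd q \<bullet> snd q)) has_derivative
      (\<lambda>w. ((snd w \<bullet> snd X) * ?\<rho> - (snd q \<bullet> snd X) * (snd q \<bullet> snd w + snd w \<bullet> snd q)) / (?\<rho> * ?\<rho>))) (at q)"
    using \<rho> by (intro has_derivative_divide' has_derivative_inner_left has_derivative_inner
        has_derivative_snd has_derivative_ident)
  moreover have "((snd w \<bullet> snd X) * ?\<rho> - (snd q \<bullet> snd X) * (snd q \<bullet> snd w + snd w \<bullet> snd q)) / (?\<rho> * ?\<rho>) =
      (snd w \<bullet> snd X) / ?\<rho> - 2 * (snd q \<bullet> snd X) * (snd q \<bullet> snd w) / ?\<rho>\<^sup>2"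
    for w :: event using \<rho> by (simp add: inner_commute[of "snd w" "snd q"] diff_divide_distrib power2_eq_square)
  ultimately have c: "((\<lambda>q. (snd q \<bullet> snd X) / (snd q \<bullet> snd q)) has_derivative
      (\<lambda>w. (snd w \<bullet> snd X) / ?\<rho> - 2 * (snd q \<bullet> snd X) * (snd q \<bullet> snd w) / ?\<rho>\<^sup>2)) (at q)"
    by (simp only:)
  have "((\<lambda>q. tangent_part q X) has_derivative
    (\<lambda>w. (0, 0 - (((snd q \<bullet> snd X) / ?\<rho>) *\<^sub>R snd w +
       ((snd w \<bullet> snd X) / ?\<rho> - 2 * (snd q \<bullet> snd X) * (snd q \<bullet> snd w) / ?\<rho>\<^sup>2) *\<^sub>R snd q)))) (at q)"
    unfolding tangent_part_def
    by (intro has_derivative_Pair has_derivative_const has_derivative_diff has_derivative_scaleR c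
        has_derivative_snd has_derivative_ident)
  then show ?thesis by (simp add: add.commute)
qed

lemma frechet_derivative_tangent_part:
  assumes "snd q \<noteq> 0" "w \<in> tangent_space q"
  shows "frechet_derivative (\<lambda>q. tangent_part q X) (at q) w =
    (0, - (((snd w \<bullet> snd X) / (snd q \<bullet> snd q)) *\<^sub>R snd q +
       ((snd q \<bullet> snd X) / (snd q \<bullet> snd q)) *\<^sub>R snd w))"
  using assms
  by (simp add: frechet_derivative_at[OF has_derivative_tangent_part, symmetric] tangent_space_def)

text \<open>The covariant derivative of one projected constant field along another, in a form free
  of \<open>sharp\<close> and \<open>frechet_derivative\<close> and valid on an open set, so that it
  can be differentiated again for the curvature. The term with \<open>snd q \<bullet> snd Y\<close>
  comes from differentiating the projection, the others are the Christoffel terms of the warping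
  function.\<close>

definition nabla_tp :: "event \<Rightarrow> event \<Rightarrow> event \<Rightarrow> event" where
  "nabla_tp X Y q = (let X' = snd (tangent_part q X); Y' = snd (tangent_part q Y) in
    (a (fst q) * deriv a (fst q) * (X' \<bullet> Y'),
     - (((snd q \<bullet> snd Y) / (snd q \<bullet> snd q)) *\<^sub>R X') +
     (deriv a (fst q) / a (fst q)) *\<^sub>R (fst X *\<^sub>R Y' + fst Y *\<^sub>R X')))"

lemma nabla_tangent_part:
  assumes "snd q \<noteq> 0"
  shows "nabla a (\<lambda>q. tangent_part q X) (\<lambda>q. tangent_part q Y) q = nabla_tp X Y q"
proof -
  have "snd q \<bullet> snd (tangent_part q X) = 0"
    using tangent_part_in_tangent_space[OF assms] by (simp add: tangent_space_def)
  moreover have "fst (tangent_part q X) = fst X" for X by (simp add: tangent_part_def)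
  ultimately show ?thesis
    unfolding nabla_def levi_civita_flrw[OF assms tangent_part_in_tangent_space[OF assms] tangent_part_in_tangent_space[OF assms]]
      frechet_derivative_tangent_part[OF assms tangent_part_in_tangent_space[OF assms]]
    using assms
    by (simp add: nabla_tp_def Let_def, subst tangent_part_def) (simp add: algebra_simps inner_diff_right)
qed

lemma open_snd_nonzero: "open {q :: event. snd q \<noteq> 0}"
proof -
  have "{q :: event. snd q \<noteq> 0} = snd -` (- {0})" by auto
  then show ?thesis by (metis open_vimage_snd open_Compl closed_singleton)
qed

text \<open>\<open>X\<close> may have a radial part, since the trace in \<open>Ric\<close> runs over
  an ambient basis. The space component is split into a multiple of \<open>snd p\<close> and a
  tangential remainder, because the outer covariant derivative projects the former away.\<close>

lemma frechet_derivative_nabla_tangent_part: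
  assumes p: "norm (snd p) = 1" and Y: "Y \<in> tangent_space p" and w: "w \<in> tangent_space p"
  shows "frechet_derivative (nabla a (\<lambda>q. tangent_part q X) (\<lambda>q. tangent_part q Y)) (at p) w =
    (((deriv a (fst p))\<^sup>2 + a (fst p) * deriv (deriv a) (fst p)) * fst w * (snd X \<bullet> snd Y)
       - a (fst p) * deriv a (fst p) * (snd p \<bullet> snd X) * (snd w \<bullet> snd Y),
     (- deriv a (fst p) / a (fst p) * (fst X * (snd w \<bullet> snd Y) + fst Y * (snd w \<bullet> snd X))) *\<^sub>R snd p +
       (- ((snd w \<bullet> snd Y) *\<^sub>R snd (tangent_part p X))
       + ((deriv (deriv a) (fst p) / a (fst p) - (deriv a (fst p) / a (fst p))\<^sup>2) * fst w) *\<^sub>R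
           (fst X *\<^sub>R snd Y + fst Y *\<^sub>R snd (tangent_part p X))
       - (deriv a (fst p) / a (fst p) * fst Y * (snd p \<bullet> snd X)) *\<^sub>R snd w))"
proof -
  let ?x = "snd p" and ?t = "fst p"
  have x: "?x \<noteq> 0" "?x \<bullet> ?x = 1" using p by (auto simp: norm_eq_1)
  have xY: "?x \<bullet> snd Y = 0" using Y by (simp add: tangent_space_def)
  have N: "nabla a (\<lambda>q. tangent_part q X) (\<lambda>q. tangent_part q Y) q = nabla_tp X Y q" if "snd q \<noteq> 0" for q
    using nabla_tangent_part that by auto
  have T: "((\<lambda>q. tangent_part q Z) has_derivative frechet_derivative (\<lambda>q. tangent_part q Z) (at p)) (at p)" for Z
    using has_derivative_tangent_part[OF x(1), of Z]
    by (auto simp flip: frechet_derivative_works simp: differentiable_def)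
  have A: "((\<lambda>q::event. a (fst q)) has_derivative (\<lambda>w. fst w * deriv a ?t)) (at p)"
    using has_derivative_compose[OF has_derivative_fst[OF has_derivative_ident], of a "(*) (deriv a ?t)" p UNIV] a_deriv
    by (simp add: has_field_derivative_def mult.commute)
  have A': "((\<lambda>q::event. deriv a (fst q)) has_derivative (\<lambda>w. fst w * deriv (deriv a) ?t)) (at p)"
    using has_derivative_compose[OF has_derivative_fst[OF has_derivative_ident], of "deriv a" "(*) (deriv (deriv a) ?t)" p UNIV] a_deriv2
    by (simp add: has_field_derivative_def mult.commute)
  let ?T = "\<lambda>Z. snd (tangent_part p Z)" and ?T' = "\<lambda>Z w. snd (frechet_derivative (\<lambda>q. tangent_part q Z) (at p) w)"
  let ?D = "\<lambda>w. ((fst w * deriv a ?t * deriv a ?t + a ?t * (fst w * deriv (deriv a) ?t)) * (?T X \<bullet> ?T Y) +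
        a ?t * deriv a ?t * (?T' X w \<bullet> ?T Y + ?T X \<bullet> ?T' Y w),
      - ((snd w \<bullet> snd Y) *\<^sub>R ?T X) +
      ((fst w * deriv (deriv a) ?t * a ?t - deriv a ?t * (fst w * deriv a ?t)) / (a ?t * a ?t)) *\<^sub>R (fst X *\<^sub>R ?T Y + fst Y *\<^sub>R ?T X) +
      (deriv a ?t / a ?t) *\<^sub>R (fst X *\<^sub>R ?T' Y w + fst Y *\<^sub>R ?T' X w))"
  have "(nabla_tp X Y has_derivative ?D) (at p)"
    unfolding nabla_tp_def[abs_def] Let_def
    using x xY a_pos[of ?t]
    by (auto intro!: derivative_eq_intros T A A' simp: fun_eq_iff algebra_simps)
  then have "(nabla a (\<lambda>q. tangent_part q X) (\<lambda>q. tangent_part q Y) has_derivative ?D) (at p)"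
    using has_derivative_transform_within_open[OF _ open_snd_nonzero, of "nabla_tp X Y" ?D p UNIV] N x by auto
  from frechet_derivative_at[OF this, symmetric]
  have D: "frechet_derivative (nabla a (\<lambda>q. tangent_part q X) (\<lambda>q. tangent_part q Y)) (at p) w = ?D w" by simp
  have T'w: "?T' Z w = - ((snd w \<bullet> snd Z) *\<^sub>R ?x + (?x \<bullet> snd Z) *\<^sub>R snd w)" for Z
    using frechet_derivative_tangent_part[OF x(1) w, of Z] x by simp
  have TY: "?T Y = snd Y" using tangent_part_id[OF Y] by simp
  have xT: "?x \<bullet> ?T Z = 0" for Z
    using tangent_part_in_tangent_space[OF x(1)] by (simp add: tangent_space_def)
  have TX: "?T X \<bullet> snd Y = snd X \<bullet> snd Y"
    using xY by (simp add: tangent_part_def inner_diff_left)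
  show ?thesis
    unfolding D T'w TY
    using a_pos[of ?t] xT xY TX
    by (simp add: inner_commute[of _ ?x] inner_add_right inner_diff_right inner_add_left inner_diff_left
        scaleR_add_right scaleR_diff_right algebra_simps power2_eq_square diff_divide_distrib xY)
qed

lemma riemann_flrw:
  fixes X Y Z :: event
  assumes p: "norm (snd p) = 1" and Y: "Y \<in> tangent_space p" and Z: "Z \<in> tangent_space p"
  defines "X' \<equiv> snd (tangent_part p X)"
  shows "riemann a (\<lambda>q. tangent_part q X) (\<lambda>q. tangent_part q Y) (\<lambda>q. tangent_part q Z) p =
    (a (fst p) * deriv (deriv a) (fst p) * (fst X * (snd Y \<bullet> snd Z) - fst Y * (X' \<bullet> snd Z)),
     (1 + (deriv a (fst p))\<^sup>2) *\<^sub>R ((snd Y \<bullet> snd Z) *\<^sub>R X' - (X' \<bullet> snd Z) *\<^sub>R snd Y) +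
     (deriv (deriv a) (fst p) / a (fst p)) *\<^sub>R ((fst X * fst Z) *\<^sub>R snd Y - (fst Y * fst Z) *\<^sub>R X'))"
proof -
  let ?x = "snd p" and ?t = "fst p"
  \<comment> \<open>With \<open>h\<close> the Hubble rate and \<open>k\<close> the relative
    acceleration, the derivatives of \<open>a\<close> become \<open>h A\<close> and
    \<open>k A\<close>, and the quotients by \<open>a\<close> cancel.\<close>
  define A h k where "A = a (fst p)" and "h = deriv a (fst p) / a (fst p)"
    and "k = deriv (deriv a) (fst p) / a (fst p)"
  have A: "a (fst p) = A" "deriv a (fst p) = h * A" "deriv (deriv a) (fst p) = k * A"
    using a_pos[of "fst p"] by (auto simp: A_def h_def k_def)
  have x: "?x \<noteq> 0" "?x \<bullet> ?x = 1" using p by (auto simp: norm_eq_1)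
  have xY: "?x \<bullet> snd Y = 0" and xZ: "?x \<bullet> snd Z = 0" using Y Z by (auto simp: tangent_space_def)
  note tp = tangent_part_in_tangent_space[OF x(1)]
  have TX: "tangent_part p X = (fst X, X')" by (simp add: X'_def tangent_part_def)
  have xX: "?x \<bullet> X' = 0" using tp[of X] by (simp add: X'_def tangent_space_def)
  have X: "snd X = X' + (?x \<bullet> snd X) *\<^sub>R ?x" by (simp add: X'_def tangent_part_def x)
  note TY = tangent_part_id[OF Y] and TZ = tangent_part_id[OF Z]
  have aa: "A \<noteq> 0" unfolding A_def using a_pos[of "fst p"] by simp
  have tpn: "tangent_part p (\<tau>, r *\<^sub>R ?x + v) = (\<tau>, v)" if "?x \<bullet> v = 0" for \<tau> r v
    using that x by (simp add: tangent_part_def inner_add_right)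
  have XY: "snd X \<bullet> snd Y = X' \<bullet> snd Y" "snd Y \<bullet> snd X = X' \<bullet> snd Y"
    and XZ: "snd X \<bullet> snd Z = X' \<bullet> snd Z" "snd Z \<bullet> snd X = X' \<bullet> snd Z"
    using xY xZ by (subst X, simp add: inner_add_left inner_add_right inner_commute)+
  note D1 = frechet_derivative_nabla_tangent_part[OF p Z tp[of X], of Y, unfolded TX TY fst_conv snd_conv A]
  note D2 = frechet_derivative_nabla_tangent_part[OF p Z Y, of X, unfolded TX fst_conv snd_conv A]
  have n1: "nabla a (\<lambda>q. tangent_part q Y) (\<lambda>q. tangent_part q Z) p = nabla_tp Y Z p"
    and n2: "nabla a (\<lambda>q. tangent_part q X) (\<lambda>q. tangent_part q Z) p = nabla_tp X Z p"
    by (rule nabla_tangent_part[OF x(1)])+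
  have tn: "nabla_tp V Z p \<in> tangent_space p" for V
    using tp[of V] xZ Z by (simp add: nabla_tp_def Let_def tangent_space_def TZ inner_add_right)
  \<comment> \<open>The projected constant fields do not commute if \<open>X\<close> has a radial
    part. The bracket term \<open>3\<close> cancels exactly the summands with
    \<open>?x \<bullet> snd X\<close> in \<open>2\<close>, as tensoriality demands.\<close>
  have L: "lie_bracket (\<lambda>q. tangent_part q X) (\<lambda>q. tangent_part q Y) p = (0, (?x \<bullet> snd X) *\<^sub>R snd Y)"
    unfolding lie_bracket_def TX TY
      frechet_derivative_tangent_part[OF x(1) tp[of X, unfolded TX]] frechet_derivative_tangent_part[OF x(1) Y]
    using x xY by (simp add: XY inner_commute[of X'])
  have Lt: "(0, (?x \<bullet> snd X) *\<^sub>R snd Y) \<in> tangent_space p" using xY by (simp add: tangent_space_def)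
  note orth = xX xY xZ inner_add_right inner_diff_right inner_minus_right inner_scaleR_right
  have 1: "nabla a (\<lambda>q. tangent_part q X) (nabla a (\<lambda>q. tangent_part q Y) (\<lambda>q. tangent_part q Z)) p =
     ((h\<^sup>2 + k) * A\<^sup>2 * fst X * (snd Y \<bullet> snd Z) + h\<^sup>2 * A\<^sup>2 * (fst Y * (X' \<bullet> snd Z) + fst Z * (X' \<bullet> snd Y)),
      - ((X' \<bullet> snd Z) *\<^sub>R snd Y) + (k * fst X) *\<^sub>R (fst Y *\<^sub>R snd Z + fst Z *\<^sub>R snd Y)
      + (h\<^sup>2 * A\<^sup>2 * (snd Y \<bullet> snd Z)) *\<^sub>R X')"
    unfolding nabla_def[of a _ "nabla a _ _"] n1 levi_civita_flrw[OF x(1) tp[of X, unfolded TX] tn] TX D1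
    apply (subst tpn)
    subgoal by (simp add: orth)
    unfolding nabla_tp_def Let_def TX TY TZ A
    using aa xY xZ
    by (simp add: inner_add_right XY XZ) (simp add: algebra_simps power2_eq_square)
  have 2: "nabla a (\<lambda>q. tangent_part q Y) (nabla a (\<lambda>q. tangent_part q X) (\<lambda>q. tangent_part q Z)) p =
     ((h\<^sup>2 + k) * A\<^sup>2 * fst Y * (X' \<bullet> snd Z) + h\<^sup>2 * A\<^sup>2 * (fst X * (snd Y \<bullet> snd Z) + fst Z * (X' \<bullet> snd Y))
        - h * A\<^sup>2 * (?x \<bullet> snd X) * (snd Y \<bullet> snd Z),
      - ((snd Y \<bullet> snd Z) *\<^sub>R X') + (k * fst Y) *\<^sub>R (fst X *\<^sub>R snd Z + fst Z *\<^sub>R X')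
      + (h\<^sup>2 * A\<^sup>2 * (X' \<bullet> snd Z)) *\<^sub>R snd Y - (h * fst Z * (?x \<bullet> snd X)) *\<^sub>R snd Y)"
    unfolding nabla_def[of a _ "nabla a _ _"] n2 levi_civita_flrw[OF x(1) Y tn] TY D2
    apply (subst tpn)
    subgoal by (simp add: orth)
    unfolding nabla_tp_def Let_def TX TY TZ A
    using aa xY xZ
    by (simp add: inner_add_right XY XZ inner_commute[of "snd Y" X']) (simp add: algebra_simps power2_eq_square)
  have 3: "nabla a (lie_bracket (\<lambda>q. tangent_part q X) (\<lambda>q. tangent_part q Y)) (\<lambda>q. tangent_part q Z) p =
     (h * A\<^sup>2 * (?x \<bullet> snd X) * (snd Y \<bullet> snd Z), (h * fst Z * (?x \<bullet> snd X)) *\<^sub>R snd Y)"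
    unfolding nabla_def L TZ frechet_derivative_tangent_part[OF x(1) Lt] levi_civita_flrw[OF x(1) Lt Z] A
    using aa by (simp add: tangent_part_def x xZ power2_eq_square)
  show ?thesis
    unfolding riemann_def 1 2 3 A
    using aa by (simp add: algebra_simps power2_eq_square)
qed

section \<open>Traces: Ricci and Einstein tensor\<close>

lemma sum_Basis_inner_mult: "(\<Sum>b\<in>Basis. (u \<bullet> b) * (v \<bullet> b)) = u \<bullet> (v :: 'c :: euclidean_space)"
  by (simp add: euclidean_inner[of u v])

lemma sum_Basis_event:
  fixes g :: "event \<Rightarrow> real"
  shows "(\<Sum>b\<in>Basis. g b) = g (1, 0) + (\<Sum>e\<in>Basis. g (0, e))"
  unfolding Basis_prod_def[where 'a = real]
  by (subst sum.union_disjoint) (auto simp: sum.reindex inj_on_def)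

text \<open>The two traces in the Ricci tensor: of the projection onto the tangent space of the
  3-sphere, which has rank three, and of a map with range in the span of \<open>w\<close>.\<close>

lemma sum_Basis_tangent:
  assumes "norm (snd p) = 1" "snd p \<bullet> v = 0"
  shows "(\<Sum>e\<in>Basis. snd (tangent_part p (0, e)) \<bullet> e) = 3"
    and "(\<Sum>e\<in>Basis. (snd (tangent_part p (0, e)) \<bullet> v) * (w \<bullet> e)) = v \<bullet> w"
proof -
  have x: "snd p \<bullet> snd p = 1" using assms(1) by (simp add: norm_eq_1)
  have "(\<Sum>e\<in>Basis. snd (tangent_part p (0, e)) \<bullet> e) = (\<Sum>e\<in>Basis. 1 - (snd p \<bullet> e) * (snd p \<bullet> e))"
    by (rule sum.cong) (auto simp: tangent_part_def x inner_diff_left inner_Basis)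
  also have "\<dots> = 3" by (simp add: sum_subtractf sum_Basis_inner_mult x)
  finally show "(\<Sum>e\<in>Basis. snd (tangent_part p (0, e)) \<bullet> e) = 3" .
  have "snd (tangent_part p (0, e)) \<bullet> v = v \<bullet> e" for e
    using assms(2) by (simp only: tangent_part_def snd_conv inner_diff_left inner_scaleR_left)
      (simp only: mult_zero_right diff_zero inner_commute)
  then show "(\<Sum>e\<in>Basis. (snd (tangent_part p (0, e)) \<bullet> v) * (w \<bullet> e)) = v \<bullet> w"
    by (simp only: sum_Basis_inner_mult)
qed

lemma Ric_flrw:
  assumes p: "norm (snd p) = 1" and Y: "Y \<in> tangent_space p" and Z: "Z \<in> tangent_space p"
  shows "Ric a p Y Z = - 3 * (deriv (deriv a) (fst p) / a (fst p)) * (fst Y * fst Z) +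
    (a (fst p) * deriv (deriv a) (fst p) + 2 + 2 * (deriv a (fst p))\<^sup>2) * (snd Y \<bullet> snd Z)"
proof -
  have xY: "snd p \<bullet> snd Y = 0" and xZ: "snd p \<bullet> snd Z = 0" using Y Z by (auto simp: tangent_space_def)
  let ?x = "\<lambda>e. snd (tangent_part p (0, e))"
  let ?r = "deriv (deriv a) (fst p) / a (fst p)"
  have T: "snd (tangent_part p (1, 0)) = 0" by (simp add: tangent_part_def)
  have "Ric a p Y Z = a (fst p) * deriv (deriv a) (fst p) * (snd Y \<bullet> snd Z) +
    (\<Sum>e\<in>Basis. ((1 + (deriv a (fst p))\<^sup>2) * (snd Y \<bullet> snd Z) - ?r * (fst Y * fst Z)) * (?x e \<bullet> e)
       - (1 + (deriv a (fst p))\<^sup>2) * ((?x e \<bullet> snd Z) * (snd Y \<bullet> e)))"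
    unfolding Ric_def riemann_flrw[OF assms] sum_Basis_event
    by (simp add: T inner_add_left inner_diff_left) (simp add: algebra_simps)
  also have "\<dots> = a (fst p) * deriv (deriv a) (fst p) * (snd Y \<bullet> snd Z) +
      (((1 + (deriv a (fst p))\<^sup>2) * (snd Y \<bullet> snd Z) - ?r * (fst Y * fst Z)) * 3
       - (1 + (deriv a (fst p))\<^sup>2) * (snd Z \<bullet> snd Y))"
    unfolding sum_subtractf sum_distrib_left[symmetric] sum_Basis_tangent(1)[OF p xZ] sum_Basis_tangent(2)[OF p xZ] ..
  finally show ?thesis by (simp add: algebra_simps inner_commute)
qed

lemma Ein_flrw:
  assumes p: "norm (snd p) = 1" and Y: "Y \<in> tangent_space p" and Z: "Z \<in> tangent_space p"
  shows "Ein a p Y Z = 3 * (1 + (deriv a (fst p))\<^sup>2) / (a (fst p))\<^sup>2 * (fst Y * fst Z)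
     - (2 * a (fst p) * deriv (deriv a) (fst p) + 1 + (deriv a (fst p))\<^sup>2) * (snd Y \<bullet> snd Z)"
proof -
  have x: "snd p \<noteq> 0" using p by auto
  note tp = tangent_part_in_tangent_space[OF x]
  have aa: "a (fst p) > 0" by (rule a_pos)
  let ?r = "deriv (deriv a) (fst p) / a (fst p)"
  \<comment> \<open>The Ricci endomorphism has eigenvalue \<open>3 * ?r\<close> on the time
    direction and \<open>?c\<close> on the three space directions; its trace is the scalar
    curvature.\<close>
  let ?c = "?r + 2 * (1 + (deriv a (fst p))\<^sup>2) / (a (fst p))\<^sup>2"
  have "sharp a p (Ric a p (tangent_part p b)) = (3 * ?r * fst b, ?c *\<^sub>R snd (tangent_part p b))" for b
  proof (rule sharp_eqI)
    show "(3 * ?r * fst b, ?c *\<^sub>R snd (tangent_part p b)) \<in> tangent_space p"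
      using tp[of b] by (simp add: tangent_space_def)
    show "flrw a p (3 * ?r * fst b, ?c *\<^sub>R snd (tangent_part p b)) U = Ric a p (tangent_part p b) U"
      if "U \<in> tangent_space p" for U
      unfolding Ric_flrw[OF p tp that] using aa
      by (simp add: flrw_def field_simps power2_eq_square) (simp add: tangent_part_def)
  qed (rule aa)
  then have "Sc a p = 3 * ?r + (\<Sum>e\<in>Basis. ?c * (snd (tangent_part p (0, e)) \<bullet> e))"
    unfolding Sc_def sum_Basis_event by simp
  then have Sc: "Sc a p = 3 * ?r + ?c * 3"
    unfolding sum_distrib_left[symmetric] sum_Basis_tangent(1)[OF p inner_zero_right] .
  show ?thesis
    unfolding Ein_def Ric_flrw[OF assms] Sc flrw_def using aa
    by (simp add: field_simps power2_eq_square)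
qed

end

section \<open>Lagrangians on two-jets of parametrized tori\<close>

type_synonym jet = "event \<times> event \<times> event \<times> event \<times> event \<times> event \<times> event"

text \<open>Both orders of the mixed derivative get a slot, because
  \<open>mean_curvature_vector\<close> sums \<open>chi\<close> over both; a Lagrangian is then a
  plain function on a Euclidean space, to be differentiated in every slot.\<close>

definition jet :: "(real \<times> real \<Rightarrow> event) \<Rightarrow> real \<times> real \<Rightarrow> jet" where
  "jet f u = (f u, partial e1 f u, partial e2 f u,
     partial e1 (partial e1 f) u, partial e1 (partial e2 f) u,
     partial e2 (partial e1 f) u, partial e2 (partial e2 f) u)"

definition turn :: "real \<times> real \<Rightarrow> event \<Rightarrow> event" where
  "turn u X = (fst X, cis (fst u) * fst (snd X), cis (snd u) * snd (snd X))"

text \<open>The generator of \<open>turn\<close>: \<open>turn u (spin h X)\<close> is the derivative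
  of \<open>turn u X\<close> with respect to \<open>u\<close> along \<open>h\<close>.\<close>

definition spin :: "real \<times> real \<Rightarrow> event \<Rightarrow> event" where
  "spin h X = (0, fst h *\<^sub>R (\<i> * fst (snd X)), snd h *\<^sub>R (\<i> * snd (snd X)))"

definition turn_jet :: "real \<times> real \<Rightarrow> jet \<Rightarrow> jet" where
  "turn_jet u = (\<lambda>(x, x1, x2, x11, x12, x21, x22).
     (turn u x, turn u x1, turn u x2, turn u x11, turn u x12, turn u x21, turn u x22))"

text \<open>The two-jet at parameter \<open>(0, 0)\<close> of the orbit map of \<open>X\<close>; at
  other parameters it is rotated by \<open>turn_jet\<close>, see \<open>jet_turn\<close>. Being
  linear in \<open>X\<close>, it also serves for velocities.\<close>

definition orbit_jet :: "event \<Rightarrow> jet" where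
  "orbit_jet X = (X, spin e1 X, spin e2 X, spin e1 (spin e1 X), spin e1 (spin e2 X),
     spin e2 (spin e1 X), spin e2 (spin e2 X))"

section \<open>The action of the rotations on jets\<close>

lemma bounded_linear_turn: "bounded_linear (turn u)"
  unfolding turn_def
  by (intro bounded_linear_Pair bounded_linear_fst bounded_linear_fst_comp bounded_linear_snd_comp
      bounded_linear_const_mult bounded_linear_snd)

lemma turn_simps:
  "turn u (X + Y) = turn u X + turn u Y" "turn u (X - Y) = turn u X - turn u Y"
  "turn u (- X) = - turn u X" "turn u (r *\<^sub>R X) = r *\<^sub>R turn u X" "turn u 0 = 0"
  using bounded_linear.linear[OF bounded_linear_turn]
  by (auto simp: linear_add linear_diff linear_neg linear_scale linear_0)

lemma spin_add: "spin h (X + Y) = spin h X + spin h Y" and spin_scaleR: "spin h (r *\<^sub>R X) = r *\<^sub>R spin h X"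
  by (simp_all add: spin_def algebra_simps)

lemma inner_cis_mult: "(cis r * z) \<bullet> (cis r * w) = z \<bullet> w"
proof -
  have "(cis r * z) \<bullet> (cis r * w) = ((cos r)\<^sup>2 + (sin r)\<^sup>2) * (z \<bullet> w)"
    unfolding inner_complex_def times_complex.sel cis.sel by algebra
  then show ?thesis by simp
qed

lemma inner_turn: "snd (turn u X) \<bullet> snd (turn u Y) = snd X \<bullet> snd Y"
  by (simp add: turn_def inner_prod_def inner_cis_mult)

lemma fst_turn [simp]: "fst (turn u X) = fst X"
  by (simp add: turn_def)

lemma bounded_linear_turn_jet: "bounded_linear (turn_jet u)"
  unfolding turn_jet_def case_prod_beta
  by (intro bounded_linear_Pair bounded_linear_compose[OF bounded_linear_turn] bounded_linear_fst
      bounded_linear_fst_comp bounded_linear_snd_comp bounded_linear_snd)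

lemma bounded_linear_spin: "bounded_linear (spin h)"
  unfolding linear_conv_bounded_linear[symmetric] by (intro linearI spin_add spin_scaleR)

lemma bounded_linear_orbit_jet: "bounded_linear orbit_jet"
  unfolding orbit_jet_def
  by (intro bounded_linear_Pair bounded_linear_compose[OF bounded_linear_spin] bounded_linear_ident)

lemma has_derivative_scaleR_turn:
  assumes "(\<phi> has_derivative \<phi>') (at u)"
  shows "((\<lambda>u. \<phi> u *\<^sub>R turn u X) has_derivative
    (\<lambda>h. \<phi>' h *\<^sub>R turn u X + \<phi> u *\<^sub>R turn u (spin h X))) (at u)"
proof -
  have "((\<lambda>u. turn u X) has_derivative (\<lambda>h. turn u (spin h X))) (at u)"
    unfolding turn_def spin_def
    by (auto intro!: derivative_eq_intros simp: fun_eq_iff zero_prod_def algebra_simps)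
  from has_derivative_scaleR[OF assms this] show ?thesis by (simp add: add.commute)
qed

lemma partial_scaleR_turn:
  assumes "smooth_on UNIV \<phi>"
  shows "frechet_derivative (\<lambda>u. \<phi> u *\<^sub>R turn u X) (at u) h =
    frechet_derivative \<phi> (at u) h *\<^sub>R turn u X + \<phi> u *\<^sub>R turn u (spin h X)"
  by (simp add: frechet_derivative_at[OF has_derivative_scaleR_turn[OF smooth_on_has_derivative[OF assms UNIV_I]], symmetric])

lemma partial2_scaleR_turn:
  assumes "smooth_on UNIV \<phi>"
  shows "frechet_derivative (\<lambda>u. frechet_derivative (\<lambda>u. \<phi> u *\<^sub>R turn u X) (at u) h) (at u) k =
    frechet_derivative (\<lambda>u. frechet_derivative \<phi> (at u) h) (at u) k *\<^sub>R turn u X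
    + frechet_derivative \<phi> (at u) h *\<^sub>R turn u (spin k X)
    + frechet_derivative \<phi> (at u) k *\<^sub>R turn u (spin h X) + \<phi> u *\<^sub>R turn u (spin k (spin h X))"
proof -
  have "((\<lambda>u. frechet_derivative \<phi> (at u) h *\<^sub>R turn u X + \<phi> u *\<^sub>R turn u (spin h X)) has_derivative
     (\<lambda>k. (frechet_derivative (\<lambda>u. frechet_derivative \<phi> (at u) h) (at u) k *\<^sub>R turn u X
       + frechet_derivative \<phi> (at u) h *\<^sub>R turn u (spin k X))
    + (frechet_derivative \<phi> (at u) k *\<^sub>R turn u (spin h X) + \<phi> u *\<^sub>R turn u (spin k (spin h X))))) (at u)"
    by (intro has_derivative_add has_derivative_scaleR_turn smooth_on_has_derivative[of UNIV]
        smooth_on_frechet_derivative assms UNIV_I)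
  from frechet_derivative_at[OF this, symmetric] show ?thesis
    by (simp add: partial_scaleR_turn[OF assms] add.assoc)
qed

text \<open>Once the rotation is pulled out, the jets multiplying \<open>\<phi>\<close> and its
  derivatives do not depend on \<open>u\<close>; this is where coefficients become constant. The
  multiple 2 collects the two cross terms of a pure second derivative.\<close>

lemma jet_scaleR_turn:
  assumes "smooth_on UNIV \<phi>"
  shows "jet (\<lambda>u. \<phi> u *\<^sub>R turn u X) u = turn_jet u (\<phi> u *\<^sub>R orbit_jet X
    + frechet_derivative \<phi> (at u) e1 *\<^sub>R (0, X, 0, 2 *\<^sub>R spin e1 X, spin e2 X, spin e2 X, 0)
    + frechet_derivative \<phi> (at u) e2 *\<^sub>R (0, 0, X, 0, spin e1 X, spin e1 X, 2 *\<^sub>R spin e2 X)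
    + frechet_derivative (\<lambda>u. frechet_derivative \<phi> (at u) e1) (at u) e1 *\<^sub>R (0, 0, 0, X, 0, 0, 0)
    + frechet_derivative (\<lambda>u. frechet_derivative \<phi> (at u) e2) (at u) e1 *\<^sub>R (0, 0, 0, 0, X, 0, 0)
    + frechet_derivative (\<lambda>u. frechet_derivative \<phi> (at u) e1) (at u) e2 *\<^sub>R (0, 0, 0, 0, 0, X, 0)
    + frechet_derivative (\<lambda>u. frechet_derivative \<phi> (at u) e2) (at u) e2 *\<^sub>R (0, 0, 0, 0, 0, 0, X))"
  unfolding jet_def partial2_scaleR_turn[OF assms]
  unfolding partial_scaleR_turn[OF assms] orbit_jet_def turn_jet_def
  by (simp add: turn_simps scaleR_2 scaleR_add_right add_ac)

lemma jet_turn: "jet (\<lambda>u. turn u X) u = turn_jet u (orbit_jet X)"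
  using jet_scaleR_turn[OF smooth_on_const[of UNIV "1 :: real"], of X u]
  by (simp flip: zero_prod_def)

text \<open>Reads the derivatives of one surface of the family off the joint map, so that they are
  seen to be smooth in \<open>s\<close> as well.\<close>

lemma partial_slice:
  assumes G: "smooth_on ({-\<epsilon><..<\<epsilon>} \<times> UNIV) G" and s: "s \<in> {-\<epsilon><..<\<epsilon>}"
  shows "frechet_derivative (\<lambda>u. G (s, u)) (at u) i = frechet_derivative G (at (s, u)) (0, i)"
proof -
  have "((\<lambda>u. (s, u)) has_derivative (\<lambda>h. (0, h))) (at u)" by (auto intro!: derivative_eq_intros)
  from has_derivative_compose[OF this smooth_on_has_derivative[OF G]] s
  have "((\<lambda>u. G (s, u)) has_derivative (\<lambda>h. frechet_derivative G (at (s, u)) (0, h))) (at u)" by simp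
  from frechet_derivative_at[OF this, symmetric] show ?thesis by simp
qed

lemma integrable_torus_map:
  fixes \<psi> :: "real \<times> real \<Rightarrow> real"
  assumes "smooth_torus_map \<psi>"
  shows "\<psi> integrable_on cbox p q"
  using assms by (intro integrable_continuous)
    (auto simp: smooth_torus_map_def intro: continuous_on_subset[OF smooth_on_imp_continuous_on])

text \<open>Invariance carries the differential of \<open>L\<close> from every point of the orbit
  back to the single jet \<open>orbit_jet X\<close>. What survives integration is the differential
  along \<open>orbit_jet Y\<close>, the velocity of a variation through orbits.\<close>

theorem first_variation_orbit:
  fixes L :: "jet \<Rightarrow> real"
  assumes T: "open T" "\<And>u J. J \<in> T \<Longrightarrow> turn_jet u J \<in> T"
    and L: "smooth_on T L" "\<And>u J. J \<in> T \<Longrightarrow> L (turn_jet u J) = L J"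
    and F: "\<epsilon> > 0" "smooth_on ({-\<epsilon><..<\<epsilon>} \<times> UNIV) (\<lambda>(s, u). F s u)"
      "F 0 = (\<lambda>u. turn u X)" "\<And>u. ((\<lambda>s. F s u) has_vector_derivative \<phi> u *\<^sub>R turn u Y) (at 0)"
      "\<And>s u. s \<in> {-\<epsilon><..<\<epsilon>} \<Longrightarrow> jet (F s) u \<in> T"
    and \<phi>: "smooth_torus_map \<phi>"
  shows "((\<lambda>s. integral (cbox (0, 0) (2 * pi, 2 * pi)) (\<lambda>u. L (jet (F s) u))) has_real_derivative
    frechet_derivative L (at (orbit_jet X)) (orbit_jet Y) * integral (cbox (0, 0) (2 * pi, 2 * pi)) \<phi>) (at 0)"
proof -
  let ?I = "{-\<epsilon><..<\<epsilon>}" and ?\<Omega> = "{-\<epsilon><..<\<epsilon>} \<times> (UNIV :: (real \<times> real) set)"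
  let ?B = "cbox (0, 0) (2 * pi, 2 * pi) :: (real \<times> real) set"
  have \<Omega>: "open ?\<Omega>" by (intro open_Times) auto
  have 0: "0 \<in> ?I" using F(1) by simp
  have \<phi>': "smooth_on UNIV \<phi>" using \<phi> by (simp add: smooth_torus_map_def)
  define G where "G = (\<lambda>(s, u). F s u)"
  define G1 where "G1 i z = frechet_derivative G (at z) (0, i)" for i :: "real \<times> real" and z
  define G2 where "G2 i j z = frechet_derivative (G1 j) (at z) (0, i)" for i j :: "real \<times> real" and z
  have G: "smooth_on ?\<Omega> G" using F(2) by (simp add: G_def)
  have G1: "smooth_on ?\<Omega> (G1 i)" for i unfolding G1_def by (rule smooth_on_frechet_derivative[OF G])
  have G2: "smooth_on ?\<Omega> (G2 i j)" for i j unfolding G2_def by (rule smooth_on_frechet_derivative[OF G1])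
  have F_eq: "F s = (\<lambda>u. G (s, u))" for s by (simp add: G_def)
  have p1: "partial i (F s) u = G1 i (s, u)" if "s \<in> ?I" for i s u
    unfolding F_eq G1_def by (rule partial_slice[OF G that])
  have p2: "partial i (partial j (F s)) u = G2 i j (s, u)" if "s \<in> ?I" for i j s u
    unfolding p1[OF that] G2_def by (rule partial_slice[OF G1 that])
  define J where "J z = (G z, G1 e1 z, G1 e2 z, G2 e1 e1 z, G2 e1 e2 z, G2 e2 e1 z, G2 e2 e2 z)" for z
  have J_eq: "jet (F s) u = J (s, u)" if "s \<in> ?I" for s u
    unfolding jet_def J_def p2[OF that] unfolding p1[OF that] by (simp add: G_def)
  have J: "smooth_on ?\<Omega> J"
    unfolding J_def by (intro smooth_on_Pair \<Omega> G G1 G2)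
  define V where "V u = \<phi> u *\<^sub>R turn u Y" for u
  have dG: "frechet_derivative G (at (0, u)) (1, 0) = V u" for u
    using smooth_on_has_vector_derivative[OF G, of "(0, u)" 0 "(1, 0)"] F(4)[of u] 0
    unfolding F_eq V_def by (auto intro: vector_derivative_unique_at)
  \<comment> \<open>The \<open>s\<close>-derivative at 0 is prescribed for \<open>G\<close> alone.
    Commuting it past the derivatives along the torus shows that the jets of the family move with
    velocity \<open>jet V\<close>.\<close>
  have dG1: "frechet_derivative (G1 i) (at (0, u)) (1, 0) = partial i V u" for i u
  proof -
    have "frechet_derivative (G1 i) (at (0, u)) (1, 0) =
        frechet_derivative (\<lambda>z. frechet_derivative G (at z) (1, 0)) (at (0, u)) (0, i)"
      unfolding G1_def using 0 by (intro frechet_derivative_commute[OF G \<Omega>]) auto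
    then show ?thesis
      using partial_slice[OF smooth_on_frechet_derivative[OF G] 0, of "(1, 0)" u i] by (simp add: dG)
  qed
  have dG2: "frechet_derivative (G2 i j) (at (0, u)) (1, 0) = partial i (partial j V) u" for i j u
  proof -
    have "frechet_derivative (G2 i j) (at (0, u)) (1, 0) =
        frechet_derivative (\<lambda>z. frechet_derivative (G1 j) (at z) (1, 0)) (at (0, u)) (0, i)"
      unfolding G2_def using 0 by (intro frechet_derivative_commute[OF G1 \<Omega>]) auto
    then show ?thesis
      using partial_slice[OF smooth_on_frechet_derivative[OF G1] 0, of j "(1, 0)" u i] by (simp add: dG1)
  qed
  have dJ: "frechet_derivative J (at (0, u)) (1, 0) = jet V u" for u
  proof -
    have "(J has_derivative (\<lambda>h. (frechet_derivative G (at (0, u)) h,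
        frechet_derivative (G1 e1) (at (0, u)) h, frechet_derivative (G1 e2) (at (0, u)) h,
        frechet_derivative (G2 e1 e1) (at (0, u)) h, frechet_derivative (G2 e1 e2) (at (0, u)) h,
        frechet_derivative (G2 e2 e1) (at (0, u)) h, frechet_derivative (G2 e2 e2) (at (0, u)) h))) (at (0, u))"
      unfolding J_def using 0
      by (intro has_derivative_Pair smooth_on_has_derivative[of ?\<Omega>] G G1 G2) auto
    from frechet_derivative_at[OF this, symmetric] show ?thesis
      by (simp add: jet_def dG dG1 dG2)
  qed
  have LJ: "smooth_on ?\<Omega> (\<lambda>z. L (J z))"
    using F(5) J_eq by (intro smooth_on_compose[OF L(1) J \<Omega> T(1)]) auto
  define J0 where "J0 = orbit_jet X"
  have J0u: "J (0, u) = turn_jet u J0" for u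
    using J_eq[OF 0] by (simp add: F(3) jet_turn J0_def)
  have turn0: "turn_jet (0, 0) K = K" for K
    by (simp add: turn_jet_def turn_def split: prod.splits)
  have J0: "J0 \<in> T" using F(5)[OF 0, of "(0, 0)"] J_eq[OF 0] J0u turn0 by simp
  have dL: "(L has_derivative frechet_derivative L (at K)) (at K)" if "K \<in> T" for K
    using that by (rule smooth_on_has_derivative[OF L(1)])
  \<comment> \<open>Differentiates \<open>L (turn_jet u K) = L K\<close> at \<open>J0\<close>; the
    linear map \<open>turn_jet u\<close> is its own derivative.\<close>
  have inv: "frechet_derivative L (at (turn_jet u J0)) (turn_jet u K) = frechet_derivative L (at J0) K" for u K
  proof -
    have "((\<lambda>K. L (turn_jet u K)) has_derivative
        (\<lambda>h. frechet_derivative L (at (turn_jet u J0)) (turn_jet u h))) (at J0)"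
      using has_derivative_compose[OF bounded_linear.has_derivative[OF bounded_linear_turn_jet has_derivative_ident] dL]
        T(2)[OF J0] by blast
    then have "(L has_derivative (\<lambda>h. frechet_derivative L (at (turn_jet u J0)) (turn_jet u h))) (at J0)"
      by (rule has_derivative_transform_within_open[OF _ T(1) J0]) (simp add: L(2))
    from frechet_derivative_at[OF this] show ?thesis by metis
  qed
  define DL where "DL = frechet_derivative L (at J0)"
  have lin: "linear DL" unfolding DL_def by (rule has_derivative_linear[OF dL[OF J0]])
  let ?p = "\<lambda>i u. frechet_derivative \<phi> (at u) i"
  let ?q = "\<lambda>i j u. frechet_derivative (\<lambda>u. frechet_derivative \<phi> (at u) j) (at u) i"
  \<comment> \<open>The coefficients of the first and second derivatives of \<open>\<phi>\<close>.
    Being constants, they come out of the integral, where periodicity annihilates their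
    terms.\<close>
  define c1 c2 c11 c12 c21 c22 where
    "c1 = DL (0, Y, 0, 2 *\<^sub>R spin e1 Y, spin e2 Y, spin e2 Y, 0)"
    and "c2 = DL (0, 0, Y, 0, spin e1 Y, spin e1 Y, 2 *\<^sub>R spin e2 Y)"
    and "c11 = DL (0, 0, 0, Y, 0, 0, 0)" and "c12 = DL (0, 0, 0, 0, Y, 0, 0)"
    and "c21 = DL (0, 0, 0, 0, 0, Y, 0)" and "c22 = DL (0, 0, 0, 0, 0, 0, Y)"
  have dLJ: "frechet_derivative (\<lambda>z. L (J z)) (at (0, u)) (1, 0) =
      DL (orbit_jet Y) * \<phi> u + (c1 * ?p e1 u + c2 * ?p e2 u + c11 * ?q e1 e1 u + c12 * ?q e1 e2 u
        + c21 * ?q e2 e1 u + c22 * ?q e2 e2 u)" for u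
  proof -
    have "J (0, u) \<in> T" using F(5)[OF 0] J_eq[OF 0] by simp
    then have "((\<lambda>z. L (J z)) has_derivative
        (\<lambda>h. frechet_derivative L (at (J (0, u))) (frechet_derivative J (at (0, u)) h))) (at (0, u))"
      using 0 by (intro has_derivative_compose[OF smooth_on_has_derivative[OF J] dL]) auto
    from frechet_derivative_at[OF this, symmetric]
    have "frechet_derivative (\<lambda>z. L (J z)) (at (0, u)) (1, 0) =
      frechet_derivative L (at (turn_jet u J0)) (jet V u)" by (simp add: dJ J0u)
    then show ?thesis
      unfolding V_def jet_scaleR_turn[OF \<phi>'] inv DL_def[symmetric] c1_def c2_def c11_def c12_def c21_def c22_def
      by (simp only: linear_add[OF lin] linear_scale[OF lin] real_scaleR_def mult.commute add.assoc)
  qed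
  note t1 = smooth_torus_map_frechet_derivative[OF \<phi>]
  note int = integrable_torus_map[OF \<phi>] integrable_torus_map[OF t1]
    integrable_torus_map[OF smooth_torus_map_frechet_derivative[OF t1]]
  have "integral ?B (\<lambda>u. frechet_derivative (\<lambda>z. L (J z)) (at (0, u)) (1, 0)) = DL (orbit_jet Y) * integral ?B \<phi>"
    unfolding dLJ
    by (simp add: integral_add integrable_add integrable_on_mult_right int
        integral_partial_derivative_periodic[OF \<phi>] integral_partial_derivative_periodic[OF t1])
  then have "((\<lambda>s. integral ?B (\<lambda>u. L (J (s, u)))) has_real_derivative DL (orbit_jet Y) * integral ?B \<phi>) (at 0)"
    using leibniz_rule_smooth[OF LJ F(1), of "(0, 0)" "(2 * pi, 2 * pi)"] by simp
  then have "((\<lambda>s. integral ?B (\<lambda>u. L (jet (F s) u))) has_real_derivative DL (orbit_jet Y) * integral ?B \<phi>) (at 0)"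
    by (rule has_field_derivative_transform_within_open[of _ _ _ ?I]) (simp_all only: J_eq 0 open_greaterThanLessThan)
  then show ?thesis by (simp only: DL_def J0_def)
qed

section \<open>The Willmore Lagrangian\<close>

text \<open>The following functions of a two-jet \<open>(x, x1, x2, x11, x12, x21, x22)\<close> are the geometric quantities
  of a surface with this two-jet.\<close>

definition gram_jet :: "(real \<Rightarrow> real) \<Rightarrow> event \<Rightarrow> event \<Rightarrow> event \<Rightarrow> real" where
  "gram_jet a x x1 x2 = flrw a x x1 x1 * flrw a x x2 x2 - (flrw a x x1 x2)\<^sup>2"

definition tr_jet :: "(real \<Rightarrow> real) \<Rightarrow> event \<Rightarrow> event \<Rightarrow> event \<Rightarrow> event \<Rightarrow> event \<Rightarrow> event \<Rightarrow> event \<Rightarrow> event" where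
  "tr_jet a x x1 x2 T11 T12 T21 T22 = (1 / gram_jet a x x1 x2) *\<^sub>R
     (flrw a x x2 x2 *\<^sub>R T11 - flrw a x x1 x2 *\<^sub>R T12 - flrw a x x2 x1 *\<^sub>R T21 + flrw a x x1 x1 *\<^sub>R T22)"

definition normal_jet :: "(real \<Rightarrow> real) \<Rightarrow> event \<Rightarrow> event \<Rightarrow> event \<Rightarrow> event \<Rightarrow> event" where
  "normal_jet a x x1 x2 X = X - tr_jet a x x1 x2 (flrw a x X x1 *\<^sub>R x1) (flrw a x X x1 *\<^sub>R x2)
     (flrw a x X x2 *\<^sub>R x1) (flrw a x X x2 *\<^sub>R x2)"

definition connection_jet :: "(real \<Rightarrow> real) \<Rightarrow> event \<Rightarrow> event \<Rightarrow> event \<Rightarrow> event \<Rightarrow> event" where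
  "connection_jet a x X Y D = tangent_part x D + (a (fst x) * deriv a (fst x) * (snd X \<bullet> snd Y),
     (deriv a (fst x) / a (fst x)) *\<^sub>R (fst X *\<^sub>R snd Y + fst Y *\<^sub>R snd X))"

definition mean_curvature_jet :: "(real \<Rightarrow> real) \<Rightarrow> jet \<Rightarrow> event" where
  "mean_curvature_jet a = (\<lambda>(x, x1, x2, x11, x12, x21, x22).
     tr_jet a x x1 x2 (- normal_jet a x x1 x2 (connection_jet a x x1 x1 x11)) (- normal_jet a x x1 x2 (connection_jet a x x1 x2 x12))
       (- normal_jet a x x1 x2 (connection_jet a x x2 x1 x21)) (- normal_jet a x x1 x2 (connection_jet a x x2 x2 x22)))"

definition area_lagrangian :: "(real \<Rightarrow> real) \<Rightarrow> jet \<Rightarrow> real" where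
  "area_lagrangian a = (\<lambda>(x, x1, x2, _). sqrt (gram_jet a x x1 x2))"

definition willmore_lagrangian :: "(real \<Rightarrow> real) \<Rightarrow> jet \<Rightarrow> real" where
  "willmore_lagrangian a J = flrw a (fst J) (mean_curvature_jet a J) (mean_curvature_jet a J) * area_lagrangian a J"

text \<open>An open set on which the formulas above are smooth: \<open>snd x \<noteq> 0\<close> for
  the projection, a positive Gram determinant for the inverse metric and the root. The point may
  leave \<open>spacetime\<close>, because Lagrangians are differentiated in the ambient jet
  space.\<close>

definition spacelike_jets :: "(real \<Rightarrow> real) \<Rightarrow> jet set" where
  "spacelike_jets a = {(x, x1, x2, J). snd x \<noteq> 0 \<and> gram_jet a x x1 x2 > 0}"

lemma clifford_eq_turn: "clifford t \<beta> = (\<lambda>u. turn u (t, of_real (cos \<beta>), of_real (sin \<beta>)))"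
  by (auto simp: fun_eq_iff clifford_def turn_def scaleR_conv_of_real mult.commute)

lemma smooth_on_turn:
  assumes "open S" "smooth_on S u" "smooth_on S X"
  shows "smooth_on S (\<lambda>z. turn (u z) (X z))"
proof -
  have "turn u X = (fst X, cos (fst u) *\<^sub>R fst (snd X) + sin (fst u) *\<^sub>R (\<i> * fst (snd X)),
      cos (snd u) *\<^sub>R snd (snd X) + sin (snd u) *\<^sub>R (\<i> * snd (snd X)))" for u X
    by (simp add: turn_def complex_eq_iff)
  then show ?thesis
    by (simp only:) (intro smooth_on_Pair smooth_on_add smooth_on_scaleR smooth_on_sin smooth_on_cos
        smooth_on_fst smooth_on_snd smooth_on_linear_compose[OF bounded_linear_mult_right] assms)
qed

lemma smooth_torus_map_turn: "smooth_torus_map (\<lambda>u. turn u X)"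
  unfolding smooth_torus_map_def
proof
  show "smooth_on UNIV (\<lambda>u. turn u X)"
    by (intro smooth_on_turn smooth_on_const smooth_on_ident open_UNIV)
  show "biperiodic (\<lambda>u. turn u X)"
    by (simp add: biperiodic_def turn_def flip: cis_mult)
qed

lemma smooth_torus_map_const: "smooth_torus_map (\<lambda>u. c)"
  by (simp add: smooth_torus_map_def biperiodic_def smooth_on_const)

lemma spin_orbit:
  "spin e1 (t, z1, z2) = (0, \<i> * z1, 0)" "spin e2 (t, z1, z2) = (0, 0, \<i> * z2)"
  by (simp_all add: spin_def)

lemma frechet_derivative_turn: "frechet_derivative (\<lambda>u. turn u X) (at u) h = turn u (spin h X)"
  using partial_scaleR_turn[OF smooth_on_const[of UNIV "1 :: real"], of X u h] by simp

context
  fixes a :: "real \<Rightarrow> real"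
  assumes a_smooth: "smooth_on UNIV a" and a_pos: "\<And>t. a t > 0"
begin

section \<open>Smoothness of the Lagrangians\<close>

lemma smooth_on_flrw:
  assumes "open S" "smooth_on S x" "smooth_on S X" "smooth_on S Y"
  shows "smooth_on S (\<lambda>z. flrw a (x z) (X z) (Y z))"
  unfolding flrw_def
  by (intro smooth_intros smooth_on_compose[OF a_smooth] assms open_UNIV subset_UNIV)

lemma smooth_on_gram_jet:
  assumes "open S" "smooth_on S x" "smooth_on S x1" "smooth_on S x2"
  shows "smooth_on S (\<lambda>z. gram_jet a (x z) (x1 z) (x2 z))"
  unfolding gram_jet_def by (intro smooth_intros smooth_on_flrw assms)

lemma smooth_on_tr_jet:
  assumes "open S" "smooth_on S x" "smooth_on S x1" "smooth_on S x2"
    "\<And>z. z \<in> S \<Longrightarrow> gram_jet a (x z) (x1 z) (x2 z) \<noteq> 0"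
    "smooth_on S T11" "smooth_on S T12" "smooth_on S T21" "smooth_on S T22"
  shows "smooth_on S (\<lambda>z. tr_jet a (x z) (x1 z) (x2 z) (T11 z) (T12 z) (T21 z) (T22 z))"
  unfolding tr_jet_def by (intro smooth_intros smooth_on_flrw smooth_on_gram_jet assms)

lemma smooth_on_normal_jet:
  assumes "open S" "smooth_on S x" "smooth_on S x1" "smooth_on S x2"
    "\<And>z. z \<in> S \<Longrightarrow> gram_jet a (x z) (x1 z) (x2 z) \<noteq> 0" "smooth_on S X"
  shows "smooth_on S (\<lambda>z. normal_jet a (x z) (x1 z) (x2 z) (X z))"
  unfolding normal_jet_def by (intro smooth_on_diff smooth_on_tr_jet smooth_on_scaleR smooth_on_flrw assms)

lemma smooth_on_connection_jet:
  assumes "open S" "smooth_on S x" "smooth_on S X" "smooth_on S Y" "smooth_on S D"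
    "\<And>z. z \<in> S \<Longrightarrow> snd (x z) \<noteq> 0"
  shows "smooth_on S (\<lambda>z. connection_jet a (x z) (X z) (Y z) (D z))"
proof -
  have "a t \<noteq> 0" for t using a_pos[of t] by simp
  then show ?thesis
    unfolding connection_jet_def tangent_part_def using assms(6)
    by (intro smooth_intros smooth_on_compose[OF a_smooth] assms(1-5) open_UNIV subset_UNIV
        smooth_on_compose[OF smooth_on_real_deriv(2)[OF a_smooth open_UNIV]]) auto
qed

lemma open_spacelike_jets: "open (spacelike_jets a)"
proof -
  have "continuous_on UNIV (\<lambda>J :: jet. gram_jet a (fst J) (fst (snd J)) (fst (snd (snd J))))"
    by (intro smooth_on_imp_continuous_on smooth_on_gram_jet smooth_on_fst smooth_on_snd smooth_on_ident open_UNIV)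
  then have "open {J :: jet. gram_jet a (fst J) (fst (snd J)) (fst (snd (snd J))) > 0}"
    by (intro open_Collect_less continuous_on_const)
  moreover have "open {J :: jet. snd (fst J) \<noteq> 0}"
    by (intro open_Collect_neq continuous_intros)
  moreover have "spacelike_jets a = {J. gram_jet a (fst J) (fst (snd J)) (fst (snd (snd J))) > 0} \<inter> {J. snd (fst J) \<noteq> 0}"
    by (auto simp: spacelike_jets_def)
  ultimately show ?thesis by (simp only: open_Int)
qed

lemma smooth_on_area_lagrangian: "smooth_on (spacelike_jets a) (area_lagrangian a)"
  unfolding area_lagrangian_def case_prod_beta
  by (intro smooth_on_sqrt smooth_on_gram_jet smooth_on_fst smooth_on_snd smooth_on_ident open_spacelike_jets)
    (auto simp: spacelike_jets_def)

lemma smooth_on_willmore_lagrangian: "smooth_on (spacelike_jets a) (willmore_lagrangian a)"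
proof -
  have "smooth_on (spacelike_jets a) (mean_curvature_jet a)"
    unfolding mean_curvature_jet_def case_prod_beta
    by (intro smooth_on_tr_jet smooth_on_minus smooth_on_normal_jet smooth_on_connection_jet
        smooth_on_fst smooth_on_snd smooth_on_ident open_spacelike_jets)
      (auto simp: spacelike_jets_def)
  then show ?thesis
    unfolding willmore_lagrangian_def[abs_def]
    by (intro smooth_on_mult smooth_on_flrw smooth_on_area_lagrangian open_spacelike_jets smooth_on_fst smooth_on_ident)
qed

section \<open>Invariance of the Lagrangians under rotations\<close>

lemma flrw_turn: "flrw a (turn u x) (turn u X) (turn u Y) = flrw a x X Y"
  by (simp add: flrw_def inner_turn)

lemma gram_jet_turn: "gram_jet a (turn u x) (turn u x1) (turn u x2) = gram_jet a x x1 x2"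
  by (simp add: gram_jet_def flrw_turn)

lemma tr_jet_turn: "tr_jet a (turn u x) (turn u x1) (turn u x2) (turn u T11) (turn u T12) (turn u T21) (turn u T22) =
    turn u (tr_jet a x x1 x2 T11 T12 T21 T22)"
  by (simp add: tr_jet_def flrw_turn gram_jet_turn turn_simps)

lemma normal_jet_turn: "normal_jet a (turn u x) (turn u x1) (turn u x2) (turn u X) = turn u (normal_jet a x x1 x2 X)"
  by (simp add: normal_jet_def flrw_turn tr_jet_turn turn_simps flip: turn_simps(4))

lemma snd_turn_add:
  "snd (turn u X) + snd (turn u Y) = snd (turn u (X + Y))"
  "snd (turn u X) - snd (turn u Y) = snd (turn u (X - Y))"
  "r *\<^sub>R snd (turn u X) = snd (turn u (r *\<^sub>R X))"
  by (simp_all add: turn_simps)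

lemma tangent_part_turn: "tangent_part (turn u x) (turn u D) = turn u (tangent_part x D)"
  unfolding tangent_part_def inner_turn snd_turn_add by (simp add: turn_def prod_eq_iff algebra_simps)

lemma connection_jet_turn: "connection_jet a (turn u x) (turn u X) (turn u Y) (turn u D) = turn u (connection_jet a x X Y D)"
  unfolding connection_jet_def tangent_part_turn inner_turn fst_turn snd_turn_add
  by (simp add: turn_def prod_eq_iff algebra_simps)

lemma mean_curvature_jet_turn: "mean_curvature_jet a (turn_jet u J) = turn u (mean_curvature_jet a J)"
proof -
  obtain x x1 x2 x11 x12 x21 x22 where J: "J = (x, x1, x2, x11, x12, x21, x22)"
    by (rule prod_cases7)
  show ?thesis
    by (simp add: J mean_curvature_jet_def turn_jet_def connection_jet_turn normal_jet_turn tr_jet_turn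
        flip: turn_simps(3))
qed

lemma area_lagrangian_turn: "area_lagrangian a (turn_jet u J) = area_lagrangian a J"
  by (simp add: area_lagrangian_def turn_jet_def gram_jet_turn split: prod.splits)

lemma willmore_lagrangian_turn: "willmore_lagrangian a (turn_jet u J) = willmore_lagrangian a J"
proof -
  have "fst (turn_jet u J) = turn u (fst J)" by (simp add: turn_jet_def split: prod.splits)
  then show ?thesis
    by (simp add: willmore_lagrangian_def mean_curvature_jet_turn flrw_turn area_lagrangian_turn)
qed

lemma turn_jet_spacelike: "J \<in> spacelike_jets a \<Longrightarrow> turn_jet u J \<in> spacelike_jets a"
proof -
  have "snd (turn u X) = 0 \<longleftrightarrow> snd X = 0" for X
    using inner_turn[of u X X] by (metis inner_eq_zero_iff)
  then show "J \<in> spacelike_jets a \<Longrightarrow> turn_jet u J \<in> spacelike_jets a"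
    by (auto simp: spacelike_jets_def turn_jet_def gram_jet_turn case_prod_beta)
qed

section \<open>The Lagrangians along a spacelike torus\<close>

lemma partial_in_tangent_space:
  assumes "range f \<subseteq> spacetime" "smooth_on UNIV f"
  shows "partial i f u \<in> tangent_space (f u)"
proof -
  have "norm (snd (f u)) = 1" for u using assms(1) by (auto simp: spacetime_def)
  then have c: "(\<lambda>u. snd (f u) \<bullet> snd (f u)) = (\<lambda>u. 1)" by (simp add: norm_eq_1)
  have "((\<lambda>u. snd (f u) \<bullet> snd (f u)) has_derivative
      (\<lambda>h. snd (f u) \<bullet> snd (frechet_derivative f (at u) h) + snd (frechet_derivative f (at u) h) \<bullet> snd (f u))) (at u)"
    using smooth_on_has_derivative[OF assms(2)]
    by (intro has_derivative_inner has_derivative_snd) auto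
  from fun_cong[OF frechet_derivative_at[OF this[unfolded c]], of i] show ?thesis
    by (simp add: tangent_space_def inner_commute)
qed

text \<open>The bridge from the geometric definitions to the jet formulas: the coordinate fields of
  a torus in \<open>spacetime\<close> are tangential, so \<open>levi_civita\<close> takes its closed
  form and the definite description in \<open>sharp\<close> disappears.\<close>

lemma jet_geometry:
  assumes "spacelike_torus a f"
  shows "gram a f u = gram_jet a (f u) (partial e1 f u) (partial e2 f u)"
    and "mean_curvature_vector a f u = mean_curvature_jet a (jet f u)"
    and "jet f u \<in> spacelike_jets a"
proof -
  have f: "smooth_on UNIV f" "range f \<subseteq> spacetime"
    and pos: "v \<noteq> 0 \<Longrightarrow> flrw a (f u) (frechet_derivative f (at u) v) (frechet_derivative f (at u) v) > 0" for u v
    using assms unfolding spacelike_torus_def smooth_torus_map_def by blast+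
  have "norm (snd (f u)) = 1" for u using f(2) by (auto simp: spacetime_def)
  then have nz: "snd (f u) \<noteq> 0" for u by (metis norm_zero zero_neq_one)
  show g: "gram a f u = gram_jet a (f u) (partial e1 f u) (partial e2 f u)"
    by (simp add: gram_def gram_jet_def induced_metric_def)
  have "nabla_along a f i (partial j f) u =
      connection_jet a (f u) (partial i f u) (partial j f u) (partial i (partial j f) u)" for i j
    unfolding nabla_along_def connection_jet_def
    by (rule levi_civita_flrw[OF a_smooth a_pos nz partial_in_tangent_space[OF f(2,1)] partial_in_tangent_space[OF f(2,1)]])
  then show "mean_curvature_vector a f u = mean_curvature_jet a (jet f u)"
    unfolding mean_curvature_vector_def chi_def mean_curvature_jet_def jet_def normal_part_def tr_h_def
      normal_jet_def tr_jet_def g induced_metric_def by simp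
  define A B C where "A = flrw a (f u) (partial e1 f u) (partial e1 f u)"
    and "B = flrw a (f u) (partial e1 f u) (partial e2 f u)" and "C = flrw a (f u) (partial e2 f u) (partial e2 f u)"
  have lin: "linear (frechet_derivative f (at u))"
    by (rule has_derivative_linear[OF smooth_on_has_derivative[OF f(1) UNIV_I]])
  have A: "A > 0" using pos[of e1 u] by (simp add: A_def zero_prod_def)
  \<comment> \<open>The Gram-Schmidt vector orthogonal to the first tangent. Its squared length is
    \<open>A\<close> times the Gram determinant, which is therefore positive.\<close>
  have "frechet_derivative f (at u) (- B, A) = (- B) *\<^sub>R partial e1 f u + A *\<^sub>R partial e2 f u"
    using linear_add[OF lin, of "(- B) *\<^sub>R e1" "A *\<^sub>R e2"] by (simp add: linear_scale[OF lin, symmetric])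
  then have "flrw a (f u) ((- B) *\<^sub>R partial e1 f u + A *\<^sub>R partial e2 f u) ((- B) *\<^sub>R partial e1 f u + A *\<^sub>R partial e2 f u) > 0"
    using pos[of "(- B, A)" u] A by (simp add: zero_prod_def)
  also have "flrw a (f u) ((- B) *\<^sub>R partial e1 f u + A *\<^sub>R partial e2 f u) ((- B) *\<^sub>R partial e1 f u + A *\<^sub>R partial e2 f u)
      = B\<^sup>2 * A - 2 * A * B * B + A\<^sup>2 * C"
    unfolding A_def B_def C_def
    by (simp add: flrw_def inner_add_left inner_add_right inner_diff_left inner_diff_right inner_commute
        algebra_simps power2_eq_square)
  also have "\<dots> = A * (A * C - B\<^sup>2)" by (simp add: algebra_simps power2_eq_square)
  finally have "A * C - B\<^sup>2 > 0" using A by (simp add: zero_less_mult_iff)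
  then show "jet f u \<in> spacelike_jets a"
    using nz by (simp add: spacelike_jets_def jet_def gram_jet_def A_def B_def C_def)
qed

lemma area_eq: "spacelike_torus a f \<Longrightarrow> area a f = integral (cbox (0, 0) (2 * pi, 2 * pi)) (\<lambda>u. area_lagrangian a (jet f u))"
  unfolding area_def surface_integral_def by (simp add: jet_geometry(1) area_lagrangian_def jet_def)

lemma willmore_eq:
  "spacelike_torus a f \<Longrightarrow> willmore a f = integral (cbox (0, 0) (2 * pi, 2 * pi)) (\<lambda>u. willmore_lagrangian a (jet f u))"
  unfolding willmore_def surface_integral_def willmore_lagrangian_def area_lagrangian_def jet_geometry(2)
  by (simp add: jet_geometry(1) jet_def)

section \<open>Values of the Lagrangians on Clifford tori\<close>

lemma gram_jet_orbit:
  "gram_jet a (t, of_real c, of_real s) (0, \<i> * of_real c, 0) (0, 0, \<i> * of_real s) = ((a t)\<^sup>2 * (c * s))\<^sup>2"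
  by (simp add: gram_jet_def flrw_def inner_prod_def inner_complex_def power2_eq_square)

lemma area_lagrangian_orbit:
  assumes "0 < c" "0 < s"
  shows "area_lagrangian a (orbit_jet (t, of_real c, of_real s)) = (a t)\<^sup>2 * (c * s)"
  using assms a_pos[of t] by (simp add: area_lagrangian_def orbit_jet_def spin_orbit gram_jet_orbit)

text \<open>The mixed derivatives vanish because the two circles turn in different coordinates. The
  pure ones have real entries, which makes them normal to the torus.\<close>

lemma connection_jet_orbit:
  fixes c s t :: real
  assumes "c\<^sup>2 + s\<^sup>2 = 1"
  defines "x \<equiv> (t, of_real c, of_real s) :: event"
  shows "connection_jet a x (spin e1 x) (spin e1 x) (spin e1 (spin e1 x)) =
      (a t * deriv a t * c\<^sup>2, of_real (- c * s\<^sup>2), of_real (c\<^sup>2 * s))"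
    and "connection_jet a x (spin e2 x) (spin e2 x) (spin e2 (spin e2 x)) =
      (a t * deriv a t * s\<^sup>2, of_real (c * s\<^sup>2), of_real (- c\<^sup>2 * s))"
    and "connection_jet a x (spin e1 x) (spin e2 x) (spin e1 (spin e2 x)) = 0"
    and "connection_jet a x (spin e2 x) (spin e1 x) (spin e2 (spin e1 x)) = 0"
proof -
  have 1: "c * c + s * s = 1" and s2: "s\<^sup>2 = 1 - c\<^sup>2" and c2: "c\<^sup>2 = 1 - s\<^sup>2"
    using assms(1) by (simp_all add: power2_eq_square)
  have n: "snd x \<bullet> snd x = 1" by (simp add: x_def inner_prod_def inner_complex_def 1)
  show "connection_jet a x (spin e1 x) (spin e1 x) (spin e1 (spin e1 x)) =
      (a t * deriv a t * c\<^sup>2, of_real (- c * s\<^sup>2), of_real (c\<^sup>2 * s))"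
    unfolding connection_jet_def tangent_part_def n s2
    by (simp add: x_def spin_orbit inner_prod_def inner_complex_def complex_eq_iff power2_eq_square algebra_simps)
  show "connection_jet a x (spin e2 x) (spin e2 x) (spin e2 (spin e2 x)) =
      (a t * deriv a t * s\<^sup>2, of_real (c * s\<^sup>2), of_real (- c\<^sup>2 * s))"
    unfolding connection_jet_def tangent_part_def n c2
    by (simp add: x_def spin_orbit inner_prod_def inner_complex_def complex_eq_iff power2_eq_square algebra_simps)
  show "connection_jet a x (spin e1 x) (spin e2 x) (spin e1 (spin e2 x)) = 0"
    "connection_jet a x (spin e2 x) (spin e1 x) (spin e2 (spin e1 x)) = 0"
    unfolding connection_jet_def tangent_part_def n
    by (simp_all add: x_def spin_orbit inner_prod_def inner_complex_def complex_eq_iff zero_prod_def)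
qed

lemma mean_curvature_jet_orbit:
  assumes "0 < c" "0 < s" "c\<^sup>2 + s\<^sup>2 = 1"
  shows "mean_curvature_jet a (orbit_jet (t, of_real c, of_real s)) =
    (- 2 * deriv a t / a t, of_real ((s\<^sup>2 - c\<^sup>2) / ((a t)\<^sup>2 * c)), of_real (- (s\<^sup>2 - c\<^sup>2) / ((a t)\<^sup>2 * s)))"
proof -
  let ?x = "(t, of_real c, of_real s) :: event"
  \<comment> \<open>At this point the tangents are \<open>\<i>\<close> times real space vectors, so
    a vector with real entries is its own normal part.\<close>
  have N: "normal_jet a ?x (spin e1 ?x) (spin e2 ?x) (\<tau>, of_real v, of_real w) = (\<tau>, of_real v, of_real w)" for \<tau> v w
    by (simp add: normal_jet_def tr_jet_def flrw_def spin_orbit inner_prod_def inner_complex_def)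
  have N0: "normal_jet a ?x (spin e1 ?x) (spin e2 ?x) 0 = 0"
    by (simp add: normal_jet_def tr_jet_def flrw_def)
  show ?thesis
    using assms(1,2) a_pos[of t]
    unfolding orbit_jet_def mean_curvature_jet_def case_prod_conv connection_jet_orbit[OF assms(3)] N N0 tr_jet_def
    by (simp add: spin_orbit gram_jet_orbit flrw_def inner_prod_def inner_complex_def complex_eq_iff
        field_simps power2_eq_square)
qed

text \<open>The powers of \<open>a t\<close> in the space part cancel against the area density, by
  scale invariance of the classical Willmore integrand; the time part retains only the expansion
  rate.\<close>

lemma willmore_lagrangian_orbit:
  assumes "0 < c" "0 < s" "c\<^sup>2 + s\<^sup>2 = 1"
  shows "willmore_lagrangian a (orbit_jet (t, of_real c, of_real s)) =
    (s\<^sup>2 - c\<^sup>2)\<^sup>2 / (c * s) - 4 * (deriv a t)\<^sup>2 * (c * s)"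
proof -
  define D A where "D = s\<^sup>2 - c\<^sup>2" and "A = a t"
  have A: "A > 0" using a_pos by (simp add: A_def)
  let ?H = "(- 2 * deriv a t / A, of_real (D / (A\<^sup>2 * c)), of_real (- D / (A\<^sup>2 * s))) :: event"
  have "flrw a (fst (orbit_jet (t, of_real c, of_real s))) ?H ?H =
      - 4 * (deriv a t)\<^sup>2 / A\<^sup>2 + D\<^sup>2 / A\<^sup>2 * (1 / c\<^sup>2 + 1 / s\<^sup>2)"
    using A assms(1,2)
    by (simp add: orbit_jet_def A_def[symmetric] flrw_def inner_prod_def inner_complex_def field_simps power2_eq_square)
  also have "1 / c\<^sup>2 + 1 / s\<^sup>2 = 1 / (c * s)\<^sup>2"
    using assms by (simp add: field_simps)
  finally have *: "flrw a (fst (orbit_jet (t, of_real c, of_real s))) ?H ?H =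
      - 4 * (deriv a t)\<^sup>2 / A\<^sup>2 + D\<^sup>2 / A\<^sup>2 * (1 / (c * s)\<^sup>2)" .
  show ?thesis
    unfolding willmore_lagrangian_def mean_curvature_jet_orbit[OF assms] area_lagrangian_orbit[OF assms(1,2)]
      D_def[symmetric] A_def[symmetric] *
    using assms(1,2) A by (simp add: field_simps power2_eq_square)
qed

lemma spacelike_torus_clifford:
  assumes "0 < cos \<beta>" "0 < sin \<beta>"
  shows "spacelike_torus a (clifford t \<beta>)"
proof -
  have "range (clifford t \<beta>) \<subseteq> spacetime"
    by (auto simp: clifford_def spacetime_def norm_prod_def norm_mult)
  moreover have "flrw a (clifford t \<beta> u) (frechet_derivative (clifford t \<beta>) (at u) v)
      (frechet_derivative (clifford t \<beta>) (at u) v) > 0" if "v \<noteq> 0" for u v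
  proof -
    have "flrw a (clifford t \<beta> u) (frechet_derivative (clifford t \<beta>) (at u) v)
      (frechet_derivative (clifford t \<beta>) (at u) v) = (a t)\<^sup>2 * ((cos \<beta> * fst v)\<^sup>2 + (sin \<beta> * snd v)\<^sup>2)"
      unfolding clifford_eq_turn frechet_derivative_turn flrw_turn
      by (simp add: spin_def flrw_def inner_prod_def inner_complex_def power2_eq_square)
    moreover have "fst v \<noteq> 0 \<or> snd v \<noteq> 0" using that by (auto simp: prod_eq_iff)
    then have "(cos \<beta> * fst v)\<^sup>2 + (sin \<beta> * snd v)\<^sup>2 > 0"
      using assms by (auto simp: add_pos_nonneg add_nonneg_pos)
    ultimately show ?thesis using a_pos[of t] by simp
  qed
  ultimately show ?thesis
    using smooth_torus_map_turn unfolding spacelike_torus_def clifford_eq_turn by blast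
qed

section \<open>First variation at a fixed Clifford torus\<close>

context
  fixes t0 \<alpha> :: real
  assumes \<alpha>: "0 < \<alpha>" "\<alpha> < pi / 2"
begin

lemma cos_sin_pos: "0 < cos \<alpha>" "0 < sin \<alpha>"
  using \<alpha> by (auto intro: cos_gt_zero_pi sin_gt_zero)

abbreviation (input) torus_H :: real where "torus_H \<equiv> (tan \<alpha> - cot \<alpha>) / a t0"

abbreviation (input) torus_P :: real where "torus_P \<equiv> 2 * deriv a t0 / a t0"

abbreviation (input) torus_normal :: "real \<Rightarrow> real \<Rightarrow> real \<times> real \<Rightarrow> event" where
  "torus_normal p q \<equiv> \<lambda>u. p *\<^sub>R time_normal u + q *\<^sub>R clifford_normal a t0 \<alpha> u"

abbreviation (input) torus_density :: real where
  "torus_density \<equiv> (a t0)\<^sup>2 * (cos \<alpha> * sin \<alpha>)"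

text \<open>The derivative of the Willmore density along Clifford tori with velocity
  \<open>p n + q \<nu>\<close>, divided by the area density. The summands
  \<open>8 / (a t0)^2\<close>, \<open>H^2\<close> and \<open>P^2\<close> come from differentiating,
  in this order, the numerator and the denominator of the space part and the factor
  \<open>cos \<alpha> sin \<alpha>\<close> of the time part.\<close>

abbreviation (input) torus_gradient :: "real \<Rightarrow> real \<Rightarrow> real" where
  "torus_gradient p q \<equiv> - 8 * deriv a t0 * deriv (deriv a) t0 / (a t0)\<^sup>2 * p
     - (8 / (a t0)\<^sup>2 + torus_H\<^sup>2 + torus_P\<^sup>2) * torus_H * q"

abbreviation (input) torus_point :: event where
  "torus_point \<equiv> (t0, of_real (cos \<alpha>), of_real (sin \<alpha>))"

text \<open>The value of \<open>torus_normal p q\<close> at parameter \<open>(0, 0)\<close>, from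
  which \<open>turn\<close> generates the whole field.\<close>

abbreviation (input) torus_velocity :: "real \<Rightarrow> real \<Rightarrow> event" where
  "torus_velocity p q \<equiv> (p, of_real (q * sin \<alpha> / a t0), of_real (- q * cos \<alpha> / a t0))"

lemma torus_normal_turn: "torus_normal p q u = turn u (torus_velocity p q)"
  by (simp add: time_normal_def clifford_normal_def turn_def scaleR_conv_of_real case_prod_beta)

lemma torus_H_eq: "torus_H = ((sin \<alpha>)\<^sup>2 - (cos \<alpha>)\<^sup>2) / (cos \<alpha> * sin \<alpha> * a t0)"
  using cos_sin_pos a_pos[of t0] by (simp add: tan_def cot_def field_simps power2_eq_square)

lemma orbit_jet_torus_point: "orbit_jet torus_point \<in> spacelike_jets a"
  using jet_geometry(3)[OF spacelike_torus_clifford[OF cos_sin_pos, of t0], of "(0, 0)"]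
  unfolding clifford_eq_turn jet_turn
  by (simp add: turn_jet_def turn_def case_prod_beta)

text \<open>The coefficient in the first variation is read off from the family of tori with parameters
  \<open>(t0 + p s, \<alpha> - q s / a t0)\<close>, whose velocity is \<open>p n + q \<nu>\<close>.\<close>

lemma frechet_derivative_orbit_jet:
  assumes L: "smooth_on (spacelike_jets a) L"
    and g: "\<And>t c s. 0 < c \<Longrightarrow> 0 < s \<Longrightarrow> c\<^sup>2 + s\<^sup>2 = 1 \<Longrightarrow> L (orbit_jet (t, of_real c, of_real s)) = g t c s"
    and d: "((\<lambda>s. g (t0 + p * s) (cos (\<alpha> - q * s / a t0)) (sin (\<alpha> - q * s / a t0))) has_real_derivative d) (at 0)"
  shows "frechet_derivative L (at (orbit_jet torus_point)) (orbit_jet (torus_velocity p q)) = d"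
proof -
  define \<gamma> :: "real \<Rightarrow> event" where
    "\<gamma> s = (t0 + p * s, of_real (cos (\<alpha> - q * s / a t0)), of_real (sin (\<alpha> - q * s / a t0)))" for s
  have a0: "a t0 \<noteq> 0" using a_pos[of t0] by simp
  have "(\<gamma> has_derivative (\<lambda>h. (p * h, of_real (h * (q * sin \<alpha> / a t0)), of_real (h * (- q * cos \<alpha> / a t0))))) (at 0)"
    unfolding \<gamma>_def[abs_def] using a0
    by (auto intro!: derivative_eq_intros simp: fun_eq_iff)
  then have "(\<gamma> has_derivative (\<lambda>h. h *\<^sub>R torus_velocity p q)) (at 0)"
    by (simp add: scaleR_conv_of_real mult.commute)
  from bounded_linear.has_derivative[OF bounded_linear_orbit_jet this]
  have c: "((\<lambda>s. orbit_jet (\<gamma> s)) has_derivative (\<lambda>h. h *\<^sub>R orbit_jet (torus_velocity p q))) (at 0)"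
    by (simp only: linear_scale[OF bounded_linear.linear[OF bounded_linear_orbit_jet]])
  have \<gamma>0: "\<gamma> 0 = torus_point" by (simp add: \<gamma>_def)
  have "(L has_derivative frechet_derivative L (at (orbit_jet torus_point))) (at (orbit_jet (\<gamma> 0)))"
    unfolding \<gamma>0 by (rule smooth_on_has_derivative[OF L orbit_jet_torus_point])
  from has_derivative_compose[OF c this]
  have D: "((\<lambda>s. L (orbit_jet (\<gamma> s))) has_real_derivative
      frechet_derivative L (at (orbit_jet torus_point)) (orbit_jet (torus_velocity p q))) (at 0)"
    unfolding linear_scale[OF has_derivative_linear[OF smooth_on_has_derivative[OF L orbit_jet_torus_point]]]
      has_real_derivative_iff_has_vector_derivative has_vector_derivative_def .
  \<comment> \<open>The closed form \<open>g\<close> is given for positive cosine and sine only;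
    continuity grants this for small \<open>s\<close>, which suffices for the derivative at
    0.\<close>
  have pos: "\<forall>\<^sub>F s in nhds 0. 0 < f s" if "isCont f 0" "0 < f 0" for f :: "real \<Rightarrow> real"
    using that unfolding isCont_def tendsto_at_iff_tendsto_nhds by (rule order_tendstoD(1))
  have "isCont (\<lambda>s. cos (\<alpha> - q * s / a t0)) 0" "isCont (\<lambda>s. sin (\<alpha> - q * s / a t0)) 0"
    using a0 by (auto intro!: continuous_intros)
  then have "\<forall>\<^sub>F s in nhds 0. 0 < cos (\<alpha> - q * s / a t0) \<and> 0 < sin (\<alpha> - q * s / a t0)"
    using cos_sin_pos by (intro eventually_conj pos) auto
  then have "\<forall>\<^sub>F s in nhds 0. L (orbit_jet (\<gamma> s)) = g (t0 + p * s) (cos (\<alpha> - q * s / a t0)) (sin (\<alpha> - q * s / a t0))"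
    by eventually_elim (simp add: \<gamma>_def g)
  from DERIV_cong_ev[OF refl this refl, THEN iffD1, OF D] show ?thesis
    using d by (rule DERIV_unique)
qed

text \<open>The first factor is the product of \<open>p n + q \<nu>\<close> with the mean curvature
  vector, in agreement with the general first variation of area.\<close>

lemma area_coefficient:
  "frechet_derivative (area_lagrangian a) (at (orbit_jet torus_point)) (orbit_jet (torus_velocity p q)) =
     (torus_P * p + torus_H * q) * torus_density"
proof (rule frechet_derivative_orbit_jet[OF smooth_on_area_lagrangian])
  show "area_lagrangian a (orbit_jet (t, of_real c, of_real s)) = (a t)\<^sup>2 * (c * s)" if "0 < c" "0 < s" for t c s
    by (rule area_lagrangian_orbit[OF that])
  have a0: "a t0 > 0" by (rule a_pos)
  have l: "((\<lambda>s. t0 + p * s) has_real_derivative p) (at 0)"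
    by (auto intro!: derivative_eq_intros)
  have A: "((\<lambda>s. a (t0 + p * s)) has_real_derivative deriv a t0 * p) (at 0)"
    using DERIV_chain2[OF _ l, of a "deriv a t0"] a_deriv[OF a_smooth a_pos] by simp
  show "((\<lambda>s. (a (t0 + p * s))\<^sup>2 * (cos (\<alpha> - q * s / a t0) * sin (\<alpha> - q * s / a t0))) has_real_derivative
      (torus_P * p + torus_H * q) * torus_density) (at 0)"
    unfolding torus_H_eq
    by (rule A derivative_eq_intros refl | use a0 cos_sin_pos in \<open>simp; fail\<close>)+
      (use a0 cos_sin_pos in \<open>simp add: field_simps power2_eq_square\<close>)
qed

lemma willmore_coefficient:
  "frechet_derivative (willmore_lagrangian a) (at (orbit_jet torus_point)) (orbit_jet (torus_velocity p q)) =
     torus_gradient p q * torus_density"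
proof (rule frechet_derivative_orbit_jet[OF smooth_on_willmore_lagrangian])
  show "willmore_lagrangian a (orbit_jet (t, of_real c, of_real s)) = (s\<^sup>2 - c\<^sup>2)\<^sup>2 / (c * s) - 4 * (deriv a t)\<^sup>2 * (c * s)"
    if "0 < c" "0 < s" "c\<^sup>2 + s\<^sup>2 = 1" for t c s
    by (rule willmore_lagrangian_orbit[OF that])
  have a0: "a t0 > 0" by (rule a_pos)
  have l: "((\<lambda>s. t0 + p * s) has_real_derivative p) (at 0)"
    by (auto intro!: derivative_eq_intros)
  have A: "((\<lambda>s. deriv a (t0 + p * s)) has_real_derivative deriv (deriv a) t0 * p) (at 0)"
    using DERIV_chain2[OF _ l, of "deriv a" "deriv (deriv a) t0"] a_deriv2[OF a_smooth a_pos] by simp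
  define D where "D = (sin \<alpha>)\<^sup>2 - (cos \<alpha>)\<^sup>2"
  define m where "m = cos \<alpha> * sin \<alpha>"
  have m: "m > 0" using cos_sin_pos by (simp add: m_def)
  let ?\<delta> = "\<lambda>s. \<alpha> - q * s / a t0"
  have \<delta>: "(?\<delta> has_real_derivative - q / a t0) (at 0)"
    using a0 by (auto intro!: derivative_eq_intros)
  \<comment> \<open>In the angle, \<open>D\<close> changes at rate \<open>4 m\<close> and
    \<open>m\<close> at rate \<open>- D\<close>, so the derivative stays rational in
    \<open>D\<close> and \<open>m\<close>.\<close>
  have dD: "((\<lambda>s. (sin (?\<delta> s))\<^sup>2 - (cos (?\<delta> s))\<^sup>2) has_real_derivative 4 * m * (- q / a t0)) (at 0)"
    by (rule \<delta> derivative_eq_intros refl | simp)+ (simp add: m_def)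
  have dm: "((\<lambda>s. cos (?\<delta> s) * sin (?\<delta> s)) has_real_derivative - D * (- q / a t0)) (at 0)"
    by (rule \<delta> derivative_eq_intros refl | simp)+ (simp add: D_def power2_eq_square algebra_simps diff_divide_distrib)
  have H: "torus_H = D / (m * a t0)" by (simp add: torus_H_eq D_def m_def)
  have "((\<lambda>s. ((sin (?\<delta> s))\<^sup>2 - (cos (?\<delta> s))\<^sup>2)\<^sup>2 / (cos (?\<delta> s) * sin (?\<delta> s))
       - 4 * (deriv a (t0 + p * s))\<^sup>2 * (cos (?\<delta> s) * sin (?\<delta> s))) has_real_derivative
     ((2 * D * (4 * m * (- q / a t0))) * m - D\<^sup>2 * (- D * (- q / a t0))) / (m * m)
      - (8 * deriv a t0 * (deriv (deriv a) t0 * p) * m + 4 * (deriv a t0)\<^sup>2 * (- D * (- q / a t0)))) (at 0)"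
    by (rule dD dm A derivative_eq_intros refl | use cos_sin_pos in \<open>simp; fail\<close>)+
      (simp add: D_def[symmetric] m_def[symmetric] mult_ac)
  moreover have "((2 * D * (4 * m * (- q / a t0))) * m - D\<^sup>2 * (- D * (- q / a t0))) / (m * m)
      - (8 * deriv a t0 * (deriv (deriv a) t0 * p) * m + 4 * (deriv a t0)\<^sup>2 * (- D * (- q / a t0)))
    = torus_gradient p q * torus_density"
    unfolding H m_def[symmetric] using a0 m
    by (simp add: field_simps power2_eq_square)
  ultimately show "((\<lambda>s. ((sin (?\<delta> s))\<^sup>2 - (cos (?\<delta> s))\<^sup>2)\<^sup>2 / (cos (?\<delta> s) * sin (?\<delta> s))
       - 4 * (deriv a (t0 + p * s))\<^sup>2 * (cos (?\<delta> s) * sin (?\<delta> s))) has_real_derivative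
     torus_gradient p q * torus_density) (at 0)"
    by (simp only:)
qed

lemma first_variation_clifford:
  assumes V: "variation a (clifford t0 \<alpha>) (\<lambda>u. \<phi> u *\<^sub>R torus_normal p q u) \<epsilon> F" and \<phi>: "smooth_torus_map \<phi>"
  shows "((\<lambda>s. area a (F s)) has_real_derivative
      (torus_P * p + torus_H * q) * torus_density * integral (cbox (0, 0) (2 * pi, 2 * pi)) \<phi>) (at 0)"
    and "((\<lambda>s. willmore a (F s)) has_real_derivative
      torus_gradient p q * torus_density * integral (cbox (0, 0) (2 * pi, 2 * pi)) \<phi>) (at 0)"
proof -
  have F: "\<epsilon> > 0" "smooth_on ({-\<epsilon><..<\<epsilon>} \<times> UNIV) (\<lambda>(s, u). F s u)" "F 0 = (\<lambda>u. turn u torus_point)"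
    "\<And>u. ((\<lambda>s. F s u) has_vector_derivative \<phi> u *\<^sub>R turn u (torus_velocity p q)) (at 0)"
    and S: "\<And>s. s \<in> {-\<epsilon><..<\<epsilon>} \<Longrightarrow> spacelike_torus a (F s)"
    using V unfolding variation_def torus_normal_turn clifford_eq_turn by blast+
  have J: "\<And>s u. s \<in> {-\<epsilon><..<\<epsilon>} \<Longrightarrow> jet (F s) u \<in> spacelike_jets a"
    using jet_geometry(3)[OF S] .
  have 0: "0 \<in> {-\<epsilon><..<\<epsilon>}" using F(1) by simp
  have fv: "((\<lambda>s. integral (cbox (0, 0) (2 * pi, 2 * pi)) (\<lambda>u. L (jet (F s) u))) has_real_derivative
      frechet_derivative L (at (orbit_jet torus_point)) (orbit_jet (torus_velocity p q)) *
      integral (cbox (0, 0) (2 * pi, 2 * pi)) \<phi>) (at 0)"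
    if "smooth_on (spacelike_jets a) L" "\<And>u J. L (turn_jet u J) = L J" for L
    by (rule first_variation_orbit[OF open_spacelike_jets _ that(1) _ F _ \<phi>])
      (use turn_jet_spacelike that(2) J in blast)+
  show "((\<lambda>s. area a (F s)) has_real_derivative
      (torus_P * p + torus_H * q) * torus_density * integral (cbox (0, 0) (2 * pi, 2 * pi)) \<phi>) (at 0)"
    using fv[OF smooth_on_area_lagrangian area_lagrangian_turn] unfolding area_coefficient
    by (rule has_field_derivative_transform_within_open[OF _ open_greaterThanLessThan 0]) (simp add: area_eq S)
  show "((\<lambda>s. willmore a (F s)) has_real_derivative
      torus_gradient p q * torus_density * integral (cbox (0, 0) (2 * pi, 2 * pi)) \<phi>) (at 0)"
    using fv[OF smooth_on_willmore_lagrangian willmore_lagrangian_turn] unfolding willmore_coefficient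
    by (rule has_field_derivative_transform_within_open[OF _ open_greaterThanLessThan 0]) (simp add: willmore_eq S)
qed

lemma gram_clifford: "sqrt (gram a (clifford t0 \<alpha>) u) = torus_density"
proof -
  have "gram a (clifford t0 \<alpha>) u = gram_jet a torus_point (spin e1 torus_point) (spin e2 torus_point)"
    unfolding jet_geometry(1)[OF spacelike_torus_clifford[OF cos_sin_pos]]
    unfolding clifford_eq_turn frechet_derivative_turn gram_jet_turn ..
  then show ?thesis
    using cos_sin_pos a_pos[of t0] by (simp add: spin_orbit gram_jet_orbit)
qed

lemma surface_integral_clifford:
  "surface_integral a (clifford t0 \<alpha>) (\<lambda>u. \<phi> u * c) =
     c * torus_density * integral (cbox (0, 0) (2 * pi, 2 * pi)) \<phi>"
proof -
  have "surface_integral a (clifford t0 \<alpha>) (\<lambda>u. \<phi> u * c) =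
      integral (cbox (0, 0) (2 * pi, 2 * pi)) (\<lambda>u. (c * torus_density) * \<phi> u)"
    unfolding surface_integral_def gram_clifford by (intro integral_cong) (simp add: mult_ac)
  then show ?thesis by (simp only: integral_mult_right)
qed

lemma torus_density_pos: "torus_density > 0"
  using cos_sin_pos a_pos[of t0] by simp

lemma smooth_torus_map_torus_normal: "smooth_torus_map (torus_normal p q)"
  unfolding torus_normal_turn by (rule smooth_torus_map_turn)

lemma flrw_torus_normal:
  "flrw a (clifford t0 \<alpha> u) (torus_normal p q u) (torus_normal p' q' u) = - p * p' + q * q'"
proof -
  \<comment> \<open>Sine and cosine are generalized to arbitrary reals, so that the sum of their
    squares stays visible until the Pythagorean identity is applied.\<close>
  have "flrw a torus_point (p, of_real (q * S / a t0), of_real (- q * C / a t0))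
      (p', of_real (q' * S / a t0), of_real (- q' * C / a t0)) = - p * p' + q * q' * (S\<^sup>2 + C\<^sup>2)" for S C :: real
    using a_pos[of t0]
    by (simp add: flrw_def inner_prod_def inner_complex_def field_simps power2_eq_square)
  from this[of "sin \<alpha>" "cos \<alpha>"] show ?thesis
    unfolding torus_normal_turn unfolding clifford_eq_turn flrw_turn by simp
qed

lemma normal_field_torus_normal: "normal_field a (clifford t0 \<alpha>) (torus_normal p q)"
  unfolding normal_field_def
proof (intro conjI allI)
  fix u v
  have n: "time_normal u \<in> tangent_space (clifford t0 \<alpha> u)"
    "flrw a (clifford t0 \<alpha> u) (time_normal u) (partial v (clifford t0 \<alpha>) u) = 0"
    unfolding frechet_derivative_clifford
    by (simp_all add: time_normal_def tangent_space_def flrw_def zero_prod_def[symmetric])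
  note \<nu> = clifford_normal_unit(1,3)[of a t0 \<alpha> u, OF a_pos]
  show "torus_normal p q u \<in> tangent_space (clifford t0 \<alpha> u)"
    using n(1) \<nu>(1) by (simp add: tangent_space_def inner_add_right)
  show "flrw a (clifford t0 \<alpha> u) (torus_normal p q u) (partial v (clifford t0 \<alpha>) u) = 0"
    using n(2) \<nu>(2)[of v] by (simp add: flrw_def inner_add_left distrib_left algebra_simps)
qed (rule smooth_torus_map_torus_normal)

lemma willmore_gradient_clifford:
  "willmore_gradient a (clifford t0 \<alpha>) (torus_normal p q) (\<lambda>u. torus_gradient p q)"
  unfolding willmore_gradient_def surface_integral_clifford
  using first_variation_clifford(2) smooth_torus_map_const by blast

text \<open>\<open>lagrange_multiplier\<close> is a condition on all variations, so uniqueness of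
  the multiplier requires an actual one. The tori with moving \<open>t\<close> and
  \<open>\<alpha>\<close> provide it for \<open>\<phi> = 1\<close>.\<close>

lemma exists_variation_clifford:
  "\<exists>\<epsilon> F. variation a (clifford t0 \<alpha>) (\<lambda>u. 1 *\<^sub>R torus_normal p q u) \<epsilon> F"
proof -
  define F where "F s = clifford (t0 + p * s) (\<alpha> - q * s / a t0)" for s
  define m where "m = min \<alpha> (pi / 2 - \<alpha>)"
  \<comment> \<open>Keeps the change of the angle below \<open>m\<close>, its distance to the ends
    of \<open>(0, pi / 2)\<close>; the summand 1 admits \<open>q = 0\<close>.\<close>
  define \<epsilon> where "\<epsilon> = m * a t0 / (\<bar>q\<bar> + 1)"
  have a0: "a t0 > 0" by (rule a_pos)
  have \<epsilon>: "\<epsilon> > 0" using \<alpha> a0 by (simp add: \<epsilon>_def m_def add_nonneg_pos)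
  have pos: "0 < cos (\<alpha> - q * s / a t0)" "0 < sin (\<alpha> - q * s / a t0)" if "s \<in> {-\<epsilon><..<\<epsilon>}" for s
  proof -
    have "\<bar>q * s\<bar> \<le> (\<bar>q\<bar> + 1) * \<bar>s\<bar>" by (simp add: abs_mult algebra_simps)
    also have "\<dots> < (\<bar>q\<bar> + 1) * \<epsilon>" using that by (intro mult_strict_left_mono) auto
    also have "\<dots> = m * a t0" by (simp add: \<epsilon>_def)
    finally have "\<bar>q * s / a t0\<bar> < m"
      using a0 by (simp add: abs_mult pos_divide_less_eq)
    moreover have "m \<le> \<alpha>" "m \<le> pi / 2 - \<alpha>" by (simp_all add: m_def)
    ultimately have "0 < \<alpha> - q * s / a t0" "\<alpha> - q * s / a t0 < pi / 2" by linarith+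
    then show "0 < cos (\<alpha> - q * s / a t0)" "0 < sin (\<alpha> - q * s / a t0)"
      by (auto intro: cos_gt_zero_pi sin_gt_zero)
  qed
  have "smooth_on ({-\<epsilon><..<\<epsilon>} \<times> UNIV) (\<lambda>(s, u). F s u)"
  proof -
    have o: "open ({-\<epsilon><..<\<epsilon>} \<times> (UNIV :: (real \<times> real) set))" by (intro open_Times) auto
    have "(\<lambda>(s, u). F s u) = (\<lambda>z. (t0 + p * fst z, cos (\<alpha> - q * fst z * (1 / a t0)) *\<^sub>R cis (fst (snd z)),
        sin (\<alpha> - q * fst z * (1 / a t0)) *\<^sub>R cis (snd (snd z))))"
      by (auto simp: F_def clifford_def fun_eq_iff)
    then show ?thesis
      by (simp only:) (intro smooth_on_Pair smooth_on_add smooth_on_scaleR smooth_on_sin smooth_on_cos smooth_on_cis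
        smooth_on_diff smooth_on_mult smooth_on_fst smooth_on_snd smooth_on_ident smooth_on_const o)
  qed
  moreover have "spacelike_torus a (F s)" if "s \<in> {-\<epsilon><..<\<epsilon>}" for s
    unfolding F_def by (rule spacelike_torus_clifford[OF pos[OF that]])
  moreover have "F 0 = clifford t0 \<alpha>" by (simp add: F_def)
  moreover have "((\<lambda>s. F s u) has_vector_derivative 1 *\<^sub>R torus_normal p q u) (at 0)" for u
    unfolding F_def clifford_def case_prod_beta has_vector_derivative_def
    by (auto intro!: derivative_eq_intros
      simp: a0 less_imp_neq[OF a0, symmetric] time_normal_def clifford_normal_def case_prod_beta fun_eq_iff algebra_simps)
  ultimately show ?thesis using \<epsilon> unfolding variation_def by blast
qed

text \<open>Both first variations are multiples of the same integral of \<open>\<phi>\<close>; by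
  \<open>nz\<close> the one of area determines that integral, hence also the Willmore
  variation.\<close>

lemma area_constrained_willmore_clifford:
  assumes nz: "torus_P * p + torus_H * q \<noteq> 0"
  shows "area_constrained_willmore a (clifford t0 \<alpha>) (torus_normal p q)"
    and "lagrange_multiplier a (clifford t0 \<alpha>) (torus_normal p q) lam \<longleftrightarrow>
      lam = torus_gradient p q / (torus_P * p + torus_H * q)"
proof -
  note v = first_variation_clifford[where p = p and q = q]
  let ?I = "\<lambda>\<phi>. integral (cbox (0, 0) (2 * pi, 2 * pi)) \<phi> :: real"
  show "area_constrained_willmore a (clifford t0 \<alpha>) (torus_normal p q)"
    unfolding area_constrained_willmore_def
  proof (intro conjI allI impI)
    show "spacelike_torus a (clifford t0 \<alpha>)" by (rule spacelike_torus_clifford[OF cos_sin_pos])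
    show "normal_field a (clifford t0 \<alpha>) (torus_normal p q)" by (rule normal_field_torus_normal)
    fix u
    show "torus_normal p q u \<noteq> 0"
    proof
      assume "torus_normal p q u = 0"
      \<comment> \<open>Pairing with \<open>n\<close> and with \<open>\<nu>\<close> isolates
        \<open>p\<close> and \<open>q\<close>, which cannot both vanish by
        \<open>nz\<close>.\<close>
      then have "flrw a (clifford t0 \<alpha> u) (torus_normal p q u) (torus_normal p' q' u) = 0" for p' q'
        by (simp add: flrw_def)
      then have "- p * p' + q * q' = 0" for p' q' unfolding flrw_torus_normal .
      from this[of 1 0] this[of 0 1] nz show False by simp
    qed
  next
    fix \<phi> \<epsilon> F
    assume \<phi>: "smooth_torus_map \<phi>"
      and V: "variation a (clifford t0 \<alpha>) (\<lambda>u. \<phi> u *\<^sub>R torus_normal p q u) \<epsilon> F"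
      and A: "\<forall>s\<in>{-\<epsilon><..<\<epsilon>}. area a (F s) = area a (clifford t0 \<alpha>)"
    have "0 \<in> {-\<epsilon><..<\<epsilon>}" using V by (simp add: variation_def)
    then have "((\<lambda>s. area a (F s)) has_real_derivative 0) (at 0)"
      by (rule has_field_derivative_transform_within_open[OF DERIV_const open_greaterThanLessThan]) (simp add: A)
    then have "(torus_P * p + torus_H * q) * torus_density * ?I \<phi> = 0"
      using v(1)[OF V \<phi>] DERIV_unique by blast
    then have "?I \<phi> = 0" using nz torus_density_pos by (metis mult_eq_0_iff less_irrefl)
    then show "((\<lambda>s. willmore a (F s)) has_real_derivative 0) (at 0)"
      using v(2)[OF V \<phi>] by simp
  qed
  show "lagrange_multiplier a (clifford t0 \<alpha>) (torus_normal p q) lam \<longleftrightarrow>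
      lam = torus_gradient p q / (torus_P * p + torus_H * q)"
  proof
    assume lm: "lagrange_multiplier a (clifford t0 \<alpha>) (torus_normal p q) lam"
    obtain \<epsilon> F where V: "variation a (clifford t0 \<alpha>) (\<lambda>u. 1 *\<^sub>R torus_normal p q u) \<epsilon> F"
      using exists_variation_clifford by blast
    note one = smooth_torus_map_const[of "1 :: real"]
    obtain A where A: "((\<lambda>s. area a (F s)) has_real_derivative A) (at 0)"
      "((\<lambda>s. willmore a (F s)) has_real_derivative lam * A) (at 0)"
      using lm one V unfolding lagrange_multiplier_def by blast
    have "A = (torus_P * p + torus_H * q) * torus_density * ?I (\<lambda>_. 1)"
      and "lam * A = torus_gradient p q * torus_density * ?I (\<lambda>_. 1)"
      using A v[OF V one] DERIV_unique by blast+
    \<comment> \<open>For \<open>\<phi> = 1\<close> the common factor is the area of the parameter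
      square, so it can be cancelled.\<close>
    moreover have "?I (\<lambda>_. 1) \<noteq> 0" by (simp add: content_Pair)
    ultimately have "lam * (torus_P * p + torus_H * q) = torus_gradient p q"
      using torus_density_pos by auto
    then show "lam = torus_gradient p q / (torus_P * p + torus_H * q)"
      using nz by (simp add: eq_divide_eq)
  next
    assume lam: "lam = torus_gradient p q / (torus_P * p + torus_H * q)"
    show "lagrange_multiplier a (clifford t0 \<alpha>) (torus_normal p q) lam"
      unfolding lagrange_multiplier_def
    proof (intro allI impI)
      fix \<phi> \<epsilon> F
      assume \<phi>: "smooth_torus_map \<phi>"
        and V: "variation a (clifford t0 \<alpha>) (\<lambda>u. \<phi> u *\<^sub>R torus_normal p q u) \<epsilon> F"
      have "torus_gradient p q = lam * (torus_P * p + torus_H * q)"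
        using nz unfolding lam by simp
      then have "torus_gradient p q * torus_density * ?I \<phi> =
          lam * ((torus_P * p + torus_H * q) * torus_density * ?I \<phi>)"
        by (simp only: mult.assoc)
      with v[OF V \<phi>] show "\<exists>A. ((\<lambda>s. area a (F s)) has_real_derivative A) (at 0) \<and>
          ((\<lambda>s. willmore a (F s)) has_real_derivative lam * A) (at 0)" by metis
    qed
  qed
qed

section \<open>Curvature quantities of the Clifford torus\<close>

lemma mean_curvature_vector_clifford:
  "mean_curvature_vector a (clifford t0 \<alpha>) u = torus_normal (- torus_P) torus_H u"
proof -
  have "mean_curvature_vector a (clifford t0 \<alpha>) u = turn u (mean_curvature_jet a (orbit_jet torus_point))"
    unfolding jet_geometry(2)[OF spacelike_torus_clifford[OF cos_sin_pos]]
    unfolding clifford_eq_turn jet_turn mean_curvature_jet_turn ..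
  also have "mean_curvature_jet a (orbit_jet torus_point) = torus_velocity (- torus_P) torus_H"
    unfolding torus_H_eq using cos_sin_pos a_pos[of t0]
    by (subst mean_curvature_jet_orbit) (simp_all add: field_simps power2_eq_square)
  finally show ?thesis by (simp only: torus_normal_turn)
qed

lemma curvature_clifford:
  defines "f \<equiv> clifford t0 \<alpha>" and "\<nu> \<equiv> clifford_normal a t0 \<alpha>"
  shows "tr_h a f u (second_form a f \<nu> u) = torus_H"
    and "tr_h a f u (second_form a f time_normal u) = torus_P"
    and "norm_h_sq a f u (tracefree_form a f \<nu> u) = torus_H\<^sup>2 / 2 + 2 / (a t0)\<^sup>2"
proof -
  define h1 h2 where "h1 = (a t0 * cos \<alpha>)\<^sup>2" and "h2 = (a t0 * sin \<alpha>)\<^sup>2"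
  have a0: "a t0 > 0" by (rule a_pos)
  have h: "h1 > 0" "h2 > 0" using cos_sin_pos a0 by (simp_all add: h1_def h2_def)
  have I: "induced_metric a f u e1 e1 = h1" "induced_metric a f u e2 e2 = h2"
    "induced_metric a f u e1 e2 = 0" "induced_metric a f u e2 e1 = 0"
    unfolding induced_metric_def f_def unfolding clifford_eq_turn frechet_derivative_turn flrw_turn
    by (simp_all add: spin_orbit flrw_def inner_prod_def inner_complex_def h1_def h2_def power2_eq_square)
  have tr: "tr_h a f u T = T e1 e1 / h1 + T e2 e2 / h2" for T :: "real \<times> real \<Rightarrow> real \<times> real \<Rightarrow> real"
    using h by (simp add: tr_h_def gram_def I field_simps)
  define k1 k2 where "k1 = tan \<alpha> / a t0" and "k2 = - cot \<alpha> / a t0"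
  have S: "second_form a f \<nu> u e1 j = k1 * induced_metric a f u e1 j"
    "second_form a f \<nu> u e2 j = k2 * induced_metric a f u e2 j" for j
    unfolding second_form_def f_def \<nu>_def
      clifford_principal_curvatures[OF a_deriv[OF a_smooth a_pos] a0 \<alpha>] induced_metric_def k1_def k2_def
    by (simp_all add: flrw_def algebra_simps)
  show H: "tr_h a f u (second_form a f \<nu> u) = torus_H"
    using h unfolding tr S I by (simp add: k1_def k2_def diff_divide_distrib)
  have kH: "torus_H = k1 + k2" by (simp add: k1_def k2_def diff_divide_distrib)
  have k: "k1 * k2 = - 1 / (a t0)\<^sup>2"
    using cos_sin_pos a0 by (simp add: k1_def k2_def tan_def cot_def power2_eq_square)
  have T: "tracefree_form a f \<nu> u e1 e1 = (k1 - k2) / 2 * h1" "tracefree_form a f \<nu> u e2 e2 = - (k1 - k2) / 2 * h2"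
    "tracefree_form a f \<nu> u e1 e2 = 0" "tracefree_form a f \<nu> u e2 e1 = 0"
    unfolding tracefree_form_def H kH S I by (simp_all add: field_simps)
  have "norm_h_sq a f u (tracefree_form a f \<nu> u) = (k1 - k2)\<^sup>2 / 2"
    using h unfolding norm_h_sq_def tr T by (simp add: field_simps power2_eq_square)
  \<comment> \<open>The product of the principal curvatures does not depend on
    \<open>\<alpha>\<close>, so the trace-free norm is a function of \<open>H\<close> and
    \<open>a t0\<close>.\<close>
  also have "(k1 - k2)\<^sup>2 = (k1 + k2)\<^sup>2 - 4 * (k1 * k2)" by (simp add: algebra_simps power2_eq_square)
  finally show "norm_h_sq a f u (tracefree_form a f \<nu> u) = torus_H\<^sup>2 / 2 + 2 / (a t0)\<^sup>2"
    unfolding kH k by (simp add: field_simps)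
  have F: "fst (f u) = t0" and nz: "snd (f u) \<noteq> 0"
    using cos_sin_pos by (auto simp: f_def clifford_def case_prod_beta prod_eq_iff)
  have n: "time_normal u \<in> tangent_space (f u)" by (simp add: time_normal_def tangent_space_def zero_prod_def[symmetric])
  have p: "partial i f u \<in> tangent_space (f u)" for i
    using spacelike_torus_clifford[OF cos_sin_pos, of t0] unfolding f_def[symmetric]
    by (intro partial_in_tangent_space) (auto simp: spacelike_torus_def smooth_torus_map_def)
  have dn: "partial i time_normal u = 0" for i by (simp add: time_normal_def)
  have f0: "fst (partial i f u) = 0" for i by (simp add: f_def frechet_derivative_clifford)
  \<comment> \<open>Slices are umbilic: \<open>n\<close> changes along the torus by the Hubble rate
    times the tangent, and the trace doubles that rate.\<close>
  have "nabla_along a f i time_normal u = (deriv a t0 / a t0) *\<^sub>R partial i f u" for i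
    unfolding nabla_along_def levi_civita_flrw[OF a_smooth a_pos nz p n] F dn
    by (simp add: tangent_part_def time_normal_def zero_prod_def[symmetric] prod_eq_iff f0)
  then have "second_form a f time_normal u i j = (deriv a t0 / a t0) * induced_metric a f u i j" for i j
    by (simp add: second_form_def induced_metric_def flrw_def algebra_simps)
  then show "tr_h a f u (second_form a f time_normal u) = torus_P"
    using h unfolding tr by (simp add: I)
qed

text \<open>The first derivative of \<open>a\<close> is traded for \<open>P\<close>, to match the
  multiplier formula. The second derivative occurs in the direction \<open>\<nu>\<close>
  only.\<close>

lemma Einstein_clifford:
  "Ein a (clifford t0 \<alpha> u) (time_normal u) (time_normal u) = 3 * (1 / (a t0)\<^sup>2 + torus_P\<^sup>2 / 4)"
  "Ein a (clifford t0 \<alpha> u) (clifford_normal a t0 \<alpha> u) (clifford_normal a t0 \<alpha> u) =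
     - (2 * deriv (deriv a) t0 / a t0 + 1 / (a t0)\<^sup>2 + torus_P\<^sup>2 / 4)"
proof -
  let ?x = "clifford t0 \<alpha> u" and ?\<nu> = "clifford_normal a t0 \<alpha> u"
  have a0: "a t0 > 0" by (rule a_pos)
  have F: "fst ?x = t0" by (simp add: clifford_def case_prod_beta)
  have x: "norm (snd ?x) = 1"
    using spacelike_torus_clifford[OF cos_sin_pos, of t0] by (auto simp: spacelike_torus_def spacetime_def)
  have n: "time_normal u \<in> tangent_space ?x" by (simp add: time_normal_def tangent_space_def zero_prod_def[symmetric])
  note \<nu> = clifford_normal_unit(1,2)[of a t0 \<alpha> u, OF a0]
  have \<nu>0: "fst ?\<nu> = 0" by (simp add: clifford_normal_def case_prod_beta)
  then have \<nu>1: "snd ?\<nu> \<bullet> snd ?\<nu> = 1 / (a t0)\<^sup>2"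
    using \<nu>(2) a0 by (simp add: flrw_def F field_simps)
  show "Ein a ?x (time_normal u) (time_normal u) = 3 * (1 / (a t0)\<^sup>2 + torus_P\<^sup>2 / 4)"
    unfolding Ein_flrw[OF a_smooth a_pos x n n] F using a0
    by (simp add: time_normal_def zero_prod_def[symmetric] field_simps power2_eq_square)
  show "Ein a ?x ?\<nu> ?\<nu> = - (2 * deriv (deriv a) t0 / a t0 + 1 / (a t0)\<^sup>2 + torus_P\<^sup>2 / 4)"
    unfolding Ein_flrw[OF a_smooth a_pos x \<nu>(1) \<nu>(1)] F \<nu>0 \<nu>1 using a0
    by (simp add: field_simps power2_eq_square)
qed

end

end
theorem proposition6p5:
  fixes a :: "real \<Rightarrow> real" and t0 \<alpha> :: real
  assumes "smooth_on UNIV a" and "\<And>t. a t > 0" and "0 < \<alpha>" and "\<alpha> < pi / 2"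
  shows "let f = clifford t0 \<alpha>;
             n = time_normal;
             \<nu> = clifford_normal a t0 \<alpha>;
             H = (\<lambda>u. tr_h a f u (second_form a f \<nu> u));
             P = (\<lambda>u. tr_h a f u (second_form a f n u));
             B2 = (\<lambda>u. norm_h_sq a f u (tracefree_form a f \<nu> u));
             \<mu> = (\<lambda>u. Ein a (f u) (n u) (n u));
             Hvec = mean_curvature_vector a f;
             Hstar = (\<lambda>u. H u *\<^sub>R n u - P u *\<^sub>R \<nu> u);
             V = (\<lambda>\<beta> u. Hvec u + \<beta> *\<^sub>R Hstar u)
         in ((\<forall>u. (H u)\<^sup>2 - (P u)\<^sup>2 \<noteq> 0) \<longrightarrow>
               (\<exists>W Wstar. willmore_gradient a f Hvec W \<and> willmore_gradient a f Hstar Wstar \<and>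
                 (\<forall>\<beta>. area_constrained_willmore a f (V \<beta>) \<and>
                   (\<exists>lam. (\<forall>lam'. lagrange_multiplier a f (V \<beta>) lam' \<longleftrightarrow> lam' = lam) \<and>
                     (\<forall>u. lam = (W u + \<beta> * Wstar u) / ((H u)\<^sup>2 - (P u)\<^sup>2)) \<and>
                     (\<forall>u. lam * ((H u)\<^sup>2 - (P u)\<^sup>2) =
                        - (1 / 2) * ((H u)\<^sup>2 - (P u)\<^sup>2)\<^sup>2
                        - ((H u)\<^sup>2 + (P u)\<^sup>2 - 2 * \<beta> * H u * P u) * B2 u
                        - 2 * H u * (H u - \<beta> * P u) * \<mu> u
                        - 2 * P u * (P u - \<beta> * H u) * Ein a (f u) (\<nu> u) (\<nu> u)))))) \<and>
            ((\<forall>u. (H u)\<^sup>2 - (P u)\<^sup>2 = 0) \<longrightarrow>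
               (\<forall>b c. let l = (\<lambda>u. n u + \<nu> u); k = (\<lambda>u. n u - \<nu> u);
                          U = (\<lambda>u. b *\<^sub>R l u + c *\<^sub>R k u)
                      in (\<forall>u. flrw a (f u) (U u) (Hvec u) \<noteq> 0) \<longrightarrow>
                           area_constrained_willmore a f U \<and> (\<exists>lam. lagrange_multiplier a f U lam)))"
proof -
  let ?f = "clifford t0 \<alpha>" and ?\<nu> = "clifford_normal a t0 \<alpha>"
  define H where "H = (tan \<alpha> - cot \<alpha>) / a t0"
  define P where "P = 2 * deriv a t0 / a t0"
  define N where "N p q u = p *\<^sub>R time_normal u + q *\<^sub>R ?\<nu> u" for p q :: real and u
  define w where "w p q = - 8 * deriv a t0 * deriv (deriv a) t0 / (a t0)\<^sup>2 * p
     - (8 / (a t0)\<^sup>2 + H\<^sup>2 + P\<^sup>2) * H * q" for p q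
  \<comment> \<open>In \<open>H\<close>, \<open>P\<close>, \<open>r\<close>, \<open>e\<close> and
    \<open>\<beta>\<close> the remaining computations are polynomial identities; \<open>- r\<close>
    is the product of the principal curvatures.\<close>
  define r e where "r = 1 / (a t0)\<^sup>2" and "e = deriv (deriv a) t0 / a t0"
  have a0: "a t0 > 0" by (rule assms(2))
  have wre: "w p q = - 4 * P * e * p - (8 * r + H\<^sup>2 + P\<^sup>2) * H * q" for p q
    by (simp add: w_def P_def r_def e_def power2_eq_square)
  have N: "N p q = (\<lambda>u. p *\<^sub>R time_normal u + q *\<^sub>R ?\<nu> u)" for p q by (simp add: N_def fun_eq_iff)
  have mc: "mean_curvature_vector a ?f = N (- P) H"
    using mean_curvature_vector_clifford[OF assms] by (simp add: fun_eq_iff N_def P_def H_def)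
  have Hstar: "(\<lambda>u. H *\<^sub>R time_normal u - P *\<^sub>R ?\<nu> u) = N H (- P)"
    by (simp add: fun_eq_iff N_def)
  have V: "(\<lambda>u. N (- P) H u + \<beta> *\<^sub>R (H *\<^sub>R time_normal u - P *\<^sub>R ?\<nu> u)) = N (\<beta> * H - P) (H - \<beta> * P)" for \<beta>
    by (simp add: fun_eq_iff N_def algebra_simps)
  have U: "b *\<^sub>R (time_normal u + ?\<nu> u) + c *\<^sub>R (time_normal u - ?\<nu> u) = N (b + c) (b - c) u" for b c u
    by (simp add: N_def algebra_simps)
  have grad: "willmore_gradient a ?f (N p q) (\<lambda>u. w p q)" for p q
    using willmore_gradient_clifford[OF assms, where p = p and q = q] unfolding N w_def H_def P_def .
  have acw: "area_constrained_willmore a ?f (N p q)"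
    and lm: "lagrange_multiplier a ?f (N p q) lam \<longleftrightarrow> lam = w p q / (P * p + H * q)"
    if "P * p + H * q \<noteq> 0" for p q lam
    using area_constrained_willmore_clifford(1)[OF assms, where p = p and q = q]
      area_constrained_willmore_clifford(2)[OF assms, where p = p and q = q and lam = lam] that
    unfolding N w_def H_def P_def by blast+
  have fl: "flrw a (?f u) (N p q u) (N p' q' u) = - p * p' + q * q'" for p q p' q' u
    unfolding N by (rule flrw_torus_normal[OF assms])
  note curv = curvature_clifford[OF assms, where ?t0.0 = t0, folded H_def P_def r_def]
    Einstein_clifford[OF assms, where ?t0.0 = t0, folded P_def r_def]
  have Ein_\<nu>: "Ein a (?f u) (?\<nu> u) (?\<nu> u) = - (2 * e + r + P\<^sup>2 / 4)" for u
    using curv(5)[where u = u] by (simp add: e_def)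
  have B2: "norm_h_sq a ?f u (tracefree_form a ?f ?\<nu> u) = H\<^sup>2 / 2 + 2 * r" for u
    using curv(3)[where u = u] by (simp add: r_def)
  \<comment> \<open>The rate of change of area along \<open>V_\<beta>\<close>. It is independent of
    \<open>\<beta>\<close>, because \<open>Hstar\<close> is orthogonal to the mean curvature
    vector.\<close>
  have slope: "P * (\<beta> * H - P) + H * (H - \<beta> * P) = H\<^sup>2 - P\<^sup>2" for \<beta>
    by (simp add: algebra_simps power2_eq_square)
  have split: "w (\<beta> * H - P) (H - \<beta> * P) = w (- P) H + \<beta> * w H (- P)" for \<beta>
    by (simp add: wre algebra_simps)
  \<comment> \<open>The asserted right-hand side with the values of \<open>B2\<close>,
    \<open>\<mu>\<close> and \<open>Ein(\<nu>, \<nu>)\<close> inserted; only the last supplies terms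
    in \<open>e\<close>.\<close>
  have formula: "w (\<beta> * H - P) (H - \<beta> * P) =
      - (1 / 2) * (H\<^sup>2 - P\<^sup>2)\<^sup>2 - (H\<^sup>2 + P\<^sup>2 - 2 * \<beta> * H * P) * (H\<^sup>2 / 2 + 2 * r)
      - 2 * H * (H - \<beta> * P) * (3 * (r + P\<^sup>2 / 4)) - 2 * P * (P - \<beta> * H) * - (2 * e + r + P\<^sup>2 / 4)" for \<beta>
    by (simp add: wre field_simps power2_eq_square)
  show ?thesis
    unfolding Let_def curv(1,2,4) Ein_\<nu> B2 Hstar mc V U fl
  proof (intro conjI impI allI)
    assume "\<forall>u::real \<times> real. H\<^sup>2 - P\<^sup>2 \<noteq> 0"
    then have nz: "H\<^sup>2 - P\<^sup>2 \<noteq> 0" by simp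
    define lam where "lam \<beta> = w (\<beta> * H - P) (H - \<beta> * P) / (H\<^sup>2 - P\<^sup>2)" for \<beta>
    have "area_constrained_willmore a ?f (N (\<beta> * H - P) (H - \<beta> * P))"
      "lagrange_multiplier a ?f (N (\<beta> * H - P) (H - \<beta> * P)) lam' \<longleftrightarrow> lam' = lam \<beta>" for \<beta> lam'
      using acw[of "\<beta> * H - P" "H - \<beta> * P"] lm[of "\<beta> * H - P" "H - \<beta> * P" lam'] nz
      unfolding slope lam_def by blast+
    moreover have "lam \<beta> = (w (- P) H + \<beta> * w H (- P)) / (H\<^sup>2 - P\<^sup>2)" for \<beta>
      unfolding lam_def split ..
    moreover have "lam \<beta> * (H\<^sup>2 - P\<^sup>2) =
      - (1 / 2) * (H\<^sup>2 - P\<^sup>2)\<^sup>2 - (H\<^sup>2 + P\<^sup>2 - 2 * \<beta> * H * P) * (H\<^sup>2 / 2 + 2 * r)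
      - 2 * H * (H - \<beta> * P) * (3 * (r + P\<^sup>2 / 4)) - 2 * P * (P - \<beta> * H) * - (2 * e + r + P\<^sup>2 / 4)" for \<beta>
      using nz unfolding lam_def formula[symmetric] by simp
    ultimately have main: "area_constrained_willmore a ?f (N (\<beta> * H - P) (H - \<beta> * P)) \<and>
        (\<exists>lam. (\<forall>lam'. lagrange_multiplier a ?f (N (\<beta> * H - P) (H - \<beta> * P)) lam' \<longleftrightarrow> lam' = lam) \<and>
          (\<forall>u::real \<times> real. lam = (w (- P) H + \<beta> * w H (- P)) / (H\<^sup>2 - P\<^sup>2)) \<and>
          (\<forall>u::real \<times> real. lam * (H\<^sup>2 - P\<^sup>2) =
              - (1 / 2) * (H\<^sup>2 - P\<^sup>2)\<^sup>2 - (H\<^sup>2 + P\<^sup>2 - 2 * \<beta> * H * P) * (H\<^sup>2 / 2 + 2 * r)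
              - 2 * H * (H - \<beta> * P) * (3 * (r + P\<^sup>2 / 4)) - 2 * P * (P - \<beta> * H) * - (2 * e + r + P\<^sup>2 / 4)))" for \<beta>
      by (intro conjI exI[of _ "lam \<beta>"] allI)
    \<comment> \<open>By homogeneity of the torus both gradients are constant functions.\<close>
    show "\<exists>W Wstar. willmore_gradient a ?f (N (- P) H) W \<and> willmore_gradient a ?f (N H (- P)) Wstar \<and>
       (\<forall>\<beta>. area_constrained_willmore a ?f (N (\<beta> * H - P) (H - \<beta> * P)) \<and>
         (\<exists>lam. (\<forall>lam'. lagrange_multiplier a ?f (N (\<beta> * H - P) (H - \<beta> * P)) lam' \<longleftrightarrow> lam' = lam) \<and>
           (\<forall>u. lam = (W u + \<beta> * Wstar u) / (H\<^sup>2 - P\<^sup>2)) \<and>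
           (\<forall>u::real \<times> real. lam * (H\<^sup>2 - P\<^sup>2) =
              - (1 / 2) * (H\<^sup>2 - P\<^sup>2)\<^sup>2 - (H\<^sup>2 + P\<^sup>2 - 2 * \<beta> * H * P) * (H\<^sup>2 / 2 + 2 * r)
              - 2 * H * (H - \<beta> * P) * (3 * (r + P\<^sup>2 / 4)) - 2 * P * (P - \<beta> * H) * - (2 * e + r + P\<^sup>2 / 4))))"
      by (rule exI[of _ "\<lambda>_. w (- P) H"], rule exI[of _ "\<lambda>_. w H (- P)"]) (intro conjI[OF grad conjI[OF grad]] allI main)
  next
    fix b c
    \<comment> \<open>Transversality of \<open>U\<close>, which is
      \<open>(b + c) n + (b - c) \<nu>\<close>; the product with the mean curvature vector is again
      the rate of change of area along \<open>U\<close>.\<close>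
    assume "\<forall>u::real \<times> real. - (b + c) * - P + (b - c) * H \<noteq> 0"
    then have nz: "P * (b + c) + H * (b - c) \<noteq> 0" by (simp add: algebra_simps)
    show "area_constrained_willmore a ?f (N (b + c) (b - c))" by (rule acw[OF nz])
    show "\<exists>lam. lagrange_multiplier a ?f (N (b + c) (b - c)) lam" using lm[OF nz] by blast
  qed
qed

end
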